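(* Let $\mathcal{V}^c(R)$, $c\in\mathbb{C}$, be the elliptic (extended) Etingof--Kazhdan $h$-adic quantum vertex algebra, $\mathcal{A}_{h,p}(\widehat{\mathfrak{gl}}_2)$ the elliptic quantum algebra of level zero with $p=ah^{2b}$ ($a\in\mathbb{R}_{>0}$, $b\in\mathbb{Z}_{>0}$), $\sigma,\rho,\tau$ the maps defined in the context and $\phi=z_2e^{2z_0}$. Let $(W,Y_W)$ be a $(\sigma,\rho,\tau)$-deformed $\phi$-coordinated $\mathcal{V}^c(R)$-module. Write $$Y_W(t_{ij}^{(0,-1)}\boldsymbol{1},z^2)=\sum_{n\in\mathbb{Z}}(t_{ij}^{(0,-1)}\boldsymbol{1})_n\,z^{-n},\qquad i,j=1,2,$$ with $(t_{ij}^{(0,-1)}\boldsymbol{1})_n\in\mathrm{End}\,W$, and suppose that for all $i,j=1,2$ $$\mathrm{Im}\,(t_{ij}^{(0,-1)}\boldsymbol{1})_n\subseteq h^{bn}W\quad\text{for all } n>0,$$ $$(t_{ij}^{(0,-1)}\boldsymbol{1})_n=0\quad\text{if}\quad(-1)^{i+j}\neq(-1)^n .$$ Then the assignment $$L(z)_W:=Y_W(T^0(0)\boldsymbol{1},z^2)$$ defines a structure of $\mathcal{A}_{h,p}(\widehat{\mathfrak{gl}}_2)$-module over $W$.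
   Context: General conventions. $h$ is a formal parameter; a $\mathbb{C}[[h]]$-module $U$ is topologically free if $U=U^0[[h]]$ for a complex vector space $U^0$; then $U((z))_h=U^0((z))[[h]]$ and tensor products are $h$-adically completed. Subscripts of matrices indicate tensor factors; $\mathrm{i}$ is the imaginary unit. $Y_W(v,z^2)$ is the series in $z$ obtained from $Y_W(v,z)\in\mathrm{Hom}(W,W((z^{1/2}))_h)$ by replacing $z^{1/2}$ with $z$. Elliptic $R$-matrix. Let $(z;p)_\infty=\prod_{k\geqslant0}(1-zp^k)$, $f(z)=\frac{(z;q^4)_\infty(zq^4;q^4)_\infty}{(zq^2;q^4)_\infty^2}\in\mathbb{C}(q)[[z]]$, $$\alpha(z)=\frac{(p^{1/2}qz;p)_\infty}{(p^{1/2}q^{-1}z;p)_\infty}\prod_{k\geqslant1}f(p^kz^2),\qquad\beta(z)=\frac{(-pqz;p)_\infty}{(-pq^{-1}z;p)_\infty}\prod_{k\geqslant1}f(p^kz^2).$$ In the basis $e_1\otimes e_1,e_1\otimes e_2,e_2\otimes e_1,e_2\otimes e_2$ of $\mathbb{C}^2\otimes\mathbb{C}^2$ put $$R(z)=\begin{pmatrix}a(z)&0&0&d(z)\\0&b(z)&c(z)&0\\0&c(z)&b(z)&0\\d(z)&0&0&a(z)\end{pmatrix},$$ where the entries are uniquely determined by $a(z)+d(z)=q^{-1/2}f(z^2)^{-1}\frac{\alpha(z^{-1})}{\alpha(z)}$, $b(z)+c(z)=q^{1/2}f(z^2)^{-1}\frac{1+q^{-1}z}{1+qz}\frac{\beta(z^{-1})}{\beta(z)}$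 and the requirement that $a,b$ (resp. $c,d$) contain only even (resp. odd) powers of $z$. Fix $a\in\mathbb{R}_{>0}$, $b\in\mathbb{Z}_{>0}$ and set $q^{1/2}=e^{h/4}$, $p=ah^{2b}$ (so $p^{1/2}=a^{1/2}h^b$). Then $R(z)\in(\mathrm{End}\,\mathbb{C}^2)^{\otimes2}((z))[[h]]$, and it can be regarded as an element of $(\mathrm{End}\,\mathbb{C}^2)^{\otimes2}(z)[[h]]$. For $\varepsilon\in\mathbb Z$ the additive $R$-matrix $R(e^{u+\varepsilon\pi\mathrm{i}}):=R((-1)^\varepsilon e^u)$ is expanded in $((u))[[h]]$. Product notation. For $u=(u_1,\ldots,u_n)$, $v=(v_1,\ldots,v_m)$, $\varepsilon\in\{0,1\}^n$, $\nu\in\{0,1\}^m$, $d\in\mathbb{C}$ put $u^\varepsilon=(u_p+\varepsilon_p\pi\mathrm{i})_p$, $v^\nu=(v_q+\nu_q\pi\mathrm{i})_q$; $R^{12}_{nm}(ze^{u^\varepsilon-v^\nu+dh})$ is the product of the factors $R_{pq}(z(-1)^{\varepsilon_p-\nu_{q-n}}e^{u_p-v_{q-n}+dh})$, $1\leqslant p\leqslant n<q\leqslant n+m$, in $(\mathrm{End}\,\mathbb{C}^2)^{\otimes(n+m)}$, ordered from left to right by increasing $p$ and, for fixed $p$, by decreasing $q$, expanded in nonnegative powers of $u_p,v_q,h$. Also $R^{01}_{1n}(e^{u-v^\varepsilon+dh})=R_{0n}((-1)^{\varepsilon_n}e^{u-v_n+dh})\cdots R_{01}((-1)^{\varepsilon_1}e^{u-v_1+dh})$,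 expanded in nonnegative powers of the $v_i$. Elliptic quantum algebra. $\mathcal{A}_{h,p}(\widehat{\mathfrak{gl}}_2)$ (level zero) is the topologically free associative algebra over $\mathbb{C}[[h]]$ generated by $\bar L_{ij,n}$, $i,j\in\{1,2\}$, $n\in\mathbb{Z}$, where $\bar L_{ij,n}=0$ if $(-1)^{i+j}\neq(-1)^n$, with defining relations $R(z_1/z_2)L_1(z_1)L_2(z_2)=L_2(z_2)L_1(z_1)R(z_1/z_2)$ for $L(z)=\sum e_{ij}\otimes L_{ij}(z)$, $L_{ij}(z)=\delta_{ij}-\sum_{n\in\mathbb{Z}}L_{ij,n}z^{-n}$, $L_{ij,n}=(-p^{1/2})^{\max\{n,0\}}\bar L_{ij,n}$. $L(z)_W$ denotes the action of $L(z)$ on a module $W$. The $h$-adic quantum vertex algebra $\mathcal{V}^c(R)$. $\mathrm{U}(R)$ is the topologically free associative $\mathbb{C}[[h]]$-algebra generated by $t_{ij}^{(\varepsilon,-r)}$, $i,j=1,2$, $\varepsilon=0,1$, $r\geqslant1$, with relations $R_{12}((-1)^{\varepsilon_1-\varepsilon_2}e^{u_1-u_2})T_1^{\varepsilon_1}(u_1)T_2^{\varepsilon_2}(u_2)=T_2^{\varepsilon_2}(u_2)T_1^{\varepsilon_1}(u_1)R_{12}((-1)^{\varepsilon_1-\varepsilon_2}e^{u_1-u_2})$ for $\varepsilon_1,\varepsilon_2\in\{0,1\}$, where $T^\varepsilon(u)=\sum e_{ij}\otimes t^\varepsilon_{ij}(u)$, $t_{ij}^\varepsilon(u)=\delta_{ij}-\sum_{r\geqslant1}t_{ij}^{(\varepsilon,-r)}u^{r-1}$.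 $\mathcal{V}^c(R)$ is the $\mathbb{C}[[h]]$-module $\mathrm{U}(R)$, with vacuum vector its unit $\boldsymbol{1}$; $T^\varepsilon(u)$ acts by left multiplication. There is a unique invertible $T^-(u)\in\mathrm{End}\,\mathbb{C}^2\otimes\mathrm{Hom}(\mathrm{U}(R),\mathrm{U}(R)((u))_h)$ with $T_0^-(u)T_1^{\varepsilon_1}(v_1)\cdots T_n^{\varepsilon_n}(v_n)\boldsymbol{1}=R^{01}_{1n}(e^{u-v^\varepsilon+hc/2})^{-1}T_1^{\varepsilon_1}(v_1)\cdots T_n^{\varepsilon_n}(v_n)R^{01}_{1n}(e^{u-v^\varepsilon-hc/2})\boldsymbol{1}$ for all $n\geqslant 0$, $\varepsilon\in\{0,1\}^n$. $T^-(u+\pi\mathrm{i})$ is the series given by the same formula with every $\varepsilon_k$ in the $R$-matrix arguments replaced by $1-\varepsilon_k$. Put $T^\varepsilon_{[n]}(u)=T_1^{\varepsilon_1}(u_1)\cdots T_n^{\varepsilon_n}(u_n)$, $T^\varepsilon_{[n]}(u|z)=T_1^{\varepsilon_1}(z+u_1)\cdots T_n^{\varepsilon_n}(z+u_n)$, $T^-_{[n]}(u^\varepsilon|z)=T_1^-(z+u_1+\varepsilon_1\pi\mathrm{i})\cdots T_n^-(z+u_n+\varepsilon_n\pi\mathrm{i})$. The vertex operator map is determined by $Y(T^\varepsilon_{[n]}(u)\boldsymbol{1},z)=T^\varepsilon_{[n]}(u|z)T^-_{[n]}(u^\varepsilon|z+hc/2)^{-1}$. The map $\tau$ is the involutive algebra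 automorphism of $\mathrm{U}(R)$ given by $t_{ij}^{(\varepsilon,-r)}\mapsto t_{ij}^{(1-\varepsilon,-r)}$. The maps $\sigma,\rho$. They are the unique $\mathbb{C}[[h]]$-module maps $\mathcal{V}^c(R)^{\otimes2}\to\mathcal{V}^c(R)^{\otimes2}\otimes\mathbb{C}(z)[[h]]$ with $$\sigma(z)\big(T^{\varepsilon\,13}_{[n]}(u)T^{\nu\,24}_{[m]}(v)(\boldsymbol{1}\otimes\boldsymbol{1})\big)=R^{12}_{nm}(ze^{u^\varepsilon-v^\nu})T^{\varepsilon\,13}_{[n]}(u)T^{\nu\,24}_{[m]}(v)R^{12}_{nm}(ze^{u^\varepsilon-v^\nu})^{-1}(\boldsymbol{1}\otimes\boldsymbol{1}),$$ $$\rho(z)\big(T^{\varepsilon\,13}_{[n]}(u)T^{\nu\,24}_{[m]}(v)(\boldsymbol{1}\otimes\boldsymbol{1})\big)=T^{\varepsilon\,13}_{[n]}(u)R^{12}_{nm}(ze^{u^\varepsilon-v^\nu+hc})^{-1}T^{\nu\,24}_{[m]}(v)R^{12}_{nm}(ze^{u^\varepsilon-v^\nu})(\boldsymbol{1}\otimes\boldsymbol{1}).$$ Superscripts $1,2$ stand for the matrix tensor factors $1,\ldots,n$ and $n+1,\ldots,n+m$; $3,4$ for the two copies of $\mathcal{V}^c(R)$. Let $\rho(e^z)$ be obtained from $\rho(x)$ by substituting $x=e^z$ and expanding in $\mathbb{C}((z))[[h]]$; $Y^\rho(z)=Y(z)\rho(e^z)$, $Y^\rho(u,z)v=Y^\rho(z)(u\otimes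 v)$. Deformed modules. Let $V=\mathcal{V}^c(R)$ (here $\tau$ has period $M=2$). A $(\sigma,\rho,\tau)$-deformed $\phi$-coordinated $V$-module is a topologically free $\mathbb{C}[[h]]$-module $W$ with a $\mathbb{C}[[h]]$-module map $Y_W(z):V\otimes W\to W((z^{1/2}))_h$, $Y_W(z)(v\otimes w)=Y_W(v,z)w$, such that $Y_W(\boldsymbol{1},z)w=w$ for all $w\in W$; $Y_W(\tau u,z)=\lim_{x^{1/2}\to-z^{1/2}}Y_W(u,x)$ for all $u\in V$; and: (weak $\rho$-associativity) for any $u,v\in V$, $n>0$ there is $r\geqslant0$ such that for every $w\in W$, $(z_1-z_2)^rY_W(u,z_1)Y_W(v,z_2)w=A_w+h^nB_w$ with $A_w\in W((z_1^{1/2},z_2^{1/2}))$, $B_w\in W[[z_1^{\pm1/2},z_2^{\pm1/2}]]$, and $A_w|_{z_1^{1/2}=z_2^{1/2}e^{z_0}}-z_2^r(e^{2z_0}-1)^rY_W(Y^\rho(u,z_0)v,z_2)w\in h^nW[[z_0^{\pm1/2},z_2^{\pm1/2}]]$; ($\sigma$-locality) for any $u,v\in V$, $n>0$ there is $r\geqslant0$ such that for all $w\in W$ $$(z_1-z_2)^rY_W(z_1)(1\otimes Y_W(z_2))\big(\sigma(z_1^{1/2}/z_2^{1/2})(u\otimes v)\otimes w\big)-(z_1-z_2)^rY_W(v,z_2)Y_W(u,z_1)w\in h^nW[[z_1^{\pm1/2},z_2^{\pm1/2}]],$$ where $\sigma$ is expanded in $\mathbb{C}((z_1^{1/2}/z_2^{1/2}))[[h]]$.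 *)

theory Defs
  imports
    "HOL-Analysis.Infinite_Products"
    "HOL-Computational_Algebra.Computational_Algebra"
    "HOL-Library.Poly_Mapping"
begin

section \<open>Modules over power series in h\<close>

text \<open>
  The topologically free module \<open>U = U0[[h]]\<close> is the type \<open>'u fps\<close>, where \<open>'u\<close> is a complex vector
  space whose scalar multiplication is a parameter \<open>sc\<close>; \<open>hscale sc\<close> is the resulting action of
  \<open>\<complex>[[h]]\<close>.  A \<open>\<complex>[[h]]\<close>-linear map between such modules is a \<open>module_hom\<close> (it is automatically
  h-adically continuous).

  The underlying module of the vertex algebra and its tensor square are written with respect to a basis
  of \<open>U0\<close>: \<open>U0 = ('i \<Rightarrow>\<^sub>0 complex)\<close>, so that \<open>U0 \<otimes> U0 = ('i \<times> 'i \<Rightarrow>\<^sub>0 complex)\<close> and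
  \<open>U0 \<otimes> U0 \<otimes> \<complex>(z) = ('i \<times> 'i \<Rightarrow>\<^sub>0 ratfun)\<close>; the h-adically completed tensor products are the types of
  power series in h over these.
\<close>

definition hscale :: "('c \<Rightarrow> 'u \<Rightarrow> 'u) \<Rightarrow> 'c fps \<Rightarrow> 'u fps \<Rightarrow> 'u::comm_monoid_add fps" where
  "hscale sc c x = Abs_fps (\<lambda>n. \<Sum>i\<le>n. sc (fps_nth c i) (fps_nth x (n - i)))"

definition pscale :: "'c \<Rightarrow> ('i \<Rightarrow>\<^sub>0 'c) \<Rightarrow> ('i \<Rightarrow>\<^sub>0 'c::mult_zero)" where
  "pscale c p = Poly_Mapping.map (\<lambda>x. c * x) p"

type_synonym 'i hfree = "('i \<Rightarrow>\<^sub>0 complex) fps"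

text \<open>The submodule \<open>h^n U\<close>.\<close>

definition hpow :: "nat \<Rightarrow> 'u::zero fps set" where
  "hpow n = {x. \<forall>m<n. fps_nth x m = 0}"

text \<open>
  h-adically convergent sums.  As \<open>Sum_any\<close> is 0 for infinite support, \<open>hsummable\<close> is demanded
  explicitly wherever convergence is not automatic.
\<close>

definition hsum :: "('k \<Rightarrow> 'u::comm_monoid_add fps) \<Rightarrow> 'u fps" where
  "hsum f = Abs_fps (\<lambda>N. Sum_any (\<lambda>k. fps_nth (f k) N))"

definition hsummable :: "('k \<Rightarrow> 'u::zero fps) \<Rightarrow> bool" where
  "hsummable f \<longleftrightarrow> (\<forall>N. finite {k. fps_nth (f k) N \<noteq> 0})"

text \<open>\<open>U((z))_h\<close>, for a series given by its coefficients: modulo each power of h only finitely many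
  negative powers of z occur.\<close>

definition laurent_h :: "(int \<Rightarrow> 'u::zero fps) \<Rightarrow> bool" where
  "laurent_h g \<longleftrightarrow> (\<forall>n. \<exists>N. \<forall>k<N. g k \<in> hpow n)"

definition htensor :: "'i hfree \<Rightarrow> 'j hfree \<Rightarrow> ('i \<times> 'j) hfree" where
  "htensor x y = Abs_fps (\<lambda>N. \<Sum>n\<le>N. Abs_poly_mapping
     (\<lambda>(i, j). Poly_Mapping.lookup (fps_nth x n) i * Poly_Mapping.lookup (fps_nth y (N - n)) j))"

section \<open>Rational functions\<close>

type_synonym ratfun = "complex poly fract"

definition rconst :: "complex \<Rightarrow> ratfun" where
  "rconst c = to_fract [:c:]"

definition rvar :: ratfun where
  "rvar = to_fract [:0, 1:]"

text \<open>
  Substitution of an element \<open>x\<close> of an extension field of \<open>\<complex>\<close> (embedded by \<open>emb\<close>) for the variable;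
  used for transcendental \<open>x\<close> only.  With \<open>x = z\<close> in \<open>\<complex>((z))\<close> it is the expansion at 0.
\<close>

definition rat_eval :: "(complex \<Rightarrow> 'l::field) \<Rightarrow> 'l \<Rightarrow> ratfun \<Rightarrow> 'l" where
  "rat_eval emb x r =
     (THE y. \<exists>N D. r = Fract N D \<and> poly (map_poly emb D) x \<noteq> 0 \<and>
        y = poly (map_poly emb N) x / poly (map_poly emb D) x)"

definition expand0 :: "ratfun \<Rightarrow> complex fls" where
  "expand0 = rat_eval fls_const fls_X"

text \<open>The rational function with the given expansion at 0.\<close>

definition unexpand0 :: "complex fls \<Rightarrow> ratfun" where
  "unexpand0 = inv expand0"

definition base_ext :: "'i hfree \<Rightarrow> ('i \<Rightarrow>\<^sub>0 ratfun) fps" where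
  "base_ext x = Abs_fps (\<lambda>n. Poly_Mapping.map rconst (fps_nth x n))"

text \<open>For \<open>s \<in> U0 \<otimes> \<complex>(x)[[h]]\<close> and \<open>X \<in> \<complex>((z))\<close>, the coefficient of \<open>z^k\<close> in \<open>s|x=X\<close>.\<close>

definition subst_coeff :: "complex fls \<Rightarrow> ('i \<Rightarrow>\<^sub>0 ratfun) fps \<Rightarrow> int \<Rightarrow> 'i hfree" where
  "subst_coeff X s k =
     Abs_fps (\<lambda>n. Poly_Mapping.map (\<lambda>r. fls_nth (rat_eval fls_const X r) k) (fps_nth s n))"

definition fls_exp :: "complex fls" where
  "fls_exp = fps_to_fls (fps_exp 1)"

text \<open>The coefficient of \<open>z^k\<close> of an element of \<open>\<complex>((z))[[h]]\<close>.\<close>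

definition lcoeff :: "complex fls fps \<Rightarrow> int \<Rightarrow> complex fps" where
  "lcoeff g k = Abs_fps (\<lambda>n. fls_nth (fps_nth g n) k)"

section \<open>The elliptic R-matrix\<close>

text \<open>
  The infinite products defining \<open>f \<in> \<complex>(q)[[z]]\<close> converge q-adically, in \<open>\<complex>[[z]][[q]]\<close>: here the outer
  variable is q, the inner one is z.  The coefficients of the powers of z are expansions of rational
  functions of q, which can be specialised to \<open>q = exp(h/2)\<close>.
\<close>

definition qpoch4 :: "nat \<Rightarrow> complex fps fps" where
  "qpoch4 s = prodinf (\<lambda>k. 1 - fps_const fps_X * fps_X ^ (s + 4 * k))"

definition f_zq :: "complex fps fps" where
  "f_zq = qpoch4 0 * qpoch4 4 * inverse ((qpoch4 2)\<^sup>2)"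

definition f_coeff :: "nat \<Rightarrow> complex fps" where
  "f_coeff n = fls_regpart (rat_eval fls_const (fps_to_fls (fps_exp (1/2)))
     (unexpand0 (fps_to_fls (Abs_fps (\<lambda>m. fps_nth (fps_nth f_zq m) n)))))"

text \<open>In the following functions of \<open>x\<close>, \<open>x\<close> is \<open>z\<close> or its inverse, and the values are in
  \<open>\<complex>((z))[[h]]\<close>.\<close>

definition emb_h :: "complex fps \<Rightarrow> complex fls fps" where
  "emb_h c = Abs_fps (\<lambda>n. fls_const (fps_nth c n))"

definition p_ell :: "real \<Rightarrow> nat \<Rightarrow> complex fls fps" where
  "p_ell a b = emb_h (fps_const (of_real a) * fps_X ^ (2 * b))"

definition p_half :: "real \<Rightarrow> nat \<Rightarrow> complex fps" where
  "p_half a b = fps_const (of_real (sqrt a)) * fps_X ^ b"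

definition q_pow :: "real \<Rightarrow> complex fls fps" where
  "q_pow t = emb_h (fps_exp (of_real (t / 2)))"

definition poch_p :: "real \<Rightarrow> nat \<Rightarrow> complex fls fps \<Rightarrow> complex fls fps" where
  "poch_p a b y = prodinf (\<lambda>k. 1 - y * p_ell a b ^ k)"

definition f_pk :: "real \<Rightarrow> nat \<Rightarrow> nat \<Rightarrow> complex fls \<Rightarrow> complex fls fps" where
  "f_pk a b k x = suminf (\<lambda>n. emb_h (f_coeff n) * (p_ell a b ^ k * fps_const (x\<^sup>2)) ^ n)"

definition alpha_ell :: "real \<Rightarrow> nat \<Rightarrow> complex fls \<Rightarrow> complex fls fps" where
  "alpha_ell a b x =
     poch_p a b (emb_h (p_half a b) * q_pow 1 * fps_const x) /
     poch_p a b (emb_h (p_half a b) * q_pow (-1) * fps_const x) *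
     prodinf (\<lambda>k. f_pk a b (Suc k) x)"

definition beta_ell :: "real \<Rightarrow> nat \<Rightarrow> complex fls \<Rightarrow> complex fls fps" where
  "beta_ell a b x =
     poch_p a b (- p_ell a b * q_pow 1 * fps_const x) /
     poch_p a b (- p_ell a b * q_pow (-1) * fps_const x) *
     prodinf (\<lambda>k. f_pk a b (Suc k) x)"

text \<open>\<open>f(z^2)\<close> itself is a series in z which does not converge h-adically; it is regrouped by powers
  of h.\<close>

definition f_z2 :: "complex fls fps" where
  "f_z2 = Abs_fps (\<lambda>m. fps_to_fls
     (Abs_fps (\<lambda>j. if even j then fps_nth (f_coeff (j div 2)) m else 0)))"

definition R_apd :: "real \<Rightarrow> nat \<Rightarrow> complex fls fps" where
  "R_apd a b = q_pow (-1/2) * inverse f_z2 *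
     (alpha_ell a b (inverse fls_X) / alpha_ell a b fls_X)"

definition R_bpc :: "real \<Rightarrow> nat \<Rightarrow> complex fls fps" where
  "R_bpc a b = q_pow (1/2) * inverse f_z2 *
     ((1 + q_pow (-1) * fps_const fls_X) / (1 + q_pow 1 * fps_const fls_X)) *
     (beta_ell a b (inverse fls_X) / beta_ell a b fls_X)"

definition even_part :: "complex fls fps \<Rightarrow> complex fls fps" where
  "even_part g = Abs_fps (\<lambda>m. Abs_fls (\<lambda>k. if even k then fls_nth (fps_nth g m) k else 0))"

definition odd_part :: "complex fls fps \<Rightarrow> complex fls fps" where
  "odd_part g = g - even_part g"

text \<open>
  The index set \<open>{1,2}\<close> is \<open>bool\<close>, with \<open>False\<close> for 1 and \<open>True\<close> for 2.  \<open>R_ell a b i1 i2 j1 j2\<close> is the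
  entry in row \<open>e_i1 \<otimes> e_i2\<close> and column \<open>e_j1 \<otimes> e_j2\<close>.
\<close>

definition R_ell :: "real \<Rightarrow> nat \<Rightarrow> bool \<Rightarrow> bool \<Rightarrow> bool \<Rightarrow> bool \<Rightarrow> complex fls fps" where
  "R_ell a b i1 i2 j1 j2 =
     (if i1 = j1 \<and> i2 = j2 then
        (if i1 = i2 then even_part (R_apd a b) else even_part (R_bpc a b))
      else if i1 \<noteq> j1 \<and> i2 \<noteq> j2 then
        (if i1 = i2 then odd_part (R_apd a b) else odd_part (R_bpc a b))
      else 0)"

text \<open>The same entries, regarded as elements of \<open>\<complex>(z)[[h]]\<close>.\<close>

definition R_rat :: "real \<Rightarrow> nat \<Rightarrow> bool \<Rightarrow> bool \<Rightarrow> bool \<Rightarrow> bool \<Rightarrow> ratfun fps" where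
  "R_rat a b i1 i2 j1 j2 = Abs_fps (\<lambda>n. unexpand0 (fps_nth (R_ell a b i1 i2 j1 j2) n))"

section \<open>Products of R-matrices in several variables\<close>

text \<open>
  For \<open>g = \<Sum> g_n h^n \<in> \<complex>(z)[[h]]\<close>, \<open>exp_shift emb \<zeta> d g i j \<in> L[[h]]\<close> is the coefficient of \<open>x^i y^j\<close> in
  \<open>g(\<zeta> exp(x - y + d h))\<close>, expanded in nonnegative powers of x, y and h, where L is an extension field of \<open>\<complex>\<close>
  containing \<open>\<zeta>\<close>.  Each \<open>g_n(\<zeta> exp t)\<close> is expanded in \<open>L[[t]]\<close>, and \<open>t^(i+j+k) = (x - y + d h)^(i+j+k)\<close> by the
  multinomial theorem.  The cases of interest are \<open>\<zeta> = z\<close> in \<open>L = \<complex>(z)\<close> and \<open>\<zeta> = exp u\<close> in \<open>L = \<complex>((u))\<close>,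
  up to sign.
\<close>

definition exp_shift ::
  "(complex \<Rightarrow> 'l::field) \<Rightarrow> 'l \<Rightarrow> complex \<Rightarrow> ratfun fps \<Rightarrow> nat \<Rightarrow> nat \<Rightarrow> 'l fps" where
  "exp_shift emb \<zeta> d g i j = Abs_fps (\<lambda>N. \<Sum>k\<le>N.
     fls_nth (rat_eval (\<lambda>c. fls_const (emb c))
                (fls_const \<zeta> * fps_to_fls (Abs_fps (\<lambda>n. emb (1 / fact n))))
                (fps_nth g (N - k)))
             (int (i + j + k))
     * emb (fact (i + j + k) / (fact i * fact j * fact k) * (-1) ^ j * d ^ k))"

text \<open>
  An element of \<open>(End \<complex>^2)^{\<otimes>N} \<otimes> L[[h]][[x_1,\<dots>,x_N]]\<close>: row index, column index and exponents of
  the variables are lists of length N, with positions numbered from 0.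
\<close>

type_synonym 'l smat = "bool list \<Rightarrow> bool list \<Rightarrow> nat list \<Rightarrow> 'l fps"

definition idx :: "nat \<Rightarrow> bool list set" where
  "idx n = {I. length I = n}"

definition split2 :: "nat list \<Rightarrow> (nat list \<times> nat list) set" where
  "split2 e = {(e1, e2). length e1 = length e \<and> length e2 = length e \<and> map2 (+) e1 e2 = e}"

definition split3 :: "nat list \<Rightarrow> (nat list \<times> nat list \<times> nat list) set" where
  "split3 e = {(e1, e2, e3). length e1 = length e \<and> length e2 = length e \<and> length e3 = length e \<and>
     map2 (+) e1 (map2 (+) e2 e3) = e}"

definition smat_mult :: "nat \<Rightarrow> 'l::field smat \<Rightarrow> 'l smat \<Rightarrow> 'l smat" where
  "smat_mult N A B = (\<lambda>I J e.
     if length I = N \<and> length J = N \<and> length e = N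
     then \<Sum>K\<in>idx N. \<Sum>(e1, e2)\<in>split2 e. A I K e1 * B K J e2 else 0)"

definition smat_one :: "nat \<Rightarrow> 'l::field smat" where
  "smat_one N = (\<lambda>I J e. if length I = N \<and> J = I \<and> e = replicate N 0 then 1 else 0)"

definition smat_inv :: "nat \<Rightarrow> 'l::field smat \<Rightarrow> 'l smat" where
  "smat_inv N A = (THE B.
     (\<forall>I J e. \<not> (length I = N \<and> length J = N \<and> length e = N) \<longrightarrow> B I J e = 0) \<and>
     smat_mult N A B = smat_one N \<and> smat_mult N B A = smat_one N)"

text \<open>\<open>R_pq(\<zeta> exp(x_p - x_q + d h))\<close>\<close>

definition R_factor ::
  "real \<Rightarrow> nat \<Rightarrow> (complex \<Rightarrow> 'l::field) \<Rightarrow> 'l \<Rightarrow> complex \<Rightarrow> nat \<Rightarrow> nat \<Rightarrow> nat \<Rightarrow> 'l smat" where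
  "R_factor a b emb \<zeta> d N p q = (\<lambda>I J e.
     if length I = N \<and> length J = N \<and> length e = N \<and>
        (\<forall>k<N. k \<noteq> p \<and> k \<noteq> q \<longrightarrow> I ! k = J ! k \<and> e ! k = 0)
     then exp_shift emb \<zeta> d (R_rat a b (I ! p) (I ! q) (J ! p) (J ! q)) (e ! p) (e ! q)
     else 0)"

text \<open>
  \<open>R_prod a b emb \<zeta> \<epsilon> \<nu> d\<close> is \<open>R^{12}_{nm}(\<zeta> exp(u^\<epsilon> - v^\<nu> + d h))\<close> with n, m the lengths of the
  sign lists and variables \<open>x = (u, v)\<close>; \<open>\<epsilon>, \<nu>\<close> in \<open>{0,1}\<close> are encoded as \<open>False, True\<close>.
\<close>

definition R_prod ::
  "real \<Rightarrow> nat \<Rightarrow> (complex \<Rightarrow> 'l::field) \<Rightarrow> 'l \<Rightarrow> bool list \<Rightarrow> bool list \<Rightarrow> complex \<Rightarrow> 'l smat" where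
  "R_prod a b emb \<zeta> \<epsilon> \<nu> d = (let n = length \<epsilon>; N = length \<epsilon> + length \<nu> in
     foldr (smat_mult N)
       [R_factor a b emb (if \<epsilon> ! p \<noteq> \<nu> ! (q - n) then - \<zeta> else \<zeta>) d N p q.
          p \<leftarrow> [0..<n], q \<leftarrow> rev [n..<N]]
       (smat_one N))"

section \<open>Topologically free algebras given by generators and relations\<close>

datatype 'g monom_word = Monom_Word "'g list"

instantiation monom_word :: (type) monoid_add
begin

definition zero_monom_word :: "'a monom_word" where
  "zero_monom_word = Monom_Word []"

fun plus_monom_word :: "'a monom_word \<Rightarrow> 'a monom_word \<Rightarrow> 'a monom_word" where
  "plus_monom_word (Monom_Word x) (Monom_Word y) = Monom_Word (x @ y)"

instance
proof
  fix x y z :: "'a monom_word"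
  show "x + y + z = x + (y + z)" by (cases x; cases y; cases z) simp
  show "0 + x = x" by (cases x) (simp add: zero_monom_word_def)
  show "x + 0 = x" by (cases x) (simp add: zero_monom_word_def)
qed

end

text \<open>The h-adically completed free associative algebra \<open>\<complex>\<langle>G\<rangle>[[h]]\<close>.\<close>

type_synonym 'g falg = "('g monom_word \<Rightarrow>\<^sub>0 complex) fps"

definition gen :: "'g \<Rightarrow> 'g falg" where
  "gen g = fps_const (Poly_Mapping.single (Monom_Word [g]) 1)"

text \<open>
  The quotient of the completed free algebra by \<open>tf_ideal rels\<close> is the universal topologically free algebra
  with the given relations: a quotient is topologically free iff the ideal is h-adically closed
  (separatedness) and h-saturated (absence of torsion).
\<close>

definition tf_ideal :: "'a::ring_1 fps set \<Rightarrow> 'a fps set" where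
  "tf_ideal rels = \<Inter>{J. rels \<subseteq> J \<and> 0 \<in> J \<and>
     (\<forall>x\<in>J. \<forall>y\<in>J. x + y \<in> J) \<and>
     (\<forall>x\<in>J. \<forall>y. x * y \<in> J \<and> y * x \<in> J) \<and>
     (\<forall>x. fps_X * x \<in> J \<longrightarrow> x \<in> J) \<and>
     (\<forall>x. (\<forall>n. \<exists>y\<in>J. x - y \<in> hpow n) \<longrightarrow> x \<in> J)}"

text \<open>\<open>\<pi>\<close> identifies \<open>'i hfree\<close> with the topologically free algebra defined by the relations.\<close>

definition presents :: "'g falg set \<Rightarrow> ('g falg \<Rightarrow> 'i hfree) \<Rightarrow> bool" where
  "presents rels \<pi> \<longleftrightarrow>
     module_hom (hscale pscale) (hscale pscale) \<pi> \<and> surj \<pi> \<and> {x. \<pi> x = 0} = tf_ideal rels"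

text \<open>The multiplication of the presented algebra.\<close>

definition amult :: "('g falg \<Rightarrow> 'i hfree) \<Rightarrow> 'i hfree \<Rightarrow> 'i hfree \<Rightarrow> 'i hfree" where
  "amult \<pi> x y = \<pi> (inv \<pi> x * inv \<pi> y)"

text \<open>Structures on \<open>W = 'w fps\<close> of a module over the algebra \<open>\<complex>\<langle>G\<rangle>[[h]] / tf_ideal rels\<close>: unital
  representations by \<open>\<complex>[[h]]\<close>-linear operators, factoring through the quotient.\<close>

definition module_structure ::
  "(complex \<Rightarrow> 'w \<Rightarrow> 'w::ab_group_add) \<Rightarrow> 'g falg set \<Rightarrow> ('g falg \<Rightarrow> 'w fps \<Rightarrow> 'w fps) \<Rightarrow> bool" where
  "module_structure scW rels act \<longleftrightarrow>
     (\<forall>w. module_hom (hscale pscale) (hscale scW) (\<lambda>x. act x w)) \<and>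
     (\<forall>x. module_hom (hscale scW) (hscale scW) (act x)) \<and>
     (\<forall>w. act 1 w = w) \<and>
     (\<forall>x y w. act (x * y) w = act x (act y w)) \<and>
     (\<forall>x\<in>tf_ideal rels. \<forall>w. act x w = 0)"

section \<open>The elliptic quantum algebra\<close>

text \<open>\<open>Lbar i j n\<close> is the generator with indices \<open>ij, n\<close>.\<close>

datatype lgen = Lbar bool bool int

text \<open>The coefficient of \<open>z^k\<close> in \<open>L_ij(z) = \<delta>_ij - \<Sum>_n L_{ij,n} z^{-n}\<close>.\<close>

definition L_coeff :: "real \<Rightarrow> nat \<Rightarrow> bool \<Rightarrow> bool \<Rightarrow> int \<Rightarrow> lgen falg" where
  "L_coeff a b i j k = (if i = j \<and> k = 0 then 1 else 0)
     - hscale pscale ((- p_half a b) ^ nat (max (- k) 0)) (gen (Lbar i j (- k)))"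

text \<open>The coefficient of \<open>z_1^k z_2^l\<close> in \<open>R(z_1/z_2) L_1(z_1) L_2(z_2) - L_2(z_2) L_1(z_1) R(z_1/z_2)\<close>.\<close>

definition RLL_rel ::
  "real \<Rightarrow> nat \<Rightarrow> bool \<Rightarrow> bool \<Rightarrow> bool \<Rightarrow> bool \<Rightarrow> int \<Rightarrow> int \<Rightarrow> lgen falg" where
  "RLL_rel a b i1 i2 j1 j2 k l =
     hsum (\<lambda>n. \<Sum>x\<in>UNIV. \<Sum>y\<in>UNIV. hscale pscale (lcoeff (R_ell a b i1 i2 x y) n)
                 (L_coeff a b x j1 (k - n) * L_coeff a b y j2 (l + n)))
   - hsum (\<lambda>n. \<Sum>x\<in>UNIV. \<Sum>y\<in>UNIV. hscale pscale (lcoeff (R_ell a b x y j1 j2) n)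
                 (L_coeff a b i2 y (l + n) * L_coeff a b i1 x (k - n)))"

definition A_rels :: "real \<Rightarrow> nat \<Rightarrow> lgen falg set" where
  "A_rels a b = {gen (Lbar i j n) |i j n. (i = j) \<noteq> even n}
     \<union> {RLL_rel a b i1 i2 j1 j2 k l |i1 i2 j1 j2 k l. True}"

section \<open>The vertex algebra\<close>

text \<open>\<open>Tgen \<epsilon> i j r\<close> is the generator \<open>t_ij^(\<epsilon>, -r-1)\<close>, so that r ranges over all natural numbers.\<close>

datatype tgen = Tgen bool bool bool nat

text \<open>The coefficient of \<open>u^r\<close> in \<open>t_ij^\<epsilon>(u)\<close>.\<close>

definition t_coeff :: "bool \<Rightarrow> bool \<Rightarrow> bool \<Rightarrow> nat \<Rightarrow> tgen falg" where
  "t_coeff \<epsilon> i j r = (if i = j \<and> r = 0 then 1 else 0) - gen (Tgen \<epsilon> i j r)"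

text \<open>The coefficient of \<open>u_1^k u_2^l\<close> in the defining relation, with \<open>R(\<plusminus>exp(u_1 - u_2))\<close> expanded in
  nonnegative powers of \<open>u_2\<close>.\<close>

definition RTT_rel ::
  "real \<Rightarrow> nat \<Rightarrow> bool \<Rightarrow> bool \<Rightarrow> bool \<Rightarrow> bool \<Rightarrow> bool \<Rightarrow> bool \<Rightarrow> int \<Rightarrow> nat \<Rightarrow> tgen falg" where
  "RTT_rel a b \<epsilon>1 \<epsilon>2 i1 i2 j1 j2 k l =
     (let \<zeta> = (if \<epsilon>1 \<noteq> \<epsilon>2 then - fls_exp else fls_exp);
          R = (\<lambda>x1 x2 y1 y2 s m. lcoeff (exp_shift fls_const \<zeta> 0 (R_rat a b x1 x2 y1 y2) 0 m) s)
      in hsum (\<lambda>r. \<Sum>x\<in>UNIV. \<Sum>y\<in>UNIV. \<Sum>m\<le>l. hscale pscale (R i1 i2 x y (k - int r) m)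
                 (t_coeff \<epsilon>1 x j1 r * t_coeff \<epsilon>2 y j2 (l - m)))
       - hsum (\<lambda>r. \<Sum>x\<in>UNIV. \<Sum>y\<in>UNIV. \<Sum>m\<le>l. hscale pscale (R x y j1 j2 (k - int r) m)
                 (t_coeff \<epsilon>2 i2 y (l - m) * t_coeff \<epsilon>1 i1 x r)))"

definition U_rels :: "real \<Rightarrow> nat \<Rightarrow> tgen falg set" where
  "U_rels a b =
     {RTT_rel a b \<epsilon>1 \<epsilon>2 i1 i2 j1 j2 k l |\<epsilon>1 \<epsilon>2 i1 i2 j1 j2 k l. True}"

text \<open>The entry I, J of the coefficient of \<open>u^e\<close> in \<open>T^\<epsilon>_[n](u)\<close>.\<close>

definition T_word :: "bool list \<Rightarrow> bool list \<Rightarrow> bool list \<Rightarrow> nat list \<Rightarrow> tgen falg" where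
  "T_word \<epsilon> I J e = prod_list (map (\<lambda>k. t_coeff (\<epsilon> ! k) (I ! k) (J ! k) (e ! k)) [0..<length \<epsilon>])"

text \<open>The coefficient of \<open>u^e z^l\<close> in the same entry of \<open>T^\<epsilon>_[n](u|z)\<close>.\<close>

definition T_word_shift ::
  "bool list \<Rightarrow> bool list \<Rightarrow> bool list \<Rightarrow> nat list \<Rightarrow> nat \<Rightarrow> tgen falg" where
  "T_word_shift \<epsilon> I J e l = (\<Sum>s | length s = length \<epsilon> \<and> sum_list s = l.
     prod_list (map (\<lambda>k. of_nat ((e ! k + s ! k) choose (e ! k)) *
                         t_coeff (\<epsilon> ! k) (I ! k) (J ! k) (e ! k + s ! k)) [0..<length \<epsilon>]))"

text \<open>
  \<open>Tm \<delta> i j x k\<close> is the coefficient of \<open>u^k\<close> in \<open>T^-_ij(u + \<delta>\<pi>i) x\<close>.  The matrix factor 0 comes first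
  in the index lists; as \<open>R_prod\<close> also has a variable for it, its exponent is set to 0.
\<close>

definition is_Tminus ::
  "real \<Rightarrow> nat \<Rightarrow> complex \<Rightarrow> (tgen falg \<Rightarrow> 'i hfree) \<Rightarrow>
   (bool \<Rightarrow> bool \<Rightarrow> bool \<Rightarrow> 'i hfree \<Rightarrow> int \<Rightarrow> 'i hfree) \<Rightarrow> bool" where
  "is_Tminus a b c \<pi> Tm \<longleftrightarrow>
     (\<forall>\<delta> i j k. module_hom (hscale pscale) (hscale pscale) (\<lambda>x. Tm \<delta> i j x k)) \<and>
     (\<forall>\<delta> i j x. laurent_h (Tm \<delta> i j x)) \<and>
     (\<forall>\<delta> i j n \<epsilon> I J e k.
        length \<epsilon> = n \<and> length I = n \<and> length J = n \<and> length e = n \<longrightarrow>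
        (let Rp = R_prod a b fls_const fls_exp [\<delta>] \<epsilon> (c / 2);
             Rm = R_prod a b fls_const fls_exp [\<delta>] \<epsilon> (- c / 2)
         in Tm \<delta> i j (\<pi> (T_word \<epsilon> I J e)) k =
            (\<Sum>A\<in>idx n. \<Sum>B\<in>idx n. \<Sum>x\<in>UNIV. \<Sum>(e1, e2, e3)\<in>split3 e.
               hscale pscale
                 (lcoeff (smat_inv (n + 1) Rp (i # I) (x # A) (0 # e1) *
                          Rm (x # B) (j # J) (0 # e3)) k)
                 (\<pi> (T_word \<epsilon> A B e2)))))"

text \<open>\<open>Ti\<close> is the inverse of the matrix of operators \<open>Tm\<close>.\<close>

definition is_op_inverse ::
  "(bool \<Rightarrow> bool \<Rightarrow> bool \<Rightarrow> 'i hfree \<Rightarrow> int \<Rightarrow> 'i hfree) \<Rightarrow>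
   (bool \<Rightarrow> bool \<Rightarrow> bool \<Rightarrow> 'i hfree \<Rightarrow> int \<Rightarrow> 'i hfree) \<Rightarrow> bool" where
  "is_op_inverse Tm Ti \<longleftrightarrow>
     (\<forall>\<delta> i j k. module_hom (hscale pscale) (hscale pscale) (\<lambda>x. Ti \<delta> i j x k)) \<and>
     (\<forall>\<delta> i j x. laurent_h (Ti \<delta> i j x)) \<and>
     (\<forall>(P, Q)\<in>{(Tm, Ti), (Ti, Tm)}. \<forall>\<delta> i j x k.
        (\<forall>y. hsummable (\<lambda>m. P \<delta> i y (Q \<delta> y j x m) (k - m))) \<and>
        (\<Sum>y\<in>UNIV. hsum (\<lambda>m. P \<delta> i y (Q \<delta> y j x m) (k - m)))
          = (if i = j \<and> k = 0 then x else 0))"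

text \<open>The coefficient of \<open>u^e z^m\<close> in the entry i, j of \<open>T^-(z + u + \<delta>\<pi>i + hc/2)^{-1} x\<close>, expanded in
  nonnegative powers of u and h; \<open>(e + s)\<close> is the total power of \<open>u + hc/2\<close>.\<close>

definition Tinv_shift ::
  "complex \<Rightarrow> (bool \<Rightarrow> bool \<Rightarrow> bool \<Rightarrow> 'i hfree \<Rightarrow> int \<Rightarrow> 'i hfree) \<Rightarrow>
   bool \<Rightarrow> bool \<Rightarrow> bool \<Rightarrow> nat \<Rightarrow> 'i hfree \<Rightarrow> int \<Rightarrow> 'i hfree" where
  "Tinv_shift c Ti \<delta> i j e x m = hsum (\<lambda>s::nat.
     hscale pscale
       (fps_const ((of_int (m + int (e + s)) gchoose (e + s)) * of_nat ((e + s) choose e) * (c / 2) ^ s)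
          * fps_X ^ s)
       (Ti \<delta> i j x (m + int (e + s))))"

text \<open>
  The inverse of \<open>T^-_1 \<cdots> T^-_n\<close> is the product of the inverses of the factors in reversed order, so the
  operator belonging to the first matrix factor is applied first.
\<close>

primrec Tinv_prod ::
  "complex \<Rightarrow> (bool \<Rightarrow> bool \<Rightarrow> bool \<Rightarrow> 'i hfree \<Rightarrow> int \<Rightarrow> 'i hfree) \<Rightarrow>
   (bool \<times> bool \<times> bool \<times> nat) list \<Rightarrow> 'i hfree \<Rightarrow> int \<Rightarrow> 'i hfree" where
  "Tinv_prod c Ti [] x k = (if k = 0 then x else 0)"
| "Tinv_prod c Ti (t # ts) x k = (case t of (\<delta>, i, j, e) \<Rightarrow>
     hsum (\<lambda>m. Tinv_prod c Ti ts (Tinv_shift c Ti \<delta> i j e x m) (k - m)))"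

text \<open>\<open>Y s k\<close> is the coefficient of \<open>z^k\<close> in \<open>Y(z) s\<close>, for s in the completed tensor square.\<close>

definition is_vertex_operator ::
  "complex \<Rightarrow> (tgen falg \<Rightarrow> 'i hfree) \<Rightarrow>
   (bool \<Rightarrow> bool \<Rightarrow> bool \<Rightarrow> 'i hfree \<Rightarrow> int \<Rightarrow> 'i hfree) \<Rightarrow>
   (('i \<times> 'i) hfree \<Rightarrow> int \<Rightarrow> 'i hfree) \<Rightarrow> bool" where
  "is_vertex_operator c \<pi> Ti Y \<longleftrightarrow>
     (\<forall>k. module_hom (hscale pscale) (hscale pscale) (\<lambda>s. Y s k)) \<and>
     (\<forall>s. laurent_h (Y s)) \<and>
     (\<forall>n \<epsilon> I J e x k.
        length \<epsilon> = n \<and> length I = n \<and> length J = n \<and> length e = n \<longrightarrow>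
        Y (htensor (\<pi> (T_word \<epsilon> I J e)) x) k =
        (\<Sum>A\<in>idx n. \<Sum>(e1, e2)\<in>split2 e. hsum (\<lambda>l::nat.
           amult \<pi> (\<pi> (T_word_shift \<epsilon> I A e1 l))
             (Tinv_prod c Ti (map (\<lambda>r. (\<epsilon> ! r, A ! r, J ! r, e2 ! r)) [0..<n]) x (k - int l)))))"

definition is_tau :: "(tgen falg \<Rightarrow> 'i hfree) \<Rightarrow> ('i hfree \<Rightarrow> 'i hfree) \<Rightarrow> bool" where
  "is_tau \<pi> \<tau> \<longleftrightarrow>
     module_hom (hscale pscale) (hscale pscale) \<tau> \<and> \<tau> (\<pi> 1) = \<pi> 1 \<and>
     (\<forall>x y. \<tau> (amult \<pi> x y) = amult \<pi> (\<tau> x) (\<tau> y)) \<and> (\<forall>x. \<tau> (\<tau> x) = x) \<and>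
     (\<forall>\<epsilon> i j r. \<tau> (\<pi> (gen (Tgen \<epsilon> i j r))) = \<pi> (gen (Tgen (\<not> \<epsilon>) i j r)))"

definition is_sigma ::
  "real \<Rightarrow> nat \<Rightarrow> (tgen falg \<Rightarrow> 'i hfree) \<Rightarrow>
   (('i \<times> 'i) hfree \<Rightarrow> ('i \<times> 'i \<Rightarrow>\<^sub>0 ratfun) fps) \<Rightarrow> bool" where
  "is_sigma a b \<pi> \<sigma> \<longleftrightarrow>
     module_hom (hscale pscale) (hscale (\<lambda>c. pscale (rconst c))) \<sigma> \<and>
     (\<forall>n m \<epsilon> \<nu> I1 J1 e1 I2 J2 e2.
        length \<epsilon> = n \<and> length I1 = n \<and> length J1 = n \<and> length e1 = n \<and>
        length \<nu> = m \<and> length I2 = m \<and> length J2 = m \<and> length e2 = m \<longrightarrow>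
        (let R = R_prod a b rconst rvar \<epsilon> \<nu> 0
         in \<sigma> (htensor (\<pi> (T_word \<epsilon> I1 J1 e1)) (\<pi> (T_word \<nu> I2 J2 e2))) =
            (\<Sum>A\<in>idx (n + m). \<Sum>B\<in>idx (n + m). \<Sum>(x1, x2, x3)\<in>split3 (e1 @ e2).
               hscale pscale (R (I1 @ I2) A x1 * smat_inv (n + m) R B (J1 @ J2) x3)
                 (base_ext (htensor
                    (\<pi> (T_word \<epsilon> (take n A) (take n B) (take n x2)))
                    (\<pi> (T_word \<nu> (drop n A) (drop n B) (drop n x2))))))))"

definition is_rho ::
  "real \<Rightarrow> nat \<Rightarrow> complex \<Rightarrow> (tgen falg \<Rightarrow> 'i hfree) \<Rightarrow>
   (('i \<times> 'i) hfree \<Rightarrow> ('i \<times> 'i \<Rightarrow>\<^sub>0 ratfun) fps) \<Rightarrow> bool" where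
  "is_rho a b c \<pi> \<rho> \<longleftrightarrow>
     module_hom (hscale pscale) (hscale (\<lambda>c. pscale (rconst c))) \<rho> \<and>
     (\<forall>n m \<epsilon> \<nu> I1 J1 e1 I2 J2 e2.
        length \<epsilon> = n \<and> length I1 = n \<and> length J1 = n \<and> length e1 = n \<and>
        length \<nu> = m \<and> length I2 = m \<and> length J2 = m \<and> length e2 = m \<longrightarrow>
        (let Rc = R_prod a b rconst rvar \<epsilon> \<nu> c; R0 = R_prod a b rconst rvar \<epsilon> \<nu> 0
         in \<rho> (htensor (\<pi> (T_word \<epsilon> I1 J1 e1)) (\<pi> (T_word \<nu> I2 J2 e2))) =
            (\<Sum>A1\<in>idx n. \<Sum>B1\<in>idx n. \<Sum>A2\<in>idx m. \<Sum>B2\<in>idx m.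
             \<Sum>(x1, x2, x3)\<in>split3 (e1 @ e2).
               hscale pscale
                 (smat_inv (n + m) Rc (A1 @ I2) (B1 @ A2) x1 * R0 (B1 @ B2) (J1 @ J2) x3)
                 (base_ext (htensor
                    (\<pi> (T_word \<epsilon> I1 A1 (take n x2)))
                    (\<pi> (T_word \<nu> A2 B2 (drop n x2))))))))"

section \<open>Deformed modules\<close>

text \<open>The coefficient of \<open>z^k\<close> in \<open>Y^\<rho>(u, z) v = Y(z) \<rho>(e^z) (u \<otimes> v)\<close>.\<close>

definition Y_rho ::
  "(('i \<times> 'i) hfree \<Rightarrow> ('i \<times> 'i \<Rightarrow>\<^sub>0 ratfun) fps) \<Rightarrow> (('i \<times> 'i) hfree \<Rightarrow> int \<Rightarrow> 'i hfree) \<Rightarrow>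
   'i hfree \<Rightarrow> 'i hfree \<Rightarrow> int \<Rightarrow> 'i hfree" where
  "Y_rho \<rho> Y u v k = hsum (\<lambda>j. Y (subst_coeff fls_exp (\<rho> (htensor u v)) j) (k - j))"

text \<open>
  \<open>YW v w k\<close> is the coefficient of \<open>z^{k/2}\<close> in \<open>Y_W(v, z) w\<close>.  Likewise series in \<open>z_1^{1/2}, z_2^{1/2}\<close> are
  functions of two integers, the numbers of half powers.

  \<open>YW_YW scW YW s w k l\<close> are the coefficients of \<open>Y_W(z_1)(1 \<otimes> Y_W(z_2))(s \<otimes> w)\<close>.
\<close>

definition YW_YW ::
  "(complex \<Rightarrow> 'w \<Rightarrow> 'w) \<Rightarrow> ('i hfree \<Rightarrow> 'w fps \<Rightarrow> int \<Rightarrow> 'w fps) \<Rightarrow>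
   ('i \<times> 'i) hfree \<Rightarrow> 'w fps \<Rightarrow> int \<Rightarrow> int \<Rightarrow> 'w::ab_group_add fps" where
  "YW_YW scW YW s w k l = Abs_fps (\<lambda>N. \<Sum>n\<le>N. \<Sum>(i, j)\<in>Poly_Mapping.keys (fps_nth s n).
     scW (Poly_Mapping.lookup (fps_nth s n) (i, j))
       (fps_nth (YW (fps_const (Poly_Mapping.single i 1))
                   (YW (fps_const (Poly_Mapping.single j 1)) w l) k) (N - n)))"

text \<open>Multiplication by \<open>(z_1 - z_2)^r\<close>.\<close>

definition mult_diff ::
  "(complex \<Rightarrow> 'w \<Rightarrow> 'w) \<Rightarrow> nat \<Rightarrow> (int \<Rightarrow> int \<Rightarrow> 'w::ab_group_add fps) \<Rightarrow> int \<Rightarrow> int \<Rightarrow> 'w fps" where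
  "mult_diff scW r G k l = (\<Sum>i\<le>r. hscale scW (fps_const ((-1) ^ i * of_nat (r choose i)))
     (G (k - 2 * int (r - i)) (l - 2 * int i)))"

text \<open>The coefficient of \<open>z_0^s z_2^{m/2}\<close> in \<open>A\<close> at \<open>z_1^{1/2} = z_2^{1/2} e^{z_0}\<close>, for
  \<open>A \<in> W((z_1^{1/2}, z_2^{1/2}))\<close>.\<close>

definition subst_phi ::
  "(complex \<Rightarrow> 'w \<Rightarrow> 'w) \<Rightarrow> (int \<Rightarrow> int \<Rightarrow> 'w::ab_group_add fps) \<Rightarrow> int \<Rightarrow> int \<Rightarrow> 'w fps" where
  "subst_phi scW A s m = (if s < 0 then 0 else
     Sum_any (\<lambda>k. hscale scW (fps_const (of_int k ^ nat s / fact (nat s))) (A k (m - k))))"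

definition weak_rho_associative ::
  "(complex \<Rightarrow> 'w \<Rightarrow> 'w) \<Rightarrow> (('i \<times> 'i) hfree \<Rightarrow> ('i \<times> 'i \<Rightarrow>\<^sub>0 ratfun) fps) \<Rightarrow>
   (('i \<times> 'i) hfree \<Rightarrow> int \<Rightarrow> 'i hfree) \<Rightarrow>
   ('i hfree \<Rightarrow> 'w fps \<Rightarrow> int \<Rightarrow> 'w::ab_group_add fps) \<Rightarrow> bool" where
  "weak_rho_associative scW \<rho> Y YW \<longleftrightarrow>
     (\<forall>u v n. n > 0 \<longrightarrow> (\<exists>r. \<forall>w. \<exists>A.
        (\<exists>N. \<forall>k l. k < N \<or> l < N \<longrightarrow> A k l = 0) \<and>
        (\<forall>k l. mult_diff scW r (\<lambda>k l. YW u (YW v w l) k) k l - A k l \<in> hpow n) \<and>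
        (\<forall>s m. subst_phi scW A s m
                 - hsum (\<lambda>j::nat. hscale scW (fps_const (fps_nth ((fps_exp 2 - 1) ^ r) j))
                           (YW (Y_rho \<rho> Y u v (s - int j)) w (m - 2 * int r)))
               \<in> hpow n)))"

text \<open>
  In the first term, \<open>\<sigma>(z_1^{1/2}/z_2^{1/2})\<close> is expanded as an infinite series, so multiplication by
  \<open>(z_1 - z_2)^r\<close> has to come first; that the resulting sum makes sense modulo \<open>h^n\<close> is part of the condition.
\<close>

definition sigma_local ::
  "(complex \<Rightarrow> 'w \<Rightarrow> 'w) \<Rightarrow> (('i \<times> 'i) hfree \<Rightarrow> ('i \<times> 'i \<Rightarrow>\<^sub>0 ratfun) fps) \<Rightarrow>
   ('i hfree \<Rightarrow> 'w fps \<Rightarrow> int \<Rightarrow> 'w::ab_group_add fps) \<Rightarrow> bool" where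
  "sigma_local scW \<sigma> YW \<longleftrightarrow>
     (\<forall>u v n. n > 0 \<longrightarrow> (\<exists>r. \<forall>w k l.
        let P = (\<lambda>j. mult_diff scW r
                   (YW_YW scW YW (subst_coeff fls_X (\<sigma> (htensor u v)) j) w) (k - j) (l + j))
        in (\<forall>N<n. finite {j. fps_nth (P j) N \<noteq> 0}) \<and>
           hsum P - mult_diff scW r (\<lambda>k l. YW v (YW u w k) l) k l \<in> hpow n))"

definition deformed_module ::
  "(complex \<Rightarrow> 'w \<Rightarrow> 'w) \<Rightarrow> (tgen falg \<Rightarrow> 'i hfree) \<Rightarrow> (('i \<times> 'i) hfree \<Rightarrow> int \<Rightarrow> 'i hfree) \<Rightarrow>
   (('i \<times> 'i) hfree \<Rightarrow> ('i \<times> 'i \<Rightarrow>\<^sub>0 ratfun) fps) \<Rightarrow>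
   (('i \<times> 'i) hfree \<Rightarrow> ('i \<times> 'i \<Rightarrow>\<^sub>0 ratfun) fps) \<Rightarrow> ('i hfree \<Rightarrow> 'i hfree) \<Rightarrow>
   ('i hfree \<Rightarrow> 'w fps \<Rightarrow> int \<Rightarrow> 'w::ab_group_add fps) \<Rightarrow> bool" where
  "deformed_module scW \<pi> Y \<sigma> \<rho> \<tau> YW \<longleftrightarrow>
     vector_space scW \<and>
     (\<forall>w k. module_hom (hscale pscale) (hscale scW) (\<lambda>v. YW v w k)) \<and>
     (\<forall>v k. module_hom (hscale scW) (hscale scW) (\<lambda>w. YW v w k)) \<and>
     (\<forall>v w. laurent_h (YW v w)) \<and>
     (\<forall>w k. YW (\<pi> 1) w k = (if k = 0 then w else 0)) \<and>
     (\<forall>v w k. YW (\<tau> v) w k = (if even k then YW v w k else - YW v w k)) \<and>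
     weak_rho_associative scW \<rho> Y YW \<and>
     sigma_local scW \<sigma> YW"

end

theory Submission
  imports Defs
begin

text \<open>
  Write \<open>L(z) = Y_W(T^0(0)1, z^2)\<close>.  On the generators, locality reads
  \<open>(z_1^2 - z_2^2)^r (R L_1 L_2 R^{-1} - L_2 L_1) \<in> h^n\<close> with \<open>R = R(z_1/z_2)\<close>.  The hypothesis on the
  negative powers of z makes the exponents of \<open>z_1\<close> bounded below modulo \<open>h^n\<close> in both terms, so the factor
  \<open>(z_1^2 - z_2^2)^r\<close> can be cancelled; multiplying by R on the right gives the RLL relation.  The same
  hypothesis allows division by \<open>(-p^{1/2})^n\<close> and thus yields the action of the generators, uniquely since W
  has no h-torsion.

  Locality uses R as a rational function of z and its inverse, so each coefficient of \<open>h^n\<close> in the product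
  formula for R has to be the expansion of a rational function.  All factors are visibly rational at
  each level except \<open>f(z^2)\<close>.  The infinite products give \<open>f(z) f(q^2 z) = (1 - z) / (1 - q^2 z)\<close>; with
  \<open>q^2 = e^h\<close> and \<open>f = \<Sum> f_m(z) h^m\<close> this expresses \<open>2 f_m\<close> by the lower \<open>f_k\<close> and their images under
  powers of \<open>z d/dz\<close>.  Moreover R is the identity modulo h, hence invertible.
\<close>

section \<open>Substitution into rational functions\<close>

text \<open>Much of the work is forced by totality. \<open>THE\<close>, \<open>inv\<close>,
  \<open>prodinf\<close>, \<open>suminf\<close> and \<open>hsum\<close> carry their intended values
  only after existence or convergence is shown; in particular \<open>unexpand0\<close> means
  something only on expansions of rational functions. Rationality is needed in two different
  variables. The coefficients of z^n in f have to be rational in q before q = e^{h/2} can be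
  substituted; the coefficients of h^m have to be rational in z before R can enter locality. The
  second statement is not a specialisation of the first, since a fixed order in h involves all
  powers of z. Both are extracted from the same q-difference equation.

  The other obstacle is that series infinite in both directions in z_1 and z_2 cannot be multiplied
  associatively, and that delta functions are killed by powers of z_1^2 - z_2^2. A one-sided bound
  on the exponents of z_1, modulo each h^n and uniform in z_2, removes both difficulties. As the
  exponent r in locality depends on n, the cancellation is done modulo each h^n separately, before
  any limit.\<close>

locale rat_subst =
  fixes emb :: "complex \<Rightarrow> 'l::field" and x :: 'l
  assumes emb_zero: "emb 0 = 0" and emb_one: "emb 1 = 1"
    and emb_add: "emb (c + d) = emb c + emb d" and emb_mult: "emb (c * d) = emb c * emb d"
    and transcendental: "D \<noteq> 0 \<Longrightarrow> poly (map_poly emb D) x \<noteq> 0"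
begin

definition peval :: "complex poly \<Rightarrow> 'l" where
  "peval P = poly (map_poly emb P) x"

lemma coeff_map_emb: "coeff (map_poly emb P) n = emb (coeff P n)"
  by (simp add: coeff_map_poly emb_zero)

lemma peval_0 [simp]: "peval 0 = 0"
  by (simp add: peval_def)

lemma peval_pCons: "peval (pCons c P) = emb c + x * peval P"
  by (cases "c = 0 \<and> P = 0") (auto simp: peval_def map_poly_pCons emb_zero)

lemma peval_add: "peval (P + Q) = peval P + peval Q"
proof -
  have "map_poly emb (P + Q) = map_poly emb P + map_poly emb Q"
    by (rule poly_eqI) (simp add: coeff_map_emb emb_add)
  then show ?thesis by (simp add: peval_def)
qed

lemma peval_smult: "peval (smult c P) = emb c * peval P"
proof -
  have "map_poly emb (smult c P) = smult (emb c) (map_poly emb P)"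
    by (rule poly_eqI) (simp add: coeff_map_emb emb_mult)
  then show ?thesis by (simp add: peval_def)
qed

lemma peval_mult: "peval (P * Q) = peval P * peval Q"
  by (induction P) (simp_all add: peval_pCons peval_add peval_smult algebra_simps emb_zero)

lemma peval_const: "peval [:c:] = emb c"
  by (simp add: peval_pCons)

lemma peval_1 [simp]: "peval 1 = 1"
  by (simp add: one_pCons peval_const emb_one)

lemma peval_eq_0_iff: "peval P = 0 \<longleftrightarrow> P = 0"
  using transcendental[of P] by (auto simp: peval_def)

text \<open>Cross-multiplication shows that all admissible representations of a fraction give one
  value, and transcendence keeps the denominators nonzero; so the \<open>THE\<close> in
  \<open>rat_eval\<close> denotes that value.\<close>

lemma rat_eval_Fract: "D \<noteq> 0 \<Longrightarrow> rat_eval emb x (Fract N D) = peval N / peval D"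
  unfolding rat_eval_def peval_def[symmetric]
proof (rule the_equality)
  assume D: "D \<noteq> 0"
  then show "\<exists>N' D'. Fract N D = Fract N' D' \<and> peval D' \<noteq> 0 \<and> peval N / peval D = peval N' / peval D'"
    using peval_eq_0_iff by blast
  fix y assume "\<exists>N' D'. Fract N D = Fract N' D' \<and> peval D' \<noteq> 0 \<and> y = peval N' / peval D'"
  then obtain N' D' where *: "Fract N D = Fract N' D'" "peval D' \<noteq> 0" "y = peval N' / peval D'"
    by blast
  then have D': "D' \<noteq> 0" by auto
  have "N * D' = N' * D"
    using *(1) D D' by (simp add: eq_fract)
  then have "peval N * peval D' = peval N' * peval D"
    by (metis peval_mult)
  then show "y = peval N / peval D"
    using *(2,3) D by (simp add: frac_eq_eq peval_eq_0_iff)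
qed

lemma rat_eval_to_fract: "rat_eval emb x (to_fract P) = peval P"
  by (simp add: to_fract_def rat_eval_Fract)

lemma rat_eval_rconst [simp]: "rat_eval emb x (rconst c) = emb c"
  by (simp add: rconst_def rat_eval_to_fract peval_const)

lemma rat_eval_rvar [simp]: "rat_eval emb x rvar = x"
  by (simp add: rvar_def rat_eval_to_fract peval_pCons emb_zero emb_one)

lemma rat_eval_0 [simp]: "rat_eval emb x 0 = 0"
  using rat_eval_to_fract[of 0] by simp

lemma rat_eval_1 [simp]: "rat_eval emb x 1 = 1"
  using rat_eval_to_fract[of 1] by simp

lemma rat_eval_add: "rat_eval emb x (r + s) = rat_eval emb x r + rat_eval emb x s"
  by (cases r; cases s) (simp add: rat_eval_Fract peval_add peval_mult peval_eq_0_iff add_frac_eq)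

lemma rat_eval_mult: "rat_eval emb x (r * s) = rat_eval emb x r * rat_eval emb x s"
  by (cases r; cases s) (simp add: rat_eval_Fract peval_mult)

lemma rat_eval_minus: "rat_eval emb x (- r) = - rat_eval emb x r"
  using rat_eval_add[of r "- r"] by (simp add: eq_neg_iff_add_eq_0 add.commute)

lemma rat_eval_diff: "rat_eval emb x (r - s) = rat_eval emb x r - rat_eval emb x s"
  using rat_eval_add[of r "- s"] by (simp add: rat_eval_minus)

lemma rat_eval_eq_0_iff: "rat_eval emb x r = 0 \<longleftrightarrow> r = 0"
proof -
  have "r * inverse r = 1" if "r \<noteq> 0" using that by simp
  then have "rat_eval emb x r * rat_eval emb x (inverse r) = 1" if "r \<noteq> 0"
    using that by (metis rat_eval_mult rat_eval_1)
  then show ?thesis by (metis mult_zero_left rat_eval_0 zero_neq_one)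
qed

lemma rat_eval_inverse: "rat_eval emb x (inverse r) = inverse (rat_eval emb x r)"
proof (cases "r = 0")
  case False
  then have "rat_eval emb x r * rat_eval emb x (inverse r) = 1"
    by (metis rat_eval_mult rat_eval_1 right_inverse)
  then show ?thesis by (metis inverse_unique)
qed simp

lemma rat_eval_power: "rat_eval emb x (r ^ n) = rat_eval emb x r ^ n"
  by (induction n) (simp_all add: rat_eval_mult)

lemma rat_eval_sum: "rat_eval emb x (sum f A) = (\<Sum>a\<in>A. rat_eval emb x (f a))"
  by (induction A rule: infinite_finite_induct) (simp_all add: rat_eval_add)

lemma rat_eval_inj: "rat_eval emb x r = rat_eval emb x s \<longleftrightarrow> r = s"
  using rat_eval_eq_0_iff[of "r - s"] by (simp add: rat_eval_diff)

end

section \<open>Substituting the variable itself, or a nonconstant power series\<close>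

lemma peval_X:
  fixes P :: "complex poly"
  shows "poly (map_poly fls_const P) fls_X = fps_to_fls (fps_of_poly P)"
proof (induction P)
  case (pCons c P)
  have "map_poly fls_const (pCons c P) = pCons (fls_const c) (map_poly fls_const P)"
    using pCons.hyps by (subst map_poly_pCons) auto
  then have "poly (map_poly fls_const (pCons c P)) fls_X = fls_const c + fls_X * fps_to_fls (fps_of_poly P)"
    using pCons.IH by simp
  also have "\<dots> = fps_to_fls (fps_const c + fps_X * fps_of_poly P)"
    by (simp add: fls_times_fps_to_fls)
  also have "fps_const c + fps_X * fps_of_poly P = fps_of_poly (pCons c P)"
    by (rule fps_ext) (simp add: fps_X_mult_nth coeff_pCons split: nat.split)
  finally show ?case .
qed simp

interpretation X: rat_subst fls_const "fls_X :: complex fls"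
  by unfold_locales (simp_all add: fls_plus_const peval_X fps_of_poly_eq_iff[of _ 0, simplified])

lemma expand0_eq: "expand0 = rat_eval fls_const fls_X"
  by (simp add: expand0_def)

lemma inj_expand0: "inj expand0"
  by (simp add: inj_def expand0_eq X.rat_eval_inj)

lemma unexpand0_expand0 [simp]: "unexpand0 (expand0 r) = r"
  by (simp add: unexpand0_def inj_expand0)

text \<open>Horner evaluation stays within power series and commutes with taking the constant term.
  Nonvanishing can thus be tested there as long as \<open>fps_nth g 0\<close> is not a root.\<close>

lemma peval_fps_nth_0:
  fixes g :: "complex fps"
  shows "\<exists>s. poly (map_poly fls_const P) (fps_to_fls g) = fps_to_fls s \<and> fps_nth s 0 = poly P (fps_nth g 0)"
proof (induction P)
  case (pCons c P)
  then obtain s where s: "poly (map_poly fls_const P) (fps_to_fls g) = fps_to_fls s"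
      "fps_nth s 0 = poly P (fps_nth g 0)"
    by blast
  have "map_poly fls_const (pCons c P) = pCons (fls_const c) (map_poly fls_const P)"
    using pCons.hyps by (subst map_poly_pCons) auto
  then have "poly (map_poly fls_const (pCons c P)) (fps_to_fls g) = fps_to_fls (fps_const c + g * s)"
    by (simp add: s fls_times_fps_to_fls)
  moreover have "fps_nth (fps_const c + g * s) 0 = poly (pCons c P) (fps_nth g 0)"
    by (simp add: s)
  ultimately show ?case by blast
qed (auto intro: exI[of _ 0])

text \<open>A zero of \<open>D\<close> at the constant term \<open>c\<close> of \<open>g\<close> is split off as a factor \<open>X - c\<close>, which \<open>g\<close> does not
  annihilate.\<close>

lemma transcendental_fps:
  fixes g :: "complex fps"
  assumes g: "g \<noteq> fps_const (fps_nth g 0)" and "D \<noteq> 0"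
  shows "poly (map_poly fls_const D) (fps_to_fls g) \<noteq> 0"
  using \<open>D \<noteq> 0\<close>
proof (induction "degree D" arbitrary: D rule: less_induct)
  case less
  let ?c = "fps_nth g 0"
  show ?case
  proof (cases "poly D ?c = 0")
    case False
    then show ?thesis using peval_fps_nth_0[of D g] by auto
  next
    case True
    then obtain E where E: "D = [:- ?c, 1:] * E"
      by (auto simp: poly_eq_0_iff_dvd)
    with less.prems have E0: "E \<noteq> 0" by auto
    have "degree D = Suc (degree E)"
      unfolding E by (subst degree_mult_eq) (use E0 in auto)
    then have IH: "poly (map_poly fls_const E) (fps_to_fls g) \<noteq> 0"
      using less.hyps[of E] E0 by simp
    have "map_poly fls_const D =
        smult (fls_const (- ?c)) (map_poly fls_const E) + pCons 0 (map_poly fls_const E)"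
      unfolding E by (rule poly_eqI) (simp add: coeff_map_poly coeff_pCons fls_minus_const split: nat.split)
    then have "poly (map_poly fls_const D) (fps_to_fls g) =
        poly (smult (fls_const (- ?c)) (map_poly fls_const E) + pCons 0 (map_poly fls_const E)) (fps_to_fls g)"
      by (simp only:)
    also have "\<dots> =
        (fps_to_fls g - fls_const ?c) * poly (map_poly fls_const E) (fps_to_fls g)"
      by (simp add: algebra_simps)
    finally have "poly (map_poly fls_const D) (fps_to_fls g) =
        (fps_to_fls g - fls_const ?c) * poly (map_poly fls_const E) (fps_to_fls g)" .
    moreover have "fps_to_fls g - fls_const ?c \<noteq> 0"
      using g by (metis eq_iff_diff_eq_0 fps_to_fls_eq_iff fps_const_to_fls)
    ultimately show ?thesis using IH by simp
  qed
qed

section \<open>Rationality and limits of h-adic series\<close>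

definition fls_rational :: "complex fls \<Rightarrow> bool" where
  "fls_rational g \<longleftrightarrow> g \<in> range expand0"

lemma expand0_unexpand0: "fls_rational g \<Longrightarrow> expand0 (unexpand0 g) = g"
  by (auto simp: fls_rational_def)

lemma fls_rational_expand0 [simp]: "fls_rational (expand0 r)"
  by (simp add: fls_rational_def)

lemma fls_rational_const [simp]: "fls_rational (fls_const c)"
  unfolding fls_rational_def expand0_eq by (rule range_eqI[of _ _ "rconst c"]) simp

lemma fls_rational_X [simp]: "fls_rational fls_X"
  unfolding fls_rational_def expand0_eq by (rule range_eqI[of _ _ rvar]) simp

lemma fls_rational_0 [simp]: "fls_rational 0"
  using fls_rational_const[of 0] by simp

lemma fls_rational_1 [simp]: "fls_rational 1"
  using fls_rational_const[of 1] by simp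

lemma fls_rational_add: "fls_rational f \<Longrightarrow> fls_rational g \<Longrightarrow> fls_rational (f + g)"
  by (auto simp: fls_rational_def expand0_eq simp flip: X.rat_eval_add)

lemma fls_rational_mult: "fls_rational f \<Longrightarrow> fls_rational g \<Longrightarrow> fls_rational (f * g)"
  by (auto simp: fls_rational_def expand0_eq simp flip: X.rat_eval_mult)

lemma fls_rational_minus: "fls_rational f \<Longrightarrow> fls_rational (- f)"
  by (auto simp: fls_rational_def expand0_eq simp flip: X.rat_eval_minus)

lemma fls_rational_diff: "fls_rational f \<Longrightarrow> fls_rational g \<Longrightarrow> fls_rational (f - g)"
  by (auto simp: fls_rational_def expand0_eq simp flip: X.rat_eval_diff)

lemma fls_rational_inverse: "fls_rational f \<Longrightarrow> fls_rational (inverse f)"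
  by (auto simp: fls_rational_def expand0_eq simp flip: X.rat_eval_inverse)

lemma fls_rational_divide: "fls_rational f \<Longrightarrow> fls_rational g \<Longrightarrow> fls_rational (f / g)"
  by (simp add: divide_inverse fls_rational_mult fls_rational_inverse)

lemma fls_rational_power: "fls_rational f \<Longrightarrow> fls_rational (f ^ n)"
  by (induction n) (simp_all add: fls_rational_mult)

lemma fls_rational_sum: "(\<And>a. a \<in> A \<Longrightarrow> fls_rational (f a)) \<Longrightarrow> fls_rational (sum f A)"
  by (induction A rule: infinite_finite_induct) (simp_all add: fls_rational_add)

lemmas fls_rational_intros =
  fls_rational_add fls_rational_mult fls_rational_minus fls_rational_diff fls_rational_inverse
  fls_rational_divide fls_rational_power fls_rational_sum

lemma fls_rational_peval: "fls_rational (X.peval P)"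
  using fls_rational_expand0[of "to_fract P"] by (simp add: expand0_eq X.rat_eval_to_fract)

lemma fls_rationalE:
  assumes "fls_rational g"
  obtains N D where "D \<noteq> 0" "X.peval D \<noteq> 0" "g = X.peval N / X.peval D"
proof -
  from assms obtain r where r: "g = expand0 r" by (auto simp: fls_rational_def)
  obtain N D where "r = Fract N D" "D \<noteq> 0" by (cases r)
  with r that show ?thesis by (simp add: expand0_eq X.rat_eval_Fract X.peval_eq_0_iff)
qed

text \<open>Differentiating N = g D reduces the claim to polynomials. It serves the operator z d/dz
  in the recurrence for the levels of f.\<close>

lemma fls_rational_deriv:
  assumes "fls_rational g"
  shows "fls_rational (fls_deriv g)"
proof -
  have poly: "fls_rational (fls_deriv (X.peval P))" for P
    by (induction P)
      (auto simp: X.peval_pCons intro!: fls_rational_intros fls_rational_peval)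
  obtain N D where D: "X.peval D \<noteq> 0" "g = X.peval N / X.peval D"
    using assms by (rule fls_rationalE)
  then have "X.peval N = g * X.peval D" by simp
  then have "fls_deriv (X.peval N) = fls_deriv g * X.peval D + g * fls_deriv (X.peval D)"
    by (simp add: add.commute)
  with D(1) have "fls_deriv g = (fls_deriv (X.peval N) - g * fls_deriv (X.peval D)) / X.peval D"
    by (simp add: field_simps)
  with poly assms show ?thesis
    by (simp add: fls_rational_intros fls_rational_peval)
qed

text \<open>Numerator and denominator are composed separately. The cases of interest are z -> z^2 in
  \<open>f_z2\<close> and z -> -z in the parity projections.\<close>

lemma fls_rational_compose:
  assumes "fls_rational g" and H: "fps_nth H 0 = 0" "H \<noteq> 0" and "fls_rational (fps_to_fls H)"
  shows "fls_rational (fls_compose_fps g H)"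
proof -
  have poly: "fls_rational (fls_compose_fps (X.peval P) H)" for P
    by (induction P)
      (auto simp: X.peval_pCons fls_compose_fps_add fls_compose_fps_mult H
        intro!: fls_rational_intros assms)
  obtain N D where D: "X.peval D \<noteq> 0" "g = X.peval N / X.peval D"
    using assms(1) by (rule fls_rationalE)
  then show ?thesis
    using poly H by (simp add: fls_compose_fps_divide fls_rational_divide)
qed

definition h_rational :: "complex fls fps \<Rightarrow> bool" where
  "h_rational g \<longleftrightarrow> (\<forall>n. fls_rational (fps_nth g n))"

lemma h_rational_const [simp]: "fls_rational c \<Longrightarrow> h_rational (fps_const c)"
  by (simp add: h_rational_def)

lemma h_rational_1 [simp]: "h_rational 1"
  using h_rational_const[of 1] by simp

lemma h_rational_emb_h [simp]: "h_rational (emb_h c)"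
  by (simp add: h_rational_def emb_h_def)

lemma h_rational_add: "h_rational f \<Longrightarrow> h_rational g \<Longrightarrow> h_rational (f + g)"
  by (simp add: h_rational_def fls_rational_add)

lemma h_rational_minus: "h_rational f \<Longrightarrow> h_rational (- f)"
  by (simp add: h_rational_def fls_rational_minus)

lemma h_rational_diff: "h_rational f \<Longrightarrow> h_rational g \<Longrightarrow> h_rational (f - g)"
  by (simp add: h_rational_def fls_rational_diff)

lemma h_rational_mult: "h_rational f \<Longrightarrow> h_rational g \<Longrightarrow> h_rational (f * g)"
  by (simp add: h_rational_def fps_mult_nth fls_rational_sum fls_rational_mult)

lemma h_rational_power: "h_rational f \<Longrightarrow> h_rational (f ^ n)"
  by (induction n) (simp_all add: h_rational_mult)

lemma h_rational_sum: "(\<And>a. a \<in> A \<Longrightarrow> h_rational (f a)) \<Longrightarrow> h_rational (sum f A)"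
  by (simp add: h_rational_def fps_sum_nth fls_rational_sum)

lemma h_rational_prod: "(\<And>a. a \<in> A \<Longrightarrow> h_rational (f a)) \<Longrightarrow> h_rational (prod f A)"
  by (induction A rule: infinite_finite_induct) (simp_all add: h_rational_mult)

text \<open>The recursion for the coefficients of an inverse series consists of field operations on
  earlier coefficients.\<close>

lemma h_rational_inverse:
  assumes "h_rational f"
  shows "h_rational (inverse f)"
proof -
  have "fls_rational (natfun_inverse f n)" for n
  proof (induction n rule: less_induct)
    case (less n)
    show ?case
      by (cases n) (use assms less in \<open>auto simp: h_rational_def intro!: fls_rational_intros\<close>)
  qed
  then show ?thesis by (simp add: h_rational_def fps_inverse_def)
qed

lemma h_rational_divide:
  assumes "h_rational f" "h_rational g" "fps_nth g 0 \<noteq> 0"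
  shows "h_rational (f / g)"
  using assms by (simp add: fps_divide_unit h_rational_mult h_rational_inverse)

lemmas h_rational_intros =
  h_rational_add h_rational_minus h_rational_diff h_rational_mult h_rational_power h_rational_sum
  h_rational_prod h_rational_inverse h_rational_divide

section \<open>The h-adic filtration and the limits of infinite products and sums\<close>

lemma hpow_mult_right: "x \<in> hpow n \<Longrightarrow> x * y \<in> hpow n" for x y :: "'a::semiring_0 fps"
  by (auto simp: hpow_def fps_mult_nth intro!: sum.neutral)

lemma hpow_mult: "x \<in> hpow m \<Longrightarrow> y \<in> hpow n \<Longrightarrow> x * y \<in> hpow (m + n)" for x y :: "'a::semiring_0 fps"
proof -
  assume x: "x \<in> hpow m" and y: "y \<in> hpow n"
  have "fps_nth x i * fps_nth y (k - i) = 0" if "k < m + n" "i \<le> k" for k i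
  proof (cases "i < m")
    case False
    then have "k - i < n" using that by linarith
    then show ?thesis using y by (simp add: hpow_def)
  qed (use x in \<open>simp add: hpow_def\<close>)
  then show "x * y \<in> hpow (m + n)"
    by (auto simp: hpow_def fps_mult_nth intro!: sum.neutral)
qed

lemma hpow_power: "x \<in> hpow m \<Longrightarrow> x ^ n \<in> hpow (m * n)" for x :: "'a::semiring_1 fps"
  by (induction n) (auto simp: hpow_mult hpow_def[of 0])

lemma hpow_antimono: "m \<le> n \<Longrightarrow> x \<in> hpow n \<Longrightarrow> x \<in> hpow m"
  by (auto simp: hpow_def)

lemma hpow_X_power: "fps_X ^ n \<in> hpow n"
  by (simp add: hpow_def fps_X_power_nth)

text \<open>Modulo h^(n+1) all factors beyond the n-th are 1, so every coefficient of the partial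
  products stabilises. The condition on \<open>g 0\<close> concerns the one factor about which
  membership in \<open>hpow 0\<close> says nothing.\<close>

lemma prodinf_fps_nth:
  fixes g :: "nat \<Rightarrow> 'a::idom fps"
  assumes g: "\<And>i. g i - 1 \<in> hpow i" and g0: "fps_nth (g 0) 0 \<noteq> 0"
  assumes "N \<le> n"
  shows "fps_nth (prodinf g) N = fps_nth (\<Prod>i\<le>n. g i) N"
proof -
  define P where "P n = (\<Prod>i\<le>n. g i)" for n
  define L where "L = Abs_fps (\<lambda>N. fps_nth (P N) N)"
  have step: "fps_nth (P (Suc n)) N = fps_nth (P n) N" if "N \<le> n" for n N
  proof -
    have "(g (Suc n) - 1) * P n \<in> hpow (Suc n)"
      using g by (rule hpow_mult_right)
    then have "fps_nth ((g (Suc n) - 1) * P n) N = 0"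
      using that by (simp add: hpow_def)
    moreover have "P (Suc n) - P n = (g (Suc n) - 1) * P n"
      by (simp add: P_def algebra_simps)
    ultimately have "fps_nth (P (Suc n) - P n) N = 0" by (simp only:)
    then show ?thesis by simp
  qed
  have L: "fps_nth (P n) N = fps_nth L N" if "N \<le> n" for n N
    using that by (induction rule: dec_induct) (simp_all add: L_def step)
  have "P \<longlonglongrightarrow> L"
    by (rule tendsto_fpsI) (use L in \<open>unfold eventually_sequentially, blast\<close>)
  \<comment> \<open>\<open>raw_has_prod\<close> demands a nonzero limit; here its constant term is
    that of \<open>g 0\<close>.\<close>
  moreover have "fps_nth L 0 \<noteq> 0"
    using g0 by (simp add: L_def P_def)
  moreover have "P = (\<lambda>n. \<Prod>i\<le>n. g i)" by (simp add: P_def fun_eq_iff)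
  ultimately have "g has_prod L"
    by (auto simp: has_prod_def raw_has_prod_def)
  then have "prodinf g = L" by (rule has_prod_unique[symmetric])
  then show ?thesis
    using L[OF \<open>N \<le> n\<close>] by (simp add: P_def)
qed

lemma suminf_fps_nth:
  fixes g :: "nat \<Rightarrow> 'a::ab_group_add fps"
  assumes g: "\<And>i. g i \<in> hpow i"
  shows "fps_nth (suminf g) N = fps_nth (\<Sum>i\<le>N. g i) N"
proof -
  define L where "L = Abs_fps (\<lambda>N. fps_nth (\<Sum>i\<le>N. g i) N)"
  have L: "fps_nth (sum g {..<n}) N = fps_nth L N" if "Suc N \<le> n" for n N
    using that
  proof (induction rule: dec_induct)
    case (step n)
    then show ?case using g[of n] by (simp add: hpow_def)
  qed (simp add: L_def lessThan_Suc_atMost)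
  then have "(\<lambda>n. sum g {..<n}) \<longlonglongrightarrow> L"
    by (intro tendsto_fpsI) (auto simp: eventually_sequentially)
  then have "suminf g = L" unfolding sums_def[symmetric] by (rule sums_unique[symmetric])
  then show ?thesis by (simp add: L_def)
qed

lemma h_rational_prodinf:
  assumes "\<And>i. g i - 1 \<in> hpow i" and "fps_nth (g 0) 0 \<noteq> 0" and "\<And>i. h_rational (g i)"
  shows "h_rational (prodinf g)"
  unfolding h_rational_def
proof
  fix N
  have "h_rational (\<Prod>i\<le>N. g i)" using assms(3) by (rule h_rational_prod)
  then show "fls_rational (fps_nth (prodinf g) N)"
    by (simp add: h_rational_def prodinf_fps_nth[OF assms(1,2) order.refl])
qed

lemma h_rational_suminf:
  assumes "\<And>i. g i \<in> hpow i" and "\<And>i. h_rational (g i)"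
  shows "h_rational (suminf g)"
  unfolding h_rational_def
proof
  fix N
  have "h_rational (\<Sum>i\<le>N. g i)" using assms(2) by (rule h_rational_sum)
  then show "fls_rational (fps_nth (suminf g) N)"
    by (simp only: h_rational_def suminf_fps_nth[OF assms(1)])
qed

section \<open>The functional equation of f\<close>

text \<open>The products in \<open>qpoch4\<close> are q-adic limits, with q as outer variable. The
  substitution z -> q^2 z is composition with a linear series only when z is the outer variable and
  q belongs to the coefficients.\<close>

definition swap_fps :: "complex fps fps \<Rightarrow> complex fps fps" where
  "swap_fps A = Abs_fps (\<lambda>n. Abs_fps (\<lambda>m. fps_nth (fps_nth A m) n))"

lemma swap_fps_nth [simp]: "fps_nth (fps_nth (swap_fps A) n) m = fps_nth (fps_nth A m) n"
  by (simp add: swap_fps_def)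

lemma fps2_eqI: "(\<And>n m. fps_nth (fps_nth A n) m = fps_nth (fps_nth B n) m) \<Longrightarrow> A = B"
  by (intro fps_ext)

lemma fps2_mult_nth:
  "fps_nth (fps_nth (A * B) n) m =
    (\<Sum>i\<le>n. \<Sum>j\<le>m. fps_nth (fps_nth A i) j * fps_nth (fps_nth B (n - i)) (m - j))"
  by (simp add: fps_mult_nth fps_sum_nth atLeast0AtMost)

lemma swap_fps_mult: "swap_fps (A * B) = swap_fps A * swap_fps B"
  by (rule fps2_eqI) (simp only: fps2_mult_nth swap_fps_nth, rule sum.swap)

lemma swap_fps_1: "swap_fps 1 = 1"
  by (rule fps2_eqI) simp

text \<open>With z outside and q inside this is 1 - q^s z; \<open>qprod s K\<close> and
  \<open>qinf s\<close> are the finite and infinite Pochhammer symbols of q^s z in base q^4.\<close>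

definition qlin :: "nat \<Rightarrow> complex fps fps" where
  "qlin s = 1 - fps_const (fps_X ^ s) * fps_X"

definition qprod :: "nat \<Rightarrow> nat \<Rightarrow> complex fps fps" where
  "qprod s K = (\<Prod>k<K. qlin (s + 4 * k))"

lemma swap_fps_factor: "swap_fps (1 - fps_const fps_X * fps_X ^ s) = qlin s"
  by (rule fps2_eqI) (auto simp: qlin_def fps_X_def[symmetric] fps_mult_left_const_nth)

lemma swap_fps_prod: "swap_fps (\<Prod>k\<le>K. 1 - fps_const fps_X * fps_X ^ (s + 4 * k)) = qprod s (Suc K)"
proof -
  have "swap_fps (\<Prod>k<K. 1 - fps_const fps_X * fps_X ^ (s + 4 * k)) = qprod s K" for K
    by (induction K) (simp_all add: qprod_def swap_fps_1 swap_fps_mult swap_fps_factor)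
  from this[of "Suc K"] show ?thesis by (simp only: lessThan_Suc_atMost)
qed

definition qinf :: "nat \<Rightarrow> complex fps fps" where
  "qinf s = swap_fps (qpoch4 s)"

text \<open>Stabilisation is governed by the degree \<open>m\<close> in q, uniformly in the degree
  \<open>n\<close> in z. Identities between finite products pass to the limit through this.\<close>

lemma qinf_nth:
  assumes "m < K"
  shows "fps_nth (fps_nth (qinf s) n) m = fps_nth (fps_nth (qprod s K) n) m"
proof -
  obtain K' where K: "K = Suc K'" "m \<le> K'" using assms by (cases K) auto
  let ?g = "\<lambda>k. 1 - fps_const fps_X * fps_X ^ (s + 4 * k) :: complex fps fps"
  have 1: "?g i - 1 \<in> hpow i" for i
    by (simp add: hpow_def)
  have 2: "fps_nth (?g 0) 0 \<noteq> 0"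
  proof
    assume "fps_nth (?g 0) 0 = 0"
    then have "fps_nth (fps_nth (?g 0) 0) 0 = 0" by (simp only: fps_zero_nth)
    then show False by simp
  qed
  have "fps_nth (qpoch4 s) m = fps_nth (\<Prod>k\<le>K'. ?g k) m"
    unfolding qpoch4_def by (rule prodinf_fps_nth[OF 1 2 K(2)])
  then show ?thesis
    by (simp add: qinf_def K swap_fps_prod[symmetric])
qed

lemma qlin_nth: "fps_nth (qlin s) n = (if n = 0 then 1 else if n = 1 then - (fps_X ^ s) else 0)"
  by (auto simp: qlin_def fps_X_nth)

lemma qlin_compose: "qlin s oo (fps_const (fps_X\<^sup>2) * fps_X) = qlin (s + 2)"
  by (rule fps_ext)
    (simp only: fps_nth_compose_linear qlin_nth, simp add: power_add power2_eq_square mult_ac)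

lemma qprod_compose: "qprod s K oo (fps_const (fps_X\<^sup>2) * fps_X) = qprod (s + 2) K"
  by (simp add: qprod_def fps_compose_prod_distrib qlin_compose)

text \<open>Composition with q^2 z multiplies the n-th coefficient by q^(2n). Coefficient
  \<open>m\<close> of the result reads only degrees at most \<open>m\<close> in q, so the truncation
  at \<open>Suc m\<close> suffices on both sides.\<close>

lemma qinf_compose: "qinf s oo (fps_const (fps_X\<^sup>2) * fps_X) = qinf (s + 2)"
proof (rule fps2_eqI)
  fix n m
  have "fps_nth (fps_nth (qinf s oo (fps_const (fps_X\<^sup>2) * fps_X)) n) m =
      fps_nth (fps_X ^ (2 * n) * fps_nth (qinf s) n) m"
    by (simp only: fps_nth_compose_linear power_mult)
  also have "\<dots> = fps_nth (fps_X ^ (2 * n) * fps_nth (qprod s (Suc m)) n) m"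
    by (simp add: fps_X_power_mult_nth qinf_nth[where K = "Suc m"])
  also have "\<dots> = fps_nth (fps_nth (qprod s (Suc m) oo (fps_const (fps_X\<^sup>2) * fps_X)) n) m"
    by (simp only: fps_nth_compose_linear power_mult)
  also have "\<dots> = fps_nth (fps_nth (qinf (s + 2)) n) m"
    by (simp only: qprod_compose qinf_nth[of m "Suc m"] lessI)
  finally show "fps_nth (fps_nth (qinf s oo (fps_const (fps_X\<^sup>2) * fps_X)) n) m =
      fps_nth (fps_nth (qinf (s + 2)) n) m" .
qed

lemma qprod_Suc: "qprod s (Suc K) = qlin s * qprod (s + 4) K"
  unfolding qprod_def by (subst prod.lessThan_Suc_shift) (simp add: algebra_simps)

lemma qinf_rec: "qinf s = qlin s * qinf (s + 4)"
proof (rule fps2_eqI)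
  fix n m
  have "fps_nth (fps_nth (qinf s) n) m = fps_nth (fps_nth (qlin s * qprod (s + 4) (Suc m)) n) m"
    by (simp only: qinf_nth[of m "Suc (Suc m)"] qprod_Suc less_SucI lessI)
  also have "\<dots> = fps_nth (fps_nth (qlin s * qinf (s + 4)) n) m"
    unfolding fps2_mult_nth by (intro sum.cong refl) (simp add: qinf_nth[where K = "Suc m"])
  finally show "fps_nth (fps_nth (qinf s) n) m = fps_nth (fps_nth (qlin s * qinf (s + 4)) n) m" .
qed

lemma qinf_nth_0: "fps_nth (qinf s) 0 = 1"
proof (rule fps_ext)
  fix m
  have "fps_nth (qprod s K) 0 = 1" for K
    by (induction K) (simp_all add: qprod_def qlin_def)
  then show "fps_nth (fps_nth (qinf s) 0) m = fps_nth 1 m"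
    by (simp only: qinf_nth[of m "Suc m"] lessI)
qed

lemma qinf_nonzero: "qinf s \<noteq> 0"
  using qinf_nth_0[of s] by auto

definition f_series :: "complex fps fps" where
  "f_series = swap_fps f_zq"

lemma f_series_eq: "f_series * (qinf 2)\<^sup>2 = qinf 0 * qinf 4"
proof -
  \<comment> \<open>\<open>inverse\<close> in \<open>f_zq\<close> is a true inverse once the
    constant term in q, a series in z, is a unit; it equals 1 because every factor is 1 - z q^s with
    s > 0.\<close>
  have "fps_nth ((qpoch4 2)\<^sup>2) 0 = 1"
  proof -
    have "fps_nth (qpoch4 2) 0 = fps_nth (swap_fps (qinf 2)) 0"
      by (rule fps_ext) (simp add: qinf_def)
    also have "\<dots> = fps_nth (swap_fps (qprod 2 1)) 0"
      by (rule fps_ext) (simp add: qinf_nth[where K = 1])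
    also have "\<dots> = 1"
      by (rule fps_ext) (auto simp: qprod_def qlin_def fps_X_def[symmetric])
    finally show ?thesis by (simp add: power2_eq_square)
  qed
  then have "(qpoch4 2)\<^sup>2 * inverse ((qpoch4 2)\<^sup>2) = 1"
    unfolding fps_inverse_def by (intro fps_right_inverse) simp
  then have "f_zq * (qpoch4 2)\<^sup>2 = qpoch4 0 * qpoch4 4"
    by (simp add: f_zq_def mult.assoc) (simp add: mult.commute)
  then have "swap_fps (f_zq * (qpoch4 2)\<^sup>2) = swap_fps (qpoch4 0 * qpoch4 4)"
    by (rule arg_cong)
  then show ?thesis
    by (simp add: swap_fps_mult f_series_def qinf_def power2_eq_square)
qed

lemma f_series_nth_0: "fps_nth f_series 0 = 1"
proof -
  have "fps_nth (f_series * (qinf 2)\<^sup>2) 0 = fps_nth (qinf 0 * qinf 4) 0"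
    by (simp only: f_series_eq)
  then show ?thesis by (simp add: qinf_nth_0 power2_eq_square)
qed

text \<open>The q-difference equation \<open>f(z) f(q^2 z) = (1 - z) / (1 - q^2 z)\<close>: the infinite products
  telescope.\<close>

lemma f_series_functional:
  "f_series * (f_series oo (fps_const (fps_X\<^sup>2) * fps_X)) * qlin 2 = qlin 0"
proof -
  let ?F' = "f_series oo (fps_const (fps_X\<^sup>2) * fps_X)"
  have "(f_series * (qinf 2)\<^sup>2) oo (fps_const (fps_X\<^sup>2) * fps_X) =
      (qinf 0 * qinf 4) oo (fps_const (fps_X\<^sup>2) * fps_X)"
    by (simp only: f_series_eq)
  then have F': "?F' * (qinf 4)\<^sup>2 = qinf 2 * qinf 6"
    using qinf_compose[of 0] qinf_compose[of 2] qinf_compose[of 4]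
    by (simp add: fps_compose_mult_distrib power2_eq_square[of "qinf _"] del: add_2_eq_Suc')
  \<comment> \<open>The multiplier clears the denominators of both copies of f and contains one
    further factor \<open>qinf 6\<close> to absorb \<open>qlin 2\<close>. It is nonzero and is
    cancelled at the end.\<close>
  have "(f_series * ?F' * qlin 2) * ((qinf 2)\<^sup>2 * (qinf 4)\<^sup>2 * qinf 6) =
      (f_series * (qinf 2)\<^sup>2) * (?F' * (qinf 4)\<^sup>2) * (qlin 2 * qinf 6)"
    by (simp only: ac_simps)
  also have "qlin 2 * qinf 6 = qinf 2"
    using qinf_rec[of 2] by simp
  also have "(f_series * (qinf 2)\<^sup>2) * (?F' * (qinf 4)\<^sup>2) * qinf 2 =
      qinf 0 * qinf 4 * (qinf 2 * qinf 6) * qinf 2"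
    by (simp only: f_series_eq F')
  also have "qinf 0 = qlin 0 * qinf 4"
    using qinf_rec[of 0] by simp
  also have "qlin 0 * qinf 4 * qinf 4 * (qinf 2 * qinf 6) * qinf 2 =
      qlin 0 * ((qinf 2)\<^sup>2 * (qinf 4)\<^sup>2 * qinf 6)"
    by (simp only: power2_eq_square ac_simps)
  finally show ?thesis
    using qinf_nonzero by simp
qed

text \<open>These are the coefficients of f(z) f(t z) = (1 - z) / (1 - t z), where t stands for q^2.
  The ring is left open because the same equation is used over power and Laurent series in q, over
  rational functions, and over series in h.\<close>

definition f_recurrence :: "'a::comm_ring_1 \<Rightarrow> (nat \<Rightarrow> 'a) \<Rightarrow> bool" where
  "f_recurrence t s \<longleftrightarrow> s 0 = 1 \<and>
     (\<forall>n. (\<Sum>i\<le>Suc n. s i * (s (Suc n - i) * t ^ (Suc n - i))) = t ^ Suc n - t ^ n)"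

lemma f_recurrence_f_series: "f_recurrence (fps_X\<^sup>2) (fps_nth f_series)"
proof -
  define D where "D = f_series * (f_series oo (fps_const (fps_X\<^sup>2) * fps_X))"
  have D: "fps_nth D n = (\<Sum>i\<le>n. fps_nth f_series i * (fps_nth f_series (n - i) * (fps_X\<^sup>2) ^ (n - i)))" for n
    unfolding D_def fps_mult_nth fps_nth_compose_linear atLeast0AtMost by (simp add: mult.commute)
  have "D - fps_const (fps_X\<^sup>2) * (fps_X * D) = 1 - fps_X"
  proof -
    have "D - fps_const (fps_X\<^sup>2) * (fps_X * D) = D * qlin 2"
      unfolding qlin_def by (simp only: algebra_simps) simp
    also have "\<dots> = qlin 0" unfolding D_def by (rule f_series_functional)
    finally show ?thesis by (simp add: qlin_def)
  qed
  then have "fps_nth (D - fps_const (fps_X\<^sup>2) * (fps_X * D)) n = fps_nth (1 - fps_X) n" for n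
    by (simp only:)
  from this[of 0] this[of "Suc n" for n]
  have D_0: "fps_nth D 0 = 1"
    and D_Suc: "fps_nth D (Suc n) = fps_X\<^sup>2 * fps_nth D n - (if n = 0 then 1 else 0)" for n
    by (simp_all add: fps_X_nth diff_eq_eq)
  have "fps_nth D (Suc n) = (fps_X\<^sup>2) ^ Suc n - (fps_X\<^sup>2) ^ n" for n
  proof (induction n)
    case 0
    then show ?case by (simp add: D_Suc D_0)
  next
    case (Suc n)
    then show ?case by (subst D_Suc) (simp only: nat.simps if_False right_diff_distrib power_Suc diff_zero)
  qed
  then show ?thesis
    by (simp only: f_recurrence_def f_series_nth_0 D simp_thms)
qed

text \<open>As s_0 = 1, the two extreme terms of the convolution combine to (1 + t^(n+1)) s_(n+1).
  The sequence is determined wherever these factors can be inverted.\<close>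

lemma f_recurrence_Suc:
  assumes "f_recurrence t s"
  shows "(1 + t ^ Suc n) * s (Suc n) =
    t ^ Suc n - t ^ n - (\<Sum>i=1..n. s i * (s (Suc n - i) * t ^ (Suc n - i)))"
proof -
  have "(\<Sum>i\<le>Suc n. s i * (s (Suc n - i) * t ^ (Suc n - i))) =
      s (Suc n) * t ^ Suc n + (\<Sum>i=1..n. s i * (s (Suc n - i) * t ^ (Suc n - i))) + s (Suc n)"
    using assms by (simp add: f_recurrence_def atMost_atLeast0 sum.atLeast_Suc_atMost[of 0])
  moreover have "(\<Sum>i\<le>Suc n. s i * (s (Suc n - i) * t ^ (Suc n - i))) = t ^ Suc n - t ^ n"
    using assms by (simp only: f_recurrence_def)
  ultimately show ?thesis by (simp add: algebra_simps)
qed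

lemma f_recurrence_hom:
  assumes "f_recurrence t s"
    and "F 1 = 1" "\<And>x y. F (x + y) = F x + F y" "\<And>x y. F (x * y) = F x * F y"
  shows "f_recurrence (F t) (\<lambda>n. F (s n))"
proof -
  have 0: "F 0 = 0" using assms(3)[of 0 0] by simp
  have minus: "F (x - y) = F x - F y" for x y
    using assms(3)[of "x - y" y] by (simp add: algebra_simps)
  have pow: "F (x ^ n) = F x ^ n" for x n
    by (induction n) (simp_all add: assms)
  have sum: "F (sum g A) = (\<Sum>i\<in>A. F (g i))" for g and A :: "nat set"
    by (induction A rule: infinite_finite_induct) (simp_all add: assms 0)
  have "F (\<Sum>i\<le>Suc n. s i * (s (Suc n - i) * t ^ (Suc n - i))) = F (t ^ Suc n - t ^ n)" for n
    using assms(1) by (simp only: f_recurrence_def)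
  then have "(\<Sum>i\<le>Suc n. F (s i) * (F (s (Suc n - i)) * F t ^ (Suc n - i))) = F t ^ Suc n - F t ^ n" for n
    by (simp only: sum minus pow assms(4))
  then show ?thesis
    using assms(1,2) by (simp only: f_recurrence_def simp_thms)
qed

text \<open>The recursion uses only subtraction, multiplication and division by 1 + t^(n+1). It is
  applied with \<open>P\<close> being rationality in q, and with \<open>P\<close> being absence of a
  pole at h = 0.\<close>

lemma f_recurrence_closed:
  fixes s :: "nat \<Rightarrow> 'a::field"
  assumes s: "f_recurrence t s"
    and P: "P 1" "P t" "\<And>x y. P x \<Longrightarrow> P y \<Longrightarrow> P (x - y)" "\<And>x y. P x \<Longrightarrow> P y \<Longrightarrow> P (x * y)"
      "\<And>n x. P x \<Longrightarrow> P (x / (1 + t ^ Suc n))"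
    and t: "\<And>n. 1 + t ^ Suc n \<noteq> 0"
  shows "P (s n)"
proof (induction n rule: less_induct)
  case (less n)
  have pow: "P (t ^ k)" for k by (induction k) (simp_all add: P)
  have sum: "P x \<Longrightarrow> (\<And>i. i \<in> A \<Longrightarrow> P (g i)) \<Longrightarrow> P (x - sum g A)" if "finite A" for g A x
    using that by (induction A arbitrary: x rule: finite_induct) (auto simp: P(3) diff_diff_eq[symmetric])
  show ?case
  proof (cases n)
    case 0
    then show ?thesis using s P(1) by (simp add: f_recurrence_def)
  next
    case (Suc k)
    let ?x = "t ^ Suc k - t ^ k - (\<Sum>i=1..k. s i * (s (Suc k - i) * t ^ (Suc k - i)))"
    have "P ?x"
      by (intro sum P(3) P(4) pow less) (auto simp: Suc)
    moreover have "s n = ?x / (1 + t ^ Suc k)"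
      using f_recurrence_Suc[OF s, of k] t[of k] Suc by (simp add: eq_divide_eq mult.commute)
    ultimately show ?thesis using P(5) by simp
  qed
qed

interpretation E: rat_subst fls_const "fps_to_fls (fps_exp (1/2) :: complex fps)"
proof unfold_locales
  fix D :: "complex poly" assume "D \<noteq> 0"
  moreover have "fps_exp (1/2) \<noteq> fps_const (fps_nth (fps_exp (1/2) :: complex fps) 0)"
  proof
    assume "fps_exp (1/2) = fps_const (fps_nth (fps_exp (1/2) :: complex fps) 0)"
    then have "fps_nth (fps_exp (1/2) :: complex fps) 1 = fps_nth (fps_const (fps_nth (fps_exp (1/2) :: complex fps) 0)) 1"
      by (rule arg_cong)
    then show False by simp
  qed
  ultimately show "poly (map_poly fls_const D) (fps_to_fls (fps_exp (1/2))) \<noteq> 0"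
    by (intro transcendental_fps)
qed (simp_all add: fls_plus_const)

text \<open>The divisors 1 + q^(2n+2) have constant term 1 and are rational in q. This makes
  \<open>unexpand0\<close> in the definition of \<open>f_coeff\<close> meaningful.\<close>

lemma fls_rational_f_series: "fls_rational (fps_to_fls (fps_nth f_series n))"
proof (rule f_recurrence_closed[where P = fls_rational and t = "fls_X\<^sup>2"])
  have "f_recurrence (fps_to_fls (fps_X\<^sup>2)) (\<lambda>n. fps_to_fls (fps_nth f_series n))"
    by (rule f_recurrence_hom[OF f_recurrence_f_series]) (simp_all add: fls_times_fps_to_fls)
  then show "f_recurrence (fls_X\<^sup>2) (\<lambda>n. fps_to_fls (fps_nth f_series n))"
    by (simp add: fps_to_fls_power)
  show "1 + (fls_X\<^sup>2) ^ Suc n \<noteq> (0 :: complex fls)" for n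
  proof
    assume "1 + (fls_X\<^sup>2) ^ Suc n = (0 :: complex fls)"
    then have "fps_to_fls (1 + (fps_X\<^sup>2) ^ Suc n :: complex fps) = 0"
      by (simp add: fps_to_fls_power fls_times_fps_to_fls)
    then have "fps_nth (1 + (fps_X\<^sup>2) ^ Suc n :: complex fps) 0 = 0"
      by (simp only: fps_to_fls_eq_0_iff fps_zero_nth)
    then show False by simp
  qed
qed (auto intro!: fls_rational_intros)

definition f_rat :: "nat \<Rightarrow> ratfun" where
  "f_rat n = unexpand0 (fps_to_fls (fps_nth f_series n))"

text \<open>Expansion at 0 is an injective homomorphism, so the equation known for the series
  descends to the rational functions.\<close>

lemma f_recurrence_f_rat: "f_recurrence (rvar\<^sup>2) f_rat"
proof -
  have expand: "expand0 (f_rat n) = fps_to_fls (fps_nth f_series n)" for n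
    by (simp add: f_rat_def expand0_unexpand0 fls_rational_f_series)
  have rec: "f_recurrence (fps_to_fls (fps_X\<^sup>2)) (\<lambda>n. fps_to_fls (fps_nth f_series n))"
    by (rule f_recurrence_hom[OF f_recurrence_f_series]) (simp_all add: fls_times_fps_to_fls)
  have 0: "expand0 (f_rat 0) = expand0 1"
    using rec by (simp add: f_recurrence_def expand) (simp add: expand0_eq)
  have 1: "expand0 (\<Sum>i\<le>Suc n. f_rat i * (f_rat (Suc n - i) * (rvar\<^sup>2) ^ (Suc n - i))) =
      expand0 ((rvar\<^sup>2) ^ Suc n - (rvar\<^sup>2) ^ n)" for n
  proof -
    have "expand0 (\<Sum>i\<le>Suc n. f_rat i * (f_rat (Suc n - i) * (rvar\<^sup>2) ^ (Suc n - i))) =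
        (\<Sum>i\<le>Suc n. expand0 (f_rat i) * (expand0 (f_rat (Suc n - i)) * (fls_X\<^sup>2) ^ (Suc n - i)))"
      by (simp only: expand0_eq X.rat_eval_sum X.rat_eval_mult X.rat_eval_power X.rat_eval_rvar)
    also have "\<dots> = (fls_X\<^sup>2) ^ Suc n - (fls_X\<^sup>2) ^ n"
      unfolding expand using rec by (simp only: f_recurrence_def fps_to_fls_power fps_X_to_fls)
    also have "\<dots> = expand0 ((rvar\<^sup>2) ^ Suc n - (rvar\<^sup>2) ^ n)"
      by (simp only: expand0_eq X.rat_eval_diff X.rat_eval_power X.rat_eval_rvar)
    finally show ?thesis .
  qed
  show ?thesis
    unfolding f_recurrence_def using injD[OF inj_expand0 0] injD[OF inj_expand0 1] by (intro conjI allI)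
qed

lemma exp_half_squared: "(fps_to_fls (fps_exp (1/2) :: complex fps))\<^sup>2 = fps_to_fls (fps_exp 1)"
  by (simp add: fps_to_fls_power[symmetric] fps_exp_power_mult)

text \<open>At q = e^{h/2} the divisors become 1 + e^{(n+1)h}, with constant term 2. Hence no pole
  at h = 0 arises, and \<open>fls_regpart\<close> in \<open>f_coeff\<close> discards
  nothing.\<close>

lemma f_coeff_conv: "fps_to_fls (f_coeff n) = rat_eval fls_const (fps_to_fls (fps_exp (1/2))) (f_rat n)"
proof -
  let ?ev = "rat_eval fls_const (fps_to_fls (fps_exp (1/2) :: complex fps))"
  have "?ev (f_rat n) \<in> range fps_to_fls"
  proof (rule f_recurrence_closed[where P = "\<lambda>x. x \<in> range fps_to_fls" and t = "fps_to_fls (fps_exp 1)"])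
    have "f_recurrence (?ev (rvar\<^sup>2)) (\<lambda>n. ?ev (f_rat n))"
      by (rule f_recurrence_hom[OF f_recurrence_f_rat]) (simp_all add: E.rat_eval_add E.rat_eval_mult)
    then show "f_recurrence (fps_to_fls (fps_exp 1)) (\<lambda>n. ?ev (f_rat n))"
      by (simp add: E.rat_eval_power exp_half_squared)
    show "1 \<in> range (fps_to_fls :: complex fps \<Rightarrow> _)"
      by (rule range_eqI[of _ _ 1]) simp
    show "x - y \<in> range fps_to_fls" if "x \<in> range fps_to_fls" "y \<in> range fps_to_fls" for x y :: "complex fls"
      using that by (auto simp flip: fps_to_fls_minus)
    show "x * y \<in> range fps_to_fls" if "x \<in> range fps_to_fls" "y \<in> range fps_to_fls" for x y :: "complex fls"
      using that by (auto simp: fls_times_fps_to_fls[symmetric])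
    fix n
    let ?u = "1 + fps_exp 1 ^ Suc n :: complex fps"
    have u0: "fps_nth ?u 0 \<noteq> 0" by (simp add: fps_exp_power_mult)
    then have "?u * inverse ?u = 1" by (rule inverse_mult_eq_1')
    then have "fps_to_fls ?u * fps_to_fls (inverse ?u) = 1"
      by (simp only: fls_times_fps_to_fls[symmetric] fps_to_fls_eq_1_iff)
    then have *: "inverse (fps_to_fls ?u) = fps_to_fls (inverse ?u)"
      by (rule inverse_unique)
    have u: "1 + fps_to_fls (fps_exp 1) ^ Suc n = fps_to_fls ?u"
      by (simp only: fps_to_fls_plus fps_to_fls_power fps_one_to_fls)
    show "1 + fps_to_fls (fps_exp 1) ^ Suc n \<noteq> (0::complex fls)"
      unfolding u fps_to_fls_eq_0_iff using u0 by (metis fps_zero_nth)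
    show "x / (1 + fps_to_fls (fps_exp 1) ^ Suc n) \<in> range fps_to_fls" if x: "x \<in> range fps_to_fls" for x :: "complex fls"
    proof -
      from x obtain y where "x = fps_to_fls y" by blast
      then have "x / (1 + fps_to_fls (fps_exp 1) ^ Suc n) = fps_to_fls (y * inverse ?u)"
        by (simp only: u divide_inverse * fls_times_fps_to_fls)
      then show ?thesis by blast
    qed
  qed simp
  then obtain g where g: "?ev (f_rat n) = fps_to_fls g" by blast
  have "Abs_fps (\<lambda>m. fps_nth (fps_nth f_zq m) n) = fps_nth f_series n"
    by (rule fps_ext) (simp add: f_series_def)
  then have "f_coeff n = fls_regpart (?ev (f_rat n))"
    by (simp add: f_coeff_def f_rat_def)
  then show ?thesis by (simp add: g)
qed

lemma f_recurrence_f_coeff: "f_recurrence (fps_exp 1) f_coeff"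
proof -
  let ?ev = "rat_eval fls_const (fps_to_fls (fps_exp (1/2) :: complex fps))"
  have "f_recurrence (?ev (rvar\<^sup>2)) (\<lambda>n. ?ev (f_rat n))"
    by (rule f_recurrence_hom[OF f_recurrence_f_rat]) (simp_all add: E.rat_eval_add E.rat_eval_mult)
  then have *: "f_recurrence (fps_to_fls (fps_exp 1)) (\<lambda>n. fps_to_fls (f_coeff n))"
    by (simp add: E.rat_eval_power exp_half_squared f_coeff_conv)
  have "fps_to_fls (\<Sum>i\<le>Suc n. f_coeff i * (f_coeff (Suc n - i) * fps_exp 1 ^ (Suc n - i))) =
      fps_to_fls (fps_exp 1 ^ Suc n - fps_exp 1 ^ n)" for n
  proof -
    have sum: "fps_to_fls (sum g A) = (\<Sum>i\<in>A. fps_to_fls (g i))" for g :: "nat \<Rightarrow> complex fps" and A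
      by (induction A rule: infinite_finite_induct) simp_all
    show ?thesis
      using * by (simp only: sum fls_times_fps_to_fls fps_to_fls_power fps_to_fls_minus f_recurrence_def)
  qed
  then show ?thesis
    using * by (simp only: f_recurrence_def fps_to_fls_eq_iff fps_to_fls_eq_1_iff simp_thms)
qed

lemma f_coeff_0 [simp]: "f_coeff 0 = 1"
  using f_recurrence_f_coeff by (simp add: f_recurrence_def)

text \<open>At h = 0 one has t = 1: the right side t^(n+1) - t^n vanishes and the divisor is 2, so
  induction leaves only the constant coefficient of f.\<close>

lemma f_coeff_nth_0: "n > 0 \<Longrightarrow> fps_nth (f_coeff n) 0 = 0"
proof (induction n rule: less_induct)
  case (less n)
  then obtain k where k: "n = Suc k" by (cases n) auto
  have "fps_nth ((1 + fps_exp 1 ^ Suc k) * f_coeff (Suc k)) 0 =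
      fps_nth (fps_exp 1 ^ Suc k - fps_exp 1 ^ k -
        (\<Sum>i=1..k. f_coeff i * (f_coeff (Suc k - i) * fps_exp 1 ^ (Suc k - i)))) 0"
    by (simp only: f_recurrence_Suc[OF f_recurrence_f_coeff])
  moreover have "fps_nth (\<Sum>i=1..k. f_coeff i * (f_coeff (Suc k - i) * fps_exp 1 ^ (Suc k - i))) 0 = 0"
    using less.IH by (auto simp: fps_sum_nth k intro!: sum.neutral)
  ultimately show ?case by (simp add: k fps_exp_power_mult)
qed

section \<open>Rationality of the R-matrix\<close>

text \<open>The f_m of the introduction: the variable is z now, and the order in h is fixed.\<close>

definition f_level :: "nat \<Rightarrow> complex fps" where
  "f_level m = Abs_fps (\<lambda>n. fps_nth (f_coeff n) m)"

text \<open>The operator (z d/dz)^j; it enters through f(e^h z) = exp(h z d/dz) f(z).\<close>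

definition euler_op :: "nat \<Rightarrow> complex fps \<Rightarrow> complex fps" where
  "euler_op j g = Abs_fps (\<lambda>n. of_nat n ^ j * fps_nth g n)"

lemma fls_rational_euler_op:
  assumes "fls_rational (fps_to_fls g)"
  shows "fls_rational (fps_to_fls (euler_op j g))"
proof (induction j)
  case 0
  have "euler_op 0 g = g" by (rule fps_ext) (simp add: euler_op_def)
  then show ?case using assms by simp
next
  case (Suc j)
  have "euler_op (Suc j) g = fps_X * fps_deriv (euler_op j g)"
    by (rule fps_ext) (simp add: euler_op_def fps_X_mult_nth)
  then have "fps_to_fls (euler_op (Suc j) g) = fls_X * fls_deriv (fps_to_fls (euler_op j g))"
    by (simp add: fls_times_fps_to_fls fls_deriv_fps_to_fls)
  then show ?case
    by (simp add: fls_rational_mult fls_rational_deriv Suc)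
qed

text \<open>The level \<open>m\<close> of \<open>(1 - z) / (1 - e^h z)\<close>.\<close>

definition rhs_level :: "nat \<Rightarrow> complex fps" where
  "rhs_level m = fps_const (1 / fact m) * ((1 - fps_X) * euler_op m (Abs_fps (\<lambda>_. 1)))"

lemma fls_rational_rhs_level: "fls_rational (fps_to_fls (rhs_level m))"
proof -
  have "(1 - fps_X) * Abs_fps (\<lambda>_. 1 :: complex) = 1"
    by (rule fps_ext) (simp add: left_diff_distrib fps_X_mult_nth)
  then have "fps_to_fls (1 - fps_X) * fps_to_fls (Abs_fps (\<lambda>_. 1 :: complex)) = 1"
    by (simp only: fls_times_fps_to_fls[symmetric] fps_to_fls_eq_1_iff)
  then have "fps_to_fls (Abs_fps (\<lambda>_. 1 :: complex)) = inverse (1 - fls_X)"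
    by (intro inverse_unique[symmetric]) simp
  then have "fls_rational (fps_to_fls (Abs_fps (\<lambda>_. 1 :: complex)))"
    by (simp add: fls_rational_intros)
  then show ?thesis
    by (simp add: rhs_level_def fls_times_fps_to_fls fls_rational_intros fls_rational_euler_op)
qed

text \<open>This is the coefficient of h^m in f(z) f(e^h z) = (1 - z) / (1 - e^h z): orders a and b
  come from the two copies of f, and the remaining m - a - b from exp(h z d/dz), which brings in the
  factorial.\<close>

lemma f_level_rec:
  "(\<Sum>(a, b)\<in>{(a, b). a + b \<le> m}.
      fps_const (1 / fact (m - a - b)) * (f_level a * euler_op (m - a - b) (f_level b))) = rhs_level m"
proof (rule fps_ext)
  fix n
  have S: "{(a, b). a + b \<le> m} = (SIGMA a:{..m}. {..m - a})" by auto
  have nth: "fps_nth (fps_const c * (f * g)) n = (\<Sum>i\<le>n. c * (fps_nth f i * fps_nth g (n - i)))"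
    for c :: complex and f g
    by (simp only: fps_mult_left_const_nth fps_mult_nth[of f g] atLeast0AtMost sum_distrib_left)
  have "fps_nth (\<Sum>(a, b)\<in>{(a, b). a + b \<le> m}.
      fps_const (1 / fact (m - a - b)) * (f_level a * euler_op (m - a - b) (f_level b))) n =
    (\<Sum>a\<le>m. \<Sum>b\<le>m - a. \<Sum>i\<le>n. 1 / fact (m - a - b) *
      (fps_nth (f_coeff i) a * (of_nat (n - i) ^ (m - a - b) * fps_nth (f_coeff (n - i)) b)))"
    by (simp add: S sum.Sigma[symmetric] fps_sum_nth nth del: fps_mult_left_const_nth)
      (simp add: f_level_def euler_op_def)
  also have "\<dots> = (\<Sum>i\<le>n. \<Sum>a\<le>m. \<Sum>b\<le>m - a. 1 / fact (m - a - b) *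
      (fps_nth (f_coeff i) a * (of_nat (n - i) ^ (m - a - b) * fps_nth (f_coeff (n - i)) b)))"
    by (simp only: sum.swap[of _ "{..n}"])
  also have "\<dots> = (\<Sum>i\<le>n. fps_nth (f_coeff i * (f_coeff (n - i) * fps_exp 1 ^ (n - i))) m)"
    by (simp add: fps_mult_nth atLeast0AtMost sum_distrib_left fps_exp_power_mult mult_ac)
  also have "\<dots> = fps_nth (\<Sum>i\<le>n. f_coeff i * (f_coeff (n - i) * fps_exp 1 ^ (n - i))) m"
    by (simp only: fps_sum_nth)
  also have "\<dots> = fps_nth (rhs_level m) n"
  proof (cases n)
    case 0
    then show ?thesis by (cases m) (simp_all add: rhs_level_def euler_op_def)
  next
    case (Suc k)
    have "(\<Sum>i\<le>n. f_coeff i * (f_coeff (n - i) * fps_exp 1 ^ (n - i))) = fps_exp 1 ^ Suc k - fps_exp 1 ^ k"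
      using f_recurrence_f_coeff unfolding f_recurrence_def Suc by blast
    then show ?thesis
      by (simp add: rhs_level_def euler_op_def Suc fps_exp_power_mult left_diff_distrib diff_divide_distrib
          del: power_Suc)
  qed
  finally show "fps_nth (\<Sum>(a, b)\<in>{(a, b). a + b \<le> m}.
      fps_const (1 / fact (m - a - b)) * (f_level a * euler_op (m - a - b) (f_level b))) n =
    fps_nth (rhs_level m) n" .
qed

lemma f_level_0: "f_level 0 = 1"
  by (rule fps_ext) (auto simp: f_level_def f_coeff_nth_0)

text \<open>The functional equation determines \<open>f_level m\<close> from the lower levels, using only operations
  that preserve rationality.\<close>

lemma fls_rational_f_level: "fls_rational (fps_to_fls (f_level m))"
proof (induction m rule: less_induct)
  case (less m)
  show ?case
  proof (cases "m = 0")
    case True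
    then show ?thesis by (simp add: f_level_0)
  next
    case False
    let ?t = "\<lambda>(a, b). fps_const (1 / fact (m - a - b)) * (f_level a * euler_op (m - a - b) (f_level b))"
    let ?S = "{(a, b). a + b \<le> m}"
    have fin: "finite ?S"
      by (rule finite_subset[of _ "{..m} \<times> {..m}"]) auto
    have euler0: "euler_op 0 g = g" for g by (rule fps_ext) (simp add: euler_op_def)
    \<comment> \<open>Since f_0 = 1, the pairs (m, 0) and (0, m), distinct for m > 0, contribute f_m
      each. All other pairs have both entries below m.\<close>
    have "sum ?t ?S = ?t (m, 0) + (?t (0, m) + sum ?t (?S - {(m, 0)} - {(0, m)}))"
      using fin False by (subst sum.remove[of _ "(m, 0)"], simp, simp, subst sum.remove[of _ "(0, m)"]) auto
    also have "?t (m, 0) + (?t (0, m) + sum ?t (?S - {(m, 0)} - {(0, m)})) =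
        fps_const 2 * f_level m + sum ?t (?S - {(m, 0)} - {(0, m)})"
      by (simp add: f_level_0 euler0)
    finally have two: "fps_const 2 * f_level m = rhs_level m - sum ?t (?S - {(m, 0)} - {(0, m)})"
      using f_level_rec[of m] by (simp add: algebra_simps)
    have "f_level m = fps_const (1/2) * (fps_const 2 * f_level m)"
      by (simp add: mult.assoc[symmetric])
    also note two
    finally have "f_level m = fps_const (1/2) * (rhs_level m - sum ?t (?S - {(m, 0)} - {(0, m)}))" .
    moreover have "fls_rational (fps_to_fls (sum ?t (?S - {(m, 0)} - {(0, m)})))"
    proof -
      have sum: "fps_to_fls (sum g A) = (\<Sum>i\<in>A. fps_to_fls (g i))" for g :: "nat \<times> nat \<Rightarrow> complex fps" and A
        by (induction A rule: infinite_finite_induct) simp_all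
      have "fls_rational (fps_to_fls (?t p))" if "p \<in> ?S - {(m, 0)} - {(0, m)}" for p
      proof -
        obtain a b where p: "p = (a, b)" by (cases p)
        with that have "a < m" "b < m" by auto
        with less.IH show ?thesis
          by (simp add: p fls_times_fps_to_fls fls_rational_intros fls_rational_euler_op)
      qed
      then show ?thesis unfolding sum by (rule fls_rational_sum)
    qed
    ultimately show ?thesis
      by (simp add: fls_times_fps_to_fls fls_rational_intros fls_rational_rhs_level)
  qed
qed

lemma h_rational_f_z2: "h_rational f_z2"
  unfolding h_rational_def
proof
  fix m
  have "Abs_fps (\<lambda>j. if even j then fps_nth (f_coeff (j div 2)) m else 0) = f_level m oo fps_X\<^sup>2"
  proof (rule fps_ext)
    fix j
    have "fps_nth (f_level m oo fps_X\<^sup>2) j = (\<Sum>i=0..j. if j = i * 2 then fps_nth (f_coeff i) m else 0)"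
      by (simp add: fps_compose_nth f_level_def power_mult[symmetric] mult.commute fps_X_power_nth if_distrib cong: if_cong)
    also have "\<dots> = (if even j then fps_nth (f_coeff (j div 2)) m else 0)"
    proof (cases "even j")
      case True
      then have "j = i * 2 \<longleftrightarrow> i = j div 2" for i by auto
      with True show ?thesis by simp
    qed (auto intro!: sum.neutral)
    finally show "fps_nth (Abs_fps (\<lambda>j. if even j then fps_nth (f_coeff (j div 2)) m else 0)) j =
        fps_nth (f_level m oo fps_X\<^sup>2) j" by simp
  qed
  then have "fps_nth f_z2 m = fls_compose_fps (fps_to_fls (f_level m)) (fps_X\<^sup>2)"
    by (simp add: f_z2_def)
  also have "fls_rational \<dots>"
    by (intro fls_rational_compose fls_rational_f_level)
      (simp_all add: fps_to_fls_power fls_rational_power)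
  finally show "fls_rational (fps_nth f_z2 m)" .
qed

lemma f_z2_nth_0: "fps_nth f_z2 0 = 1"
proof -
  have "Abs_fps (\<lambda>j. if even j then fps_nth (f_coeff (j div 2)) 0 else 0) = 1"
    by (rule fps_ext) (auto simp: f_coeff_nth_0 elim!: evenE)
  then show ?thesis by (simp add: f_z2_def)
qed

section \<open>Even and odd parts\<close>

lemma fls_nth_even_part:
  "fls_nth (fps_nth (even_part g) m) k = (if even k then fls_nth (fps_nth g m) k else 0)"
  unfolding even_part_def fps_nth_Abs_fps
  by (rule nth_Abs_fls_lower_bound[of "fls_subdegree (fps_nth g m)"]) auto

text \<open>The even part is (g(z) + g(-z)) / 2, and z -> -z preserves rationality.\<close>

lemma h_rational_even_part:
  assumes "h_rational g"
  shows "h_rational (even_part g)"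
  unfolding h_rational_def
proof
  fix m
  let ?F = "fps_nth g m"
  have "fls_rational (fps_to_fls (fps_const (-1) * fps_X))"
    by (simp add: fls_times_fps_to_fls fls_rational_intros)
  then have "fls_rational (fls_compose_fps ?F (fps_const (-1) * fps_X))"
    using assms by (intro fls_rational_compose) (auto simp: h_rational_def)
  moreover have "fps_nth (even_part g) m =
      fls_const (1/2) * (?F + fls_compose_fps ?F (fps_const (-1) * fps_X))"
    by (rule fls_eqI)
      (simp add: fls_nth_even_part fls_nth_fls_compose_fps_linear power_int_minus_left
        del: fps_const_neg)
  ultimately show "fls_rational (fps_nth (even_part g) m)"
    using assms by (simp add: h_rational_def fls_rational_intros)
qed

lemma h_rational_odd_part: "h_rational g \<Longrightarrow> h_rational (odd_part g)"
  by (simp add: odd_part_def h_rational_diff h_rational_even_part)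

lemma even_part_nth_0:
  assumes "fps_nth g 0 = 1"
  shows "fps_nth (even_part g) 0 = 1" "fps_nth (odd_part g) 0 = 0"
proof -
  show "fps_nth (even_part g) 0 = 1"
    by (rule fls_eqI) (simp add: fls_nth_even_part assms)
  then show "fps_nth (odd_part g) 0 = 0"
    by (simp add: odd_part_def assms)
qed

section \<open>The entries of R: rationality and value at h = 0\<close>

lemma hpow_emb_h: "c \<in> hpow n \<Longrightarrow> emb_h c \<in> hpow n"
  by (simp add: hpow_def emb_h_def)

lemma hpow_p_ell: "p_ell a b \<in> hpow (2 * b)"
  unfolding p_ell_def by (intro hpow_emb_h) (simp add: hpow_def fps_mult_left_const_nth)

lemma hpow_p_half: "p_half a b \<in> hpow b"
  unfolding p_half_def by (simp add: hpow_def fps_mult_left_const_nth)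

lemma h_rational_p_ell: "h_rational (p_ell a b)"
  by (simp add: p_ell_def)

lemma h_rational_q_pow: "h_rational (q_pow t)"
  by (simp add: q_pow_def)

lemma q_pow_nth_0: "fps_nth (q_pow t) 0 = 1"
  by (simp add: q_pow_def emb_h_def)

context
  fixes a :: real and b :: nat
  assumes b: "b > 0"
begin

text \<open>As b > 0, the powers of p supply the convergence. The factor with k = 0 contains no p;
  divisibility of y by h makes its constant term 1.\<close>

lemma
  assumes y: "y \<in> hpow 1" "h_rational y"
  shows h_rational_poch_p: "h_rational (poch_p a b y)"
    and poch_p_nth_0: "fps_nth (poch_p a b y) 0 = 1"
proof -
  have *: "1 - y * p_ell a b ^ i - 1 \<in> hpow i" for i
  proof -
    have "y * p_ell a b ^ i \<in> hpow (1 + 2 * b * i)"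
      by (intro hpow_mult y hpow_power hpow_p_ell)
    moreover have "i \<le> 1 + 2 * b * i" using b by (cases b) auto
    ultimately have "y * p_ell a b ^ i \<in> hpow i" by (rule hpow_antimono[rotated])
    then show ?thesis by (simp add: hpow_def)
  qed
  have 0: "fps_nth (1 - y * p_ell a b ^ 0) 0 = 1"
    using y by (simp add: hpow_def)
  show "h_rational (poch_p a b y)"
    unfolding poch_p_def
    by (rule h_rational_prodinf) (use * 0 y in \<open>auto intro!: h_rational_intros h_rational_p_ell\<close>)
  show "fps_nth (poch_p a b y) 0 = 1"
    unfolding poch_p_def
    by (subst prodinf_fps_nth[of _ 0 0]) (use * 0 in auto)
qed

text \<open>The index starts at \<open>Suc k\<close>, so the argument p^(k+1) x^2 is divisible by
  h^(k+1) and the series converges h-adically, unlike f(z^2) itself. Only rationality of x enters,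
  which admits both x = z and x = 1/z.\<close>

lemma
  assumes x: "fls_rational x"
  shows h_rational_f_pk: "h_rational (f_pk a b (Suc k) x)"
    and f_pk_hpow: "f_pk a b (Suc k) x - 1 \<in> hpow (Suc k)"
proof -
  define t where "t n = emb_h (f_coeff n) * (p_ell a b ^ Suc k * fps_const (x\<^sup>2)) ^ n" for n
  have t: "t n \<in> hpow (Suc k * n)" for n
  proof -
    have "p_ell a b ^ Suc k * fps_const (x\<^sup>2) \<in> hpow (2 * b * Suc k)"
      by (intro hpow_mult_right hpow_power hpow_p_ell)
    then have "p_ell a b ^ Suc k * fps_const (x\<^sup>2) \<in> hpow (Suc k)"
      by (rule hpow_antimono[rotated]) (use b in \<open>cases b, auto\<close>)
    then have "(p_ell a b ^ Suc k * fps_const (x\<^sup>2)) ^ n \<in> hpow (Suc k * n)"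
      by (rule hpow_power)
    then show ?thesis
      unfolding t_def by (metis hpow_mult_right mult.commute)
  qed
  have t': "t n \<in> hpow n" for n
    using t[of n] by (rule hpow_antimono[rotated]) simp
  have f_pk: "f_pk a b (Suc k) x = suminf t"
    by (simp only: f_pk_def t_def[abs_def])
  show "h_rational (f_pk a b (Suc k) x)"
    unfolding f_pk
    by (rule h_rational_suminf)
      (use t' x in \<open>auto simp: t_def intro!: h_rational_intros h_rational_p_ell h_rational_const fls_rational_intros\<close>)
  have "fps_nth (suminf t - 1) N = 0" if "N < Suc k" for N
  proof -
    have "fps_nth (t i) N = 0" if "i > 0" for i
    proof -
      have "N < Suc k * i" using that \<open>N < Suc k\<close> by (cases i) auto
      then show ?thesis using t[of i] by (simp add: hpow_def)
    qed
    then have "(\<Sum>i\<le>N. fps_nth (t i) N) = (\<Sum>i\<in>{0}. fps_nth (t i) N)"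
      by (intro sum.mono_neutral_right) auto
    moreover have "t 0 = 1" by (simp add: t_def emb_h_def fps_eq_iff)
    ultimately show ?thesis
      by (simp add: suminf_fps_nth[OF t'] fps_sum_nth)
  qed
  then show "f_pk a b (Suc k) x - 1 \<in> hpow (Suc k)"
    by (simp add: f_pk hpow_def)
qed

lemma
  assumes x: "fls_rational x"
  shows h_rational_prod_f_pk: "h_rational (prodinf (\<lambda>k. f_pk a b (Suc k) x))"
    and prod_f_pk_nth_0: "fps_nth (prodinf (\<lambda>k. f_pk a b (Suc k) x)) 0 = 1"
proof -
  have *: "f_pk a b (Suc k) x - 1 \<in> hpow k" for k
    using f_pk_hpow[OF x] by (rule hpow_antimono[rotated]) simp
  have 0: "fps_nth (f_pk a b (Suc 0) x) 0 = 1"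
    using f_pk_hpow[OF x, of 0] by (simp add: hpow_def)
  show "h_rational (prodinf (\<lambda>k. f_pk a b (Suc k) x))"
    by (rule h_rational_prodinf) (use * 0 h_rational_f_pk[OF x] in auto)
  show "fps_nth (prodinf (\<lambda>k. f_pk a b (Suc k) x)) 0 = 1"
    by (subst prodinf_fps_nth[of _ 0 0]) (use * 0 in auto)
qed

lemma fps_divide_nth_0:
  fixes f g :: "complex fls fps"
  shows "fps_nth g 0 \<noteq> 0 \<Longrightarrow> fps_nth (f / g) 0 = fps_nth f 0 / fps_nth g 0"
  by (simp add: fps_divide_unit divide_inverse)

text \<open>The arguments of the Pochhammer symbols carry p^{1/2} or p and thus vanish at h = 0,
  whatever x is. All factors of alpha and beta therefore start with 1.\<close>

lemma
  assumes x: "fls_rational x"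
  shows h_rational_alpha: "h_rational (alpha_ell a b x)"
    and alpha_nth_0: "fps_nth (alpha_ell a b x) 0 = 1"
    and h_rational_beta: "h_rational (beta_ell a b x)"
    and beta_nth_0: "fps_nth (beta_ell a b x) 0 = 1"
proof -
  have 1: "emb_h (p_half a b) * q_pow t * fps_const x \<in> hpow 1" for t
    using b by (intro hpow_mult_right hpow_emb_h hpow_antimono[OF _ hpow_p_half]) auto
  have 2: "- p_ell a b * q_pow t * fps_const x \<in> hpow 1" for t
  proof -
    have "p_ell a b \<in> hpow 1"
      using b by (intro hpow_antimono[OF _ hpow_p_ell]) auto
    then have "p_ell a b * q_pow t * fps_const x \<in> hpow 1"
      by (intro hpow_mult_right)
    then show ?thesis by (simp add: hpow_def)
  qed
  have r: "h_rational (emb_h (p_half a b) * q_pow t * fps_const x)"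
      "h_rational (- p_ell a b * q_pow t * fps_const x)" for t
    using x by (auto intro!: h_rational_intros h_rational_p_ell h_rational_q_pow simp del: mult_minus_left)
  note poch = h_rational_poch_p[OF 1 r(1)] h_rational_poch_p[OF 2 r(2)]
    poch_p_nth_0[OF 1 r(1)] poch_p_nth_0[OF 2 r(2)]
  show "h_rational (alpha_ell a b x)" "h_rational (beta_ell a b x)"
    unfolding alpha_ell_def beta_ell_def
    by (intro h_rational_intros poch h_rational_prod_f_pk x, simp only: poch, simp)+
  show "fps_nth (alpha_ell a b x) 0 = 1" "fps_nth (beta_ell a b x) 0 = 1"
    unfolding alpha_ell_def beta_ell_def
    by (simp_all only: fps_mult_nth_0 prod_f_pk_nth_0 x, subst fps_divide_nth_0)
      (simp_all only: poch, simp_all add: fps_divide_nth_0 poch(3,4)[simplified])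
qed

lemma
  shows h_rational_R_apd: "h_rational (R_apd a b)" and R_apd_nth_0: "fps_nth (R_apd a b) 0 = 1"
proof -
  have x: "fls_rational (inverse fls_X)" by (simp add: fls_rational_inverse)
  note alpha = h_rational_alpha[OF fls_rational_X] h_rational_alpha[OF x]
    alpha_nth_0[OF fls_rational_X] alpha_nth_0[OF x]
  show "h_rational (R_apd a b)"
    unfolding R_apd_def
    by (intro h_rational_intros alpha h_rational_q_pow h_rational_f_z2) (simp add: alpha)
  show "fps_nth (R_apd a b) 0 = 1"
    by (simp add: R_apd_def fps_divide_nth_0 alpha q_pow_nth_0 f_z2_nth_0)
qed

lemma
  shows h_rational_R_bpc: "h_rational (R_bpc a b)" and R_bpc_nth_0: "fps_nth (R_bpc a b) 0 = 1"
proof -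
  have x: "fls_rational (inverse fls_X)" by (simp add: fls_rational_inverse)
  note beta = h_rational_beta[OF fls_rational_X] h_rational_beta[OF x]
    beta_nth_0[OF fls_rational_X] beta_nth_0[OF x]
  \<comment> \<open>The leading term of 1 + q z is 1 + z, so 1 + q z is a unit in series in h over
    Laurent series, and the quotient in \<open>R_bpc\<close> is a genuine one.\<close>
  have nz: "1 + fls_X \<noteq> (0 :: complex fls)"
  proof
    assume "1 + fls_X = (0 :: complex fls)"
    then have "fls_nth (1 + fls_X) 0 = fls_nth (0 :: complex fls) 0" by (rule arg_cong)
    then show False by simp
  qed
  have q: "fps_nth (1 + q_pow t * fps_const fls_X) 0 = 1 + fls_X" for t
    by (simp add: q_pow_nth_0)
  show "h_rational (R_bpc a b)"
    unfolding R_bpc_def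
    by (intro h_rational_intros beta h_rational_q_pow h_rational_f_z2 h_rational_1 h_rational_const
        fls_rational_X) (simp_all only: q beta nz simp_thms, simp_all)
  have "fps_nth ((1 + q_pow (-1) * fps_const fls_X) / (1 + q_pow 1 * fps_const fls_X)) 0 = 1"
    using nz by (subst fps_divide_nth_0; unfold q) auto
  then show "fps_nth (R_bpc a b) 0 = 1"
    by (simp add: R_bpc_def fps_divide_nth_0[of "beta_ell _ _ _"] beta q_pow_nth_0 f_z2_nth_0)
qed

text \<open>\<open>unexpand0\<close> inverts the expansion only on its range; rationality of every
  level of R is what places the entries there.\<close>

lemma expand0_R_rat: "expand0 (fps_nth (R_rat a b i1 i2 j1 j2) n) = fps_nth (R_ell a b i1 i2 j1 j2) n"
proof -
  have "h_rational (R_ell a b i1 i2 j1 j2)"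
    by (auto simp: R_ell_def h_rational_even_part h_rational_odd_part h_rational_R_apd h_rational_R_bpc
        h_rational_def[of 0])
  then show ?thesis
    by (simp add: R_rat_def h_rational_def expand0_unexpand0)
qed

text \<open>Both a + d and b + c are 1 at h = 0. Since 1 is even, a and b reduce to 1 and c and d to
  0.\<close>

lemma R_rat_nth_0: "fps_nth (R_rat a b i1 i2 j1 j2) 0 = (if i1 = j1 \<and> i2 = j2 then 1 else 0)"
proof (rule injD[OF inj_expand0])
  have "expand0 1 = 1" "expand0 0 = 0" by (simp_all add: expand0_eq)
  then show "expand0 (fps_nth (R_rat a b i1 i2 j1 j2) 0) = expand0 (if i1 = j1 \<and> i2 = j2 then 1 else 0)"
    by (simp add: expand0_R_rat R_ell_def even_part_nth_0 R_apd_nth_0 R_bpc_nth_0)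
qed

end

section \<open>The inverse of the R-matrix\<close>

lemma rconst_hom [simp]: "rconst 0 = 0" "rconst 1 = 1"
    "rconst (c + d) = rconst c + rconst d" "rconst (c * d) = rconst c * rconst d"
  by (simp_all add: rconst_def mult.commute flip: one_pCons to_fract_add to_fract_mult)

lemma peval_rvar: "poly (map_poly rconst P) rvar = to_fract P"
proof (induction P)
  case (pCons c P)
  have "map_poly rconst (pCons c P) = pCons (rconst c) (map_poly rconst P)"
    using pCons.hyps by (subst map_poly_pCons) auto
  then have "poly (map_poly rconst (pCons c P)) rvar = rconst c + rvar * to_fract P"
    using pCons.IH by simp
  also have "\<dots> = to_fract ([:c:] + [:0, 1:] * P)"
    by (simp only: rconst_def rvar_def to_fract_add to_fract_mult)
  also have "[:c:] + [:0, 1:] * P = pCons c P" by simp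
  finally show ?case .
qed simp

text \<open>Meant for g = z e^t as a series in t over the rational functions of z. Setting t = 0 in
  P(g) returns P(z), which is nonzero unless P is; this also yields the transcendence of g.\<close>

lemma peval_shift_nth_0:
  fixes g :: "ratfun fps"
  assumes g: "fps_nth g 0 = rvar"
  shows "\<exists>s. poly (map_poly (\<lambda>c. fls_const (rconst c)) P) (fps_to_fls g) = fps_to_fls s \<and>
    fps_nth s 0 = to_fract P"
proof -
  have "\<exists>s. poly (map_poly (\<lambda>c. fls_const (rconst c)) P) (fps_to_fls g) = fps_to_fls s \<and>
    fps_nth s 0 = poly (map_poly rconst P) rvar"
  proof (induction P)
    case (pCons c P)
    then obtain s where s: "poly (map_poly (\<lambda>c. fls_const (rconst c)) P) (fps_to_fls g) = fps_to_fls s"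
        "fps_nth s 0 = poly (map_poly rconst P) rvar"
      by blast
    have *: "map_poly (\<lambda>c. fls_const (rconst c)) (pCons c P) =
        pCons (fls_const (rconst c)) (map_poly (\<lambda>c. fls_const (rconst c)) P)"
      "map_poly rconst (pCons c P) = pCons (rconst c) (map_poly rconst P)"
      using pCons.hyps by (subst map_poly_pCons; auto)+
    then have "poly (map_poly (\<lambda>c. fls_const (rconst c)) (pCons c P)) (fps_to_fls g) =
        fps_to_fls (fps_const (rconst c) + g * s)"
      by (simp add: s fls_times_fps_to_fls)
    moreover have "fps_nth (fps_const (rconst c) + g * s) 0 = poly (map_poly rconst (pCons c P)) rvar"
      by (simp add: s g *)
    ultimately show ?case by blast
  qed (auto intro: exI[of _ 0])
  then show ?thesis by (simp add: peval_rvar)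
qed

lemma rat_subst_shift:
  fixes g :: "ratfun fps"
  assumes g: "fps_nth g 0 = rvar"
  shows "rat_subst (\<lambda>c. fls_const (rconst c)) (fps_to_fls g)"
proof unfold_locales
  fix D :: "complex poly" assume D: "D \<noteq> 0"
  obtain s where s: "poly (map_poly (\<lambda>c. fls_const (rconst c)) D) (fps_to_fls g) = fps_to_fls s"
      "fps_nth s 0 = to_fract D"
    using peval_shift_nth_0[OF g] by blast
  show "poly (map_poly (\<lambda>c. fls_const (rconst c)) D) (fps_to_fls g) \<noteq> 0"
    using s D by auto
qed (simp_all add: fls_plus_const)

text \<open>The denominator has constant term D(z), a nonzero element of the coefficient field, so
  it is a unit and r(z e^t) has no pole at t = 0.\<close>

lemma rat_eval_shift_nth_0:
  fixes g :: "ratfun fps"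
  assumes g: "fps_nth g 0 = rvar"
  shows "fls_nth (rat_eval (\<lambda>c. fls_const (rconst c)) (fps_to_fls g) r) 0 = r"
proof -
  interpret S: rat_subst "\<lambda>c. fls_const (rconst c)" "fps_to_fls g"
    by (rule rat_subst_shift[OF g])
  obtain N D where r: "r = Fract N D" "D \<noteq> 0" by (cases r)
  obtain s where s: "S.peval N = fps_to_fls s" "fps_nth s 0 = to_fract N"
    using peval_shift_nth_0[OF g] unfolding S.peval_def by blast
  obtain t where t: "S.peval D = fps_to_fls t" "fps_nth t 0 = to_fract D"
    using peval_shift_nth_0[OF g] unfolding S.peval_def by blast
  have "t * inverse t = 1" using t r by (intro inverse_mult_eq_1') simp
  then have "fps_to_fls t * fps_to_fls (inverse t) = 1"
    by (simp only: fls_times_fps_to_fls[symmetric] fps_to_fls_eq_1_iff)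
  then have "inverse (fps_to_fls t) = fps_to_fls (inverse t)"
    by (rule inverse_unique)
  then have "rat_eval (\<lambda>c. fls_const (rconst c)) (fps_to_fls g) r = fps_to_fls (s * inverse t)"
    by (simp only: r(1) S.rat_eval_Fract[OF r(2)] s t divide_inverse fls_times_fps_to_fls)
  then show ?thesis
    using r by (simp add: s t to_fract_def)
qed

text \<open>For d = 0 only the summand k = 0 survives, and with no powers of x and y it is the value
  of each level at t = 0.\<close>

lemma exp_shift_0_0: "exp_shift rconst rvar 0 g 0 0 = g"
proof (rule fps_ext)
  fix N
  let ?E = "fps_const rvar * Abs_fps (\<lambda>n. rconst (1 / fact n))"
  have E: "fls_const rvar * fps_to_fls (Abs_fps (\<lambda>n. rconst (1 / fact n))) = fps_to_fls ?E"
    by (simp add: fls_times_fps_to_fls)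
  have E0: "fps_nth ?E 0 = rvar" by simp
  have "fps_nth (exp_shift rconst rvar 0 g 0 0) N = (\<Sum>k\<in>{..N}. if k = 0 then fps_nth g N else 0)"
    unfolding exp_shift_def fps_nth_Abs_fps
    by (rule sum.cong) (auto simp: E rat_eval_shift_nth_0[OF E0] power_0_left)
  then show "fps_nth (exp_shift rconst rvar 0 g 0 0) N = fps_nth g N" by simp
qed

text \<open>\<open>smat\<close> also has entries at lists of wrong length; this is the normalisation
  there under which the description in \<open>smat_inv\<close> can be unique.\<close>

definition smat_supported :: "'l::zero smat \<Rightarrow> bool" where
  "smat_supported A \<longleftrightarrow> (\<forall>I J e. \<not> (length I = 2 \<and> length J = 2 \<and> length e = 2) \<longrightarrow> A I J e = 0)"

text \<open>Over two tensor factors, the entries of \<open>smat\<close> become power series in two variables, and the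
  multiplication becomes that of matrices over a commutative ring.\<close>

definition smat_gf :: "'l::field smat \<Rightarrow> bool list \<Rightarrow> bool list \<Rightarrow> 'l fps fps fps" where
  "smat_gf A I J = Abs_fps (\<lambda>i. Abs_fps (\<lambda>j. A I J [i, j]))"

lemma smat_gf_nth [simp]: "fps_nth (fps_nth (smat_gf A I J) i) j = A I J [i, j]"
  by (simp add: smat_gf_def)

lemma length_2_iff: "length xs = 2 \<longleftrightarrow> (\<exists>x y. xs = [x, y])"
  by (auto simp: numeral_2_eq_2 length_Suc_conv)

lemma smat_gf_inj:
  assumes "smat_supported A" "smat_supported B"
    and "\<And>I J. I \<in> idx 2 \<Longrightarrow> J \<in> idx 2 \<Longrightarrow> smat_gf A I J = smat_gf B I J"
  shows "A = B"
proof (intro ext)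
  fix I J and e :: "nat list"
  show "A I J e = B I J e"
  proof (cases "length I = 2 \<and> length J = 2 \<and> length e = 2")
    case True
    then obtain i j where e: "e = [i, j]" by (auto simp: length_2_iff)
    have "fps_nth (fps_nth (smat_gf A I J) i) j = fps_nth (fps_nth (smat_gf B I J) i) j"
      using True assms(3) by (simp add: idx_def)
    then show ?thesis by (simp add: e)
  qed (use assms(1,2) in \<open>simp add: smat_supported_def\<close>)
qed

lemma smat_supported_mult: "smat_supported (smat_mult 2 A B)"
  by (auto simp: smat_supported_def smat_mult_def)

lemma smat_supported_one: "smat_supported (smat_one 2)"
  by (auto simp: smat_supported_def smat_one_def)

lemma split2_pair:
  "split2 [i, j] = (\<lambda>(x, y). ([x, y], [i - x, j - y])) ` ({..i} \<times> {..j})"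
proof (intro equalityI subsetI)
  fix p assume "p \<in> split2 [i, j]"
  then obtain x y where p: "p = (x, y)" "length x = 2" "length y = 2" "map2 (+) x y = [i, j]"
    by (auto simp: split2_def)
  then obtain a b c d where "p = ([a, b], [c, d])" "a + c = i" "b + d = j"
    by (auto simp: length_2_iff)
  then show "p \<in> (\<lambda>(x, y). ([x, y], [i - x, j - y])) ` ({..i} \<times> {..j})"
    by (auto intro!: image_eqI[of _ _ "(a, b)"])
qed (auto simp: split2_def)

lemma smat_gf_mult:
  fixes A B :: "'l::field smat"
  assumes "I \<in> idx 2" "J \<in> idx 2"
  shows "smat_gf (smat_mult 2 A B) I J = (\<Sum>K\<in>idx 2. smat_gf A I K * smat_gf B K J)"
proof (rule fps_ext, rule fps_ext)
  fix i j :: nat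
  have inj: "inj_on (\<lambda>(x, y). ([x, y], [i - x, j - y])) ({..i} \<times> {..j})"
    by (auto simp: inj_on_def)
  have split: "(\<Sum>(e1, e2)\<in>split2 [i, j]. F e1 e2) = (\<Sum>x\<le>i. \<Sum>y\<le>j. F [x, y] [i - x, j - y])"
    for F :: "nat list \<Rightarrow> nat list \<Rightarrow> 'l fps"
    unfolding split2_pair
    by (subst sum.reindex[OF inj]) (simp add: sum.cartesian_product case_prod_unfold o_def)
  have "fps_nth (fps_nth (smat_gf (smat_mult 2 A B) I J) i) j =
      (\<Sum>K\<in>idx 2. \<Sum>x\<le>i. \<Sum>y\<le>j. A I K [x, y] * B K J [i - x, j - y])"
    using assms unfolding smat_gf_nth smat_mult_def
    by (simp add: idx_def split)
  also have "\<dots> = fps_nth (fps_nth (\<Sum>K\<in>idx 2. smat_gf A I K * smat_gf B K J) i) j"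
    by (simp add: fps_sum_nth fps_mult_nth atLeast0AtMost)
  finally show "fps_nth (fps_nth (smat_gf (smat_mult 2 A B) I J) i) j =
      fps_nth (fps_nth (\<Sum>K\<in>idx 2. smat_gf A I K * smat_gf B K J) i) j" .
qed

lemma smat_gf_one: "I \<in> idx 2 \<Longrightarrow> smat_gf (smat_one 2) I J = (if I = J then 1 else 0)"
  by (intro fps_ext) (auto simp: smat_one_def idx_def numeral_2_eq_2)

lemma idx_2: "idx 2 = {[False, False], [False, True], [True, False], [True, True]}"
  by (auto simp: idx_def length_2_iff)

lemma finite_idx_2: "finite (idx 2)"
  by (simp add: idx_2)

lemma smat_mult_one_right:
  assumes "smat_supported A"
  shows "smat_mult 2 A (smat_one 2) = A"
proof (rule smat_gf_inj[OF smat_supported_mult assms])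
  fix I J :: "bool list" assume IJ: "I \<in> idx 2" "J \<in> idx 2"
  have "smat_gf (smat_mult 2 A (smat_one 2)) I J = (\<Sum>K\<in>idx 2. smat_gf A I K * (if K = J then 1 else 0))"
    by (simp add: smat_gf_mult IJ smat_gf_one)
  also have "\<dots> = smat_gf A I J"
    using IJ finite_idx_2 by (simp add: if_distrib cong: if_cong)
  finally show "smat_gf (smat_mult 2 A (smat_one 2)) I J = smat_gf A I J" .
qed

text \<open>The usual C = C (A B) = (C A) B = B, carried out on generating functions, where
  reassociation is that of a commutative ring.\<close>

lemma smat_inv_eqI:
  assumes B: "smat_supported B" "smat_mult 2 A B = smat_one 2" "smat_mult 2 B A = smat_one 2"
  shows "smat_inv 2 A = B"
  unfolding smat_inv_def
proof (rule the_equality)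
  show "(\<forall>I J e. \<not> (length I = 2 \<and> length J = 2 \<and> length e = 2) \<longrightarrow> B I J e = 0) \<and>
     smat_mult 2 A B = smat_one 2 \<and> smat_mult 2 B A = smat_one 2"
    using B unfolding smat_supported_def by blast
  fix C
  assume "(\<forall>I J e. \<not> (length I = 2 \<and> length J = 2 \<and> length e = 2) \<longrightarrow> C I J e = 0) \<and>
     smat_mult 2 A C = smat_one 2 \<and> smat_mult 2 C A = smat_one 2"
  then have C: "smat_supported C" "smat_mult 2 C A = smat_one 2"
    unfolding smat_supported_def by blast+
  show "C = B"
  proof (rule smat_gf_inj[OF C(1) B(1)])
    fix I J :: "bool list" assume IJ: "I \<in> idx 2" "J \<in> idx 2"
    have CA: "(\<Sum>K\<in>idx 2. smat_gf C I K * smat_gf A K L) = (if I = L then 1 else 0)" if "L \<in> idx 2" for L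
      using that IJ C(2) by (simp add: smat_gf_mult[symmetric] smat_gf_one)
    have AB: "(\<Sum>L\<in>idx 2. smat_gf A K L * smat_gf B L J) = (if K = J then 1 else 0)" if "K \<in> idx 2" for K
      using that IJ B(2) by (simp add: smat_gf_mult[symmetric] smat_gf_one)
    have "smat_gf C I J = (\<Sum>K\<in>idx 2. smat_gf C I K * (if K = J then 1 else 0))"
      using IJ finite_idx_2 by (simp add: if_distrib cong: if_cong)
    also have "\<dots> = (\<Sum>K\<in>idx 2. smat_gf C I K * (\<Sum>L\<in>idx 2. smat_gf A K L * smat_gf B L J))"
      using AB by (intro sum.cong) simp_all
    also have "\<dots> = (\<Sum>L\<in>idx 2. (\<Sum>K\<in>idx 2. smat_gf C I K * smat_gf A K L) * smat_gf B L J)"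
      unfolding sum_distrib_left sum_distrib_right mult.assoc by (rule sum.swap)
    also have "\<dots> = (\<Sum>L\<in>idx 2. (if I = L then 1 else 0) * smat_gf B L J)"
      using CA by (intro sum.cong) simp_all
    also have "\<dots> = smat_gf B I J"
      using IJ finite_idx_2 by (simp add: if_distrib[of "\<lambda>x. x * _"] cong: if_cong)
    finally show "smat_gf C I J = smat_gf B I J" .
  qed
qed

text \<open>The matrix splits into the blocks with rows (a, d), (d, a) on e_1 e_1, e_2 e_2 and (b,
  c), (c, b) on e_1 e_2, e_2 e_1.\<close>

definition eight_vertex :: "'r \<Rightarrow> 'r \<Rightarrow> 'r \<Rightarrow> 'r \<Rightarrow> bool list \<Rightarrow> bool list \<Rightarrow> 'r::zero" where
  "eight_vertex a b c d I J =
     (if I ! 0 = J ! 0 \<and> I ! 1 = J ! 1 then (if I ! 0 = I ! 1 then a else b)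
      else if I ! 0 \<noteq> J ! 0 \<and> I ! 1 \<noteq> J ! 1 then (if I ! 0 = I ! 1 then d else c)
      else 0)"

text \<open>Cramer's rule for the two 2x2 blocks; \<open>u\<close> and \<open>v\<close> are the
  inverses of their determinants.\<close>

lemma eight_vertex_inverse:
  fixes a b c d :: "'r::comm_ring_1"
  assumes "(a * a - d * d) * u = 1" "(b * b - c * c) * v = 1" and "I \<in> idx 2" "J \<in> idx 2"
  shows "(\<Sum>K\<in>idx 2. eight_vertex a b c d I K * eight_vertex (a * u) (b * v) (- (c * v)) (- (d * u)) K J) =
      (if I = J then 1 else 0)" (is ?right)
    and "(\<Sum>K\<in>idx 2. eight_vertex (a * u) (b * v) (- (c * v)) (- (d * u)) I K * eight_vertex a b c d K J) =
      (if I = J then 1 else 0)" (is ?left)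
proof -
  have *: "a * (a * u) = 1 + d * (d * u)" "b * (b * v) = 1 + c * (c * v)"
    using assms(1,2) by (simp_all add: algebra_simps)
  from assms(3,4) show ?right ?left
    unfolding idx_2 by (elim insertE emptyE; simp add: eight_vertex_def * mult_ac)+
qed

lemma fps_unit_ex: "fps_nth f 0 * y = 1 \<Longrightarrow> \<exists>g. f * g = 1" for f :: "'a::comm_ring_1 fps"
  using fps_right_inverse by blast

text \<open>The two determinants are power series in the two spectral variables and h over a field.
  Such a series is a unit iff its constant term is nonzero, as follows by lifting inverses one
  variable at a time.\<close>

lemma smat_inv_exists:
  fixes A :: "'l::field smat"
  assumes "smat_supported A"
    and A: "\<And>I J. I \<in> idx 2 \<Longrightarrow> J \<in> idx 2 \<Longrightarrow> smat_gf A I J = eight_vertex a b c d I J"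
    and "fps_nth (fps_nth (fps_nth (a * a - d * d) 0) 0) 0 \<noteq> 0"
      "fps_nth (fps_nth (fps_nth (b * b - c * c) 0) 0) 0 \<noteq> 0"
  shows "smat_mult 2 (smat_inv 2 A) A = smat_one 2"
proof -
  have unit: "\<exists>g. f * g = 1" if "fps_nth (fps_nth (fps_nth f 0) 0) 0 \<noteq> 0" for f :: "'l fps fps fps"
  proof -
    have "fps_nth (fps_nth (fps_nth f 0) 0) 0 * inverse (fps_nth (fps_nth (fps_nth f 0) 0) 0) = 1"
      using that by simp
    then obtain g where "fps_nth (fps_nth f 0) 0 * g = 1" using fps_unit_ex by blast
    then obtain g where "fps_nth f 0 * g = 1" using fps_unit_ex by blast
    then show ?thesis by (rule fps_unit_ex)
  qed
  obtain u v where uv: "(a * a - d * d) * u = 1" "(b * b - c * c) * v = 1"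
    using unit assms(3,4) by blast
  define G where "G = eight_vertex (a * u) (b * v) (- (c * v)) (- (d * u))"
  define B where "B = (\<lambda>I J e. if length I = 2 \<and> length J = 2 \<and> length e = 2
    then fps_nth (fps_nth (G I J) (e ! 0)) (e ! 1) else 0)"
  have B: "smat_supported B" by (auto simp: smat_supported_def B_def)
  have gf_B: "smat_gf B I J = G I J" if "I \<in> idx 2" "J \<in> idx 2" for I J
    using that by (intro fps_ext) (simp add: B_def idx_def)
  have "smat_mult 2 A B = smat_one 2"
    by (rule smat_gf_inj[OF smat_supported_mult smat_supported_one])
      (simp add: smat_gf_mult smat_gf_one A gf_B G_def eight_vertex_inverse[OF uv])
  moreover have "smat_mult 2 B A = smat_one 2"
    by (rule smat_gf_inj[OF smat_supported_mult smat_supported_one])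
      (simp add: smat_gf_mult smat_gf_one A gf_B G_def eight_vertex_inverse[OF uv])
  ultimately show ?thesis
    using smat_inv_eqI[OF B] by simp
qed

context
  fixes a :: real and b :: nat
  assumes b: "b > 0"
begin

lemma R_prod_1_1: "R_prod a b rconst rvar [\<epsilon>] [\<epsilon>] d = R_factor a b rconst rvar d 2 0 1"
proof -
  have "smat_supported (R_factor a b rconst rvar d 2 0 1)"
    by (auto simp: smat_supported_def R_factor_def)
  then show ?thesis
    by (simp add: R_prod_def numeral_2_eq_2[symmetric] upt_rec[of "Suc 0"] smat_mult_one_right)
qed

lemma R_prod_zero_exponents:
  "R_prod a b rconst rvar [\<epsilon>] [\<epsilon>] 0 [i1, i2] [j1, j2] [0, 0] = R_rat a b i1 i2 j1 j2"
  by (simp add: R_prod_1_1 R_factor_def exp_shift_0_0 less_2_cases_iff)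

definition R_rat_inv :: "bool list \<Rightarrow> bool list \<Rightarrow> ratfun fps" where
  "R_rat_inv I J = smat_inv 2 (R_prod a b rconst rvar [False] [False] 0) I J [0, 0]"

lemma exp_shift_rconst_0: "exp_shift rconst rvar d 0 i j = 0"
proof -
  let ?E = "fps_const rvar * Abs_fps (\<lambda>n. rconst (1 / fact n))"
  interpret S: rat_subst "\<lambda>c. fls_const (rconst c)" "fps_to_fls ?E"
    by (rule rat_subst_shift) simp
  have E: "fls_const rvar * fps_to_fls (Abs_fps (\<lambda>n. rconst (1 / fact n))) = fps_to_fls ?E"
    by (simp add: fls_times_fps_to_fls)
  show ?thesis
    unfolding exp_shift_def E by (rule fps_ext) simp
qed

text \<open>The map sigma uses the inverse as a series in u and v. The exponent [0, 0] splits only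
  into zero exponents, so the component at u = v = 0 is an inverse of R(z) itself. The determinants
  are 1 at h = 0.\<close>

lemma R_rat_inv_left:
  assumes "I \<in> idx 2" "J \<in> idx 2"
  shows "(\<Sum>K\<in>idx 2. R_rat_inv I K * R_rat a b (K ! 0) (K ! 1) (J ! 0) (J ! 1)) = (if I = J then 1 else 0)"
proof -
  let ?R = "R_prod a b rconst rvar [False] [False] 0"
  define G where "G r = Abs_fps (\<lambda>i. Abs_fps (\<lambda>j. exp_shift rconst rvar 0 r i j))" for r
  let ?A = "R_rat a b False False False False" and ?B = "R_rat a b False True False True"
    and ?C = "R_rat a b False True True False" and ?D = "R_rat a b False False True True"
  have supp: "smat_supported ?R"
    unfolding R_prod_1_1 by (auto simp: smat_supported_def R_factor_def)
  \<comment> \<open>The vanishing entries of \<open>R_rat\<close> are defined through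
    \<open>unexpand0 0\<close>, which has to be evaluated.\<close>
  have unexp: "Abs_fps (\<lambda>n. unexpand0 0) = 0"
    using unexpand0_expand0[of 0] by (intro fps_ext) (simp add: expand0_eq)
  have G_0: "G 0 = 0"
    by (simp add: G_def exp_shift_rconst_0 fps_eq_iff)
  have shape: "smat_gf ?R I J = eight_vertex (G ?A) (G ?B) (G ?C) (G ?D) I J"
    if IJ: "I \<in> idx 2" "J \<in> idx 2" for I J
  proof -
    have "smat_gf ?R I J = G (R_rat a b (I ! 0) (I ! 1) (J ! 0) (J ! 1))"
      using IJ unfolding smat_gf_def G_def R_prod_1_1 R_factor_def
      by (simp add: idx_def less_2_cases_iff)
    also have "R_rat a b (I ! 0) (I ! 1) (J ! 0) (J ! 1) = eight_vertex ?A ?B ?C ?D I J"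
      by (simp add: eight_vertex_def R_rat_def R_ell_def unexp)
    also have "G \<dots> = eight_vertex (G ?A) (G ?B) (G ?C) (G ?D) I J"
      by (simp add: eight_vertex_def G_0)
    finally show ?thesis .
  qed
  have 0: "fps_nth (fps_nth (fps_nth (G r) 0) 0) 0 = fps_nth r 0" for r
    by (simp add: G_def exp_shift_0_0)
  have "smat_mult 2 (smat_inv 2 ?R) ?R = smat_one 2"
    by (rule smat_inv_exists[OF supp shape]) (simp_all add: 0 R_rat_nth_0 b)
  then have "smat_mult 2 (smat_inv 2 ?R) ?R I J [0, 0] = smat_one 2 I J [0, 0]"
    by simp
  moreover have "split2 [0, 0] = {([0, 0], [0, 0])}"
    by (simp add: split2_pair)
  moreover have "?R K J [0, 0] = R_rat a b (K ! 0) (K ! 1) (J ! 0) (J ! 1)" if K: "K \<in> idx 2" for K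
  proof -
    obtain k1 k2 where "K = [k1, k2]"
      using K by (auto simp: idx_def length_2_iff)
    moreover obtain j1 j2 where "J = [j1, j2]"
      using assms by (auto simp: idx_def length_2_iff)
    ultimately show ?thesis by (simp add: R_prod_zero_exponents)
  qed
  ultimately show ?thesis
    using assms by (simp add: smat_mult_def smat_one_def idx_def R_rat_inv_def numeral_2_eq_2)
qed

end

section \<open>Sums and linear maps over power series in h\<close>

lemma hpow_0 [simp]: "0 \<in> hpow n"
  by (simp add: hpow_def)

lemma hpow_minus: "x \<in> hpow n \<Longrightarrow> - x \<in> hpow n" for x :: "'a::group_add fps"
  by (simp add: hpow_def)

lemma hpow_diff: "x \<in> hpow n \<Longrightarrow> y \<in> hpow n \<Longrightarrow> x - y \<in> hpow n" for x y :: "'a::group_add fps"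
  by (simp add: hpow_def)

lemma hpow_sum: "(\<And>a. a \<in> A \<Longrightarrow> f a \<in> hpow n) \<Longrightarrow> sum f A \<in> hpow n" for f :: "'b \<Rightarrow> 'a::comm_monoid_add fps"
  by (auto simp: hpow_def fps_sum_nth intro!: sum.neutral)

lemma hpow_all_imp_0: "(\<And>n. x \<in> hpow n) \<Longrightarrow> x = 0"
  by (intro fps_ext) (auto simp: hpow_def)

lemma hsum_nth:
  assumes "finite S" "\<And>k. k \<notin> S \<Longrightarrow> fps_nth (g k) N = 0"
  shows "fps_nth (hsum g) N = (\<Sum>k\<in>S. fps_nth (g k) N)"
  unfolding hsum_def fps_nth_Abs_fps
  using assms by (intro Sum_any.expand_superset) auto

lemma hpow_hsum: "(\<And>k. g k \<in> hpow n) \<Longrightarrow> hsum g \<in> hpow n"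
  by (simp add: hpow_def hsum_def)

lemma hsummable_add: "hsummable f \<Longrightarrow> hsummable g \<Longrightarrow> hsummable (\<lambda>k. f k + g k)"
  for f g :: "'k \<Rightarrow> 'u::comm_monoid_add fps"
  unfolding hsummable_def
proof
  fix N
  assume "\<forall>N. finite {k. fps_nth (f k) N \<noteq> 0}" "\<forall>N. finite {k. fps_nth (g k) N \<noteq> 0}"
  then have "finite ({k. fps_nth (f k) N \<noteq> 0} \<union> {k. fps_nth (g k) N \<noteq> 0})" by simp
  then show "finite {k. fps_nth (f k + g k) N \<noteq> 0}" by (rule rev_finite_subset) auto
qed

lemma hsum_add:
  fixes f g :: "'k \<Rightarrow> 'u::comm_monoid_add fps"
  assumes "hsummable f" "hsummable g"
  shows "hsum (\<lambda>k. f k + g k) = hsum f + hsum g"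
  using assms by (intro fps_ext) (simp add: hsum_def hsummable_def Sum_any.distrib)

lemma hsummable_0: "hsummable (\<lambda>k. 0)"
  by (simp add: hsummable_def)

lemma hsum_0: "hsum (\<lambda>k. 0) = 0"
  by (intro fps_ext) (simp add: hsum_def)

lemma hsummable_sum:
  fixes f :: "'a \<Rightarrow> 'k \<Rightarrow> 'u::comm_monoid_add fps"
  shows "(\<And>a. a \<in> A \<Longrightarrow> hsummable (f a)) \<Longrightarrow> hsummable (\<lambda>k. \<Sum>a\<in>A. f a k)"
  by (induction A rule: infinite_finite_induct) (auto simp: hsummable_0 intro: hsummable_add)

lemma hsum_sum:
  fixes f :: "'a \<Rightarrow> 'k \<Rightarrow> 'u::comm_monoid_add fps"
  shows "(\<And>a. a \<in> A \<Longrightarrow> hsummable (f a)) \<Longrightarrow> hsum (\<lambda>k. \<Sum>a\<in>A. f a k) = (\<Sum>a\<in>A. hsum (f a))"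
  by (induction A rule: infinite_finite_induct)
    (simp_all add: hsum_0 hsum_add hsummable_sum)

lemma hsum_swap:
  fixes f :: "'a \<Rightarrow> 'b \<Rightarrow> 'u::comm_monoid_add fps"
  assumes "\<And>N. finite {(a, b). fps_nth (f a b) N \<noteq> 0}"
  shows "hsum (\<lambda>a. hsum (f a)) = hsum (\<lambda>b. hsum (\<lambda>a. f a b))"
proof (rule fps_ext)
  fix N
  let ?S = "{(a, b). fps_nth (f a b) N \<noteq> 0}"
  have "finite (fst ` ?S \<times> snd ` ?S)" using assms by simp
  then have "Sum_any (\<lambda>a. Sum_any (\<lambda>b. fps_nth (f a b) N)) = Sum_any (\<lambda>b. Sum_any (\<lambda>a. fps_nth (f a b) N))"
    by (rule Sum_any.swap) force
  then show "fps_nth (hsum (\<lambda>a. hsum (f a))) N = fps_nth (hsum (\<lambda>b. hsum (\<lambda>a. f a b))) N"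
    by (simp add: hsum_def)
qed

lemma hsum_reindex:
  fixes f :: "'b \<Rightarrow> 'u::comm_monoid_add fps"
  assumes "bij g"
  shows "hsum (\<lambda>k. f (g k)) = hsum f"
  by (rule fps_ext) (simp add: hsum_def, rule Sum_any.reindex_cong[symmetric, OF assms], simp add: o_def)

lemma hscale_nth: "fps_nth (hscale sc c x) n = (\<Sum>i\<le>n. sc (fps_nth c i) (fps_nth x (n - i)))"
  by (simp add: hscale_def)

context module
begin

lemma module_hscale: "module (hscale scale)"
proof
  fix a b :: "'a fps" and x y :: "'b fps"
  show "hscale scale a (x + y) = hscale scale a x + hscale scale a y"
    by (rule fps_ext) (simp add: hscale_nth scale_right_distrib sum.distrib)
  show "hscale scale (a + b) x = hscale scale a x + hscale scale b x"
    by (rule fps_ext) (simp add: hscale_nth scale_left_distrib sum.distrib)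
  show "hscale scale 1 x = x"
  proof (rule fps_ext)
    fix n
    have "fps_nth (hscale scale 1 x) n = (\<Sum>i\<in>{0}. scale (fps_nth 1 i) (fps_nth x (n - i)))"
      unfolding hscale_nth by (rule sum.mono_neutral_right) auto
    then show "fps_nth (hscale scale 1 x) n = fps_nth x n" by simp
  qed
  show "hscale scale a (hscale scale b x) = hscale scale (a * b) x"
  proof (rule fps_ext)
    fix n
    let ?f = "\<lambda>i j l. scale (fps_nth a i * fps_nth b j) (fps_nth x l)"
    have "fps_nth (hscale scale a (hscale scale b x)) n = (\<Sum>j=0..n. \<Sum>i=0..n - j. ?f j i (n - j - i))"
      by (simp add: hscale_nth scale_sum_right atLeast0AtMost)
    also have "\<dots> = (\<Sum>j=0..n. \<Sum>i=0..j. ?f i (j - i) (n - j))"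
      by (rule fps_mult_assoc_lemma[symmetric])
    also have "\<dots> = fps_nth (hscale scale (a * b) x) n"
      by (simp add: hscale_nth fps_mult_nth scale_sum_left atLeast0AtMost)
    finally show "fps_nth (hscale scale a (hscale scale b x)) n = fps_nth (hscale scale (a * b) x) n" .
  qed
qed

lemma hpow_hscale: "c \<in> hpow m \<Longrightarrow> x \<in> hpow n \<Longrightarrow> hscale scale c x \<in> hpow (m + n)"
proof -
  assume c: "c \<in> hpow m" and x: "x \<in> hpow n"
  have "scale (fps_nth c i) (fps_nth x (k - i)) = 0" if "k < m + n" "i \<le> k" for k i
  proof (cases "i < m")
    case False
    then have "k - i < n" using that by linarith
    then show ?thesis using x by (simp add: hpow_def)
  qed (use c in \<open>simp add: hpow_def\<close>)
  then show "hscale scale c x \<in> hpow (m + n)"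
    by (auto simp: hpow_def hscale_nth intro!: sum.neutral)
qed

lemma hpow_hscale_right: "x \<in> hpow n \<Longrightarrow> hscale scale c x \<in> hpow n"
  using hpow_hscale[of c 0 x n] by (simp add: hpow_def[of 0])

lemma hpow_hscale_left: "c \<in> hpow n \<Longrightarrow> hscale scale c x \<in> hpow n"
  using hpow_hscale[of c n x 0] by (simp add: hpow_def[of 0])

lemma hscale_monom_nth:
  "fps_nth (hscale scale (fps_const d * fps_X ^ m) x) n = (if n < m then 0 else scale d (fps_nth x (n - m)))"
proof -
  have "fps_nth (hscale scale (fps_const d * fps_X ^ m) x) n =
      (\<Sum>i\<le>n. if i = m then scale d (fps_nth x (n - i)) else 0)"
    unfolding hscale_nth by (rule sum.cong) (auto simp: fps_mult_left_const_nth)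
  then show ?thesis by simp
qed

lemma hscale_const_nth: "fps_nth (hscale scale (fps_const d) x) n = scale d (fps_nth x n)"
  using hscale_monom_nth[of d 0 x n] by simp

lemma hpow_conv_hscale: "x \<in> hpow n \<Longrightarrow> x = hscale scale (fps_X ^ n) (fps_shift n x)"
  using hscale_monom_nth[of 1 n "fps_shift n x"] by (intro fps_ext) (auto simp: hpow_def)

lemma hscale_fps_const: "hscale scale (fps_const c) (fps_const x) = fps_const (scale c x)"
  by (rule fps_ext) (simp add: hscale_const_nth)

end

text \<open>The submodule \<open>hpow n\<close> consists of the multiples of h^n, so linearity alone
  gives h-adic continuity.\<close>

lemma hom_hpow:
  assumes f: "module_hom (hscale sc1) (hscale sc2) f" and "module sc1" "module sc2" and x: "x \<in> hpow n"
  shows "f x \<in> hpow n"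
proof -
  have "f x = hscale sc2 (fps_X ^ n) (f (fps_shift n x))"
    using module.hpow_conv_hscale[OF \<open>module sc1\<close> x] module_hom.scale[OF f] by metis
  then show ?thesis
    using module.hpow_hscale_left[OF \<open>module sc2\<close> hpow_X_power[of n]] by simp
qed

lemma
  assumes f: "module_hom (hscale sc1) (hscale sc2) f" and mods: "module sc1" "module sc2"
    and g: "hsummable g"
  shows hom_hsum: "f (hsum g) = hsum (\<lambda>k. f (g k))" and hom_hsummable: "hsummable (\<lambda>k. f (g k))"
proof -
  interpret module_hom "hscale sc1" "hscale sc2" f by (rule f)
  \<comment> \<open>Level \<open>N\<close> of the image can depend on all levels up to
    \<open>N\<close> of the argument, hence the union.\<close>
  define S where "S N = (\<Union>M\<in>{..N}. {k. fps_nth (g k) M \<noteq> 0})" for N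
  have fin: "finite (S N)" for N using g by (simp add: S_def hsummable_def)
  have "g k \<in> hpow (Suc N)" if "k \<notin> S N" for k N
    using that by (auto simp: S_def hpow_def less_Suc_eq_le)
  then have "f (g k) \<in> hpow (Suc N)" if "k \<notin> S N" for k N
    using that by (intro hom_hpow[OF f mods]) auto
  then have out: "fps_nth (f (g k)) N = 0" if "k \<notin> S N" for k N
    using that by (simp add: hpow_def)
  show "hsummable (\<lambda>k. f (g k))"
    unfolding hsummable_def
  proof
    fix N show "finite {k. fps_nth (f (g k)) N \<noteq> 0}"
      by (rule finite_subset[OF _ fin[of N]]) (use out in blast)
  qed
  show "f (hsum g) = hsum (\<lambda>k. f (g k))"
  proof (rule fps_ext)
    fix N
    have "hsum g - sum g (S N) \<in> hpow (Suc N)"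
      unfolding hpow_def
    proof (clarify)
      fix M assume "M < Suc N"
      then have "fps_nth (hsum g) M = (\<Sum>k\<in>S N. fps_nth (g k) M)"
        by (intro hsum_nth fin) (auto simp: S_def)
      then show "fps_nth (hsum g - sum g (S N)) M = 0" by (simp add: fps_sum_nth)
    qed
    then have "f (hsum g - sum g (S N)) \<in> hpow (Suc N)" by (rule hom_hpow[OF f mods])
    then have "fps_nth (f (hsum g)) N = fps_nth (f (sum g (S N))) N"
      by (simp add: diff hpow_def)
    also have "\<dots> = (\<Sum>k\<in>S N. fps_nth (f (g k)) N)" by (simp add: sum fps_sum_nth)
    also have "\<dots> = fps_nth (hsum (\<lambda>k. f (g k))) N"
      by (rule hsum_nth[symmetric]) (use fin out in auto)
    finally show "fps_nth (f (hsum g)) N = fps_nth (hsum (\<lambda>k. f (g k))) N" .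
  qed
qed

lemma (in module) module_hom_hscale: "module_hom (hscale scale) (hscale scale) (hscale scale c)"
proof -
  interpret h: module "hscale scale" by (rule module_hscale)
  show ?thesis by (simp add: module_hom_iff module_hscale h.scale_right_distrib mult.commute)
qed

section \<open>Linear maps on modules with a basis: uniqueness and extension\<close>

lemma lookup_pscale [simp]: "Poly_Mapping.lookup (pscale c p) k = c * Poly_Mapping.lookup p k"
  by (simp add: pscale_def Poly_Mapping.map.rep_eq when_def)

lemma module_pscale: "module (pscale :: 'c::comm_ring_1 \<Rightarrow> ('i \<Rightarrow>\<^sub>0 'c) \<Rightarrow> _)"
  by unfold_locales (auto intro!: poly_mapping_eqI simp: lookup_add algebra_simps)

lemma poly_mapping_sum_single: "p = (\<Sum>k\<in>Poly_Mapping.keys p. Poly_Mapping.single k (Poly_Mapping.lookup p k))"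
  by (rule poly_mapping_eqI)
    (auto simp: lookup_sum lookup_single when_def not_in_keys_iff_lookup_eq_zero)

lemma pscale_single: "pscale c (Poly_Mapping.single k d) = Poly_Mapping.single k (c * d)"
  by (rule poly_mapping_eqI) (simp add: lookup_single when_def)

text \<open>The difference kills all finite combinations of basis vectors, in particular the
  constant term of x. So its value at x is h times its value at another element, and iterating this
  puts it into every \<open>hpow n\<close>.\<close>

lemma hom_eqI:
  fixes f g :: "('k \<Rightarrow>\<^sub>0 'c::comm_ring_1) fps \<Rightarrow> 'u::ab_group_add fps"
  assumes f: "module_hom (hscale pscale) (hscale sc) f" and g: "module_hom (hscale pscale) (hscale sc) g"
    and "module sc"
    and eq: "\<And>k. f (fps_const (Poly_Mapping.single k 1)) = g (fps_const (Poly_Mapping.single k 1))"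
  shows "f x = g x"
proof -
  interpret sc: module sc by fact
  interpret P: module "pscale :: 'c \<Rightarrow> ('k \<Rightarrow>\<^sub>0 'c) \<Rightarrow> _" by (rule module_pscale)
  define D where "D x = f x - g x" for x
  interpret D: module_hom "hscale pscale" "hscale sc" D
    unfolding D_def using f g
    by (simp add: module_hom_iff module.scale_right_diff_distrib)
  have const: "D (fps_const p) = 0" for p
  proof -
    have "fps_const p = (\<Sum>k\<in>Poly_Mapping.keys p. fps_const (Poly_Mapping.single k (Poly_Mapping.lookup p k)))"
      by (subst poly_mapping_sum_single[of p]) (rule fps_ext, simp add: fps_sum_nth)
    also have "\<dots> = (\<Sum>k\<in>Poly_Mapping.keys p.
        hscale pscale (fps_const (Poly_Mapping.lookup p k)) (fps_const (Poly_Mapping.single k 1)))"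
      by (simp add: P.hscale_fps_const pscale_single)
    finally show ?thesis
      by (simp add: D.sum D.scale) (simp add: D_def eq)
  qed
  have "D x \<in> hpow n" for n x
  proof (induction n arbitrary: x)
    case (Suc n)
    have "x - fps_const (fps_nth x 0) \<in> hpow 1" by (simp add: hpow_def)
    then obtain y where "x - fps_const (fps_nth x 0) = hscale pscale (fps_X ^ 1) y"
      using P.hpow_conv_hscale by blast
    then have x: "x = fps_const (fps_nth x 0) + hscale pscale (fps_X ^ 1) y"
      by (simp add: algebra_simps)
    have "D x = hscale sc (fps_X ^ 1) (D y)"
      by (subst x) (simp add: D.add D.scale const)
    then show ?case
      using sc.hpow_hscale[OF hpow_X_power[of 1] Suc[of y]] by simp
  qed (simp add: hpow_def)
  then have "D x = 0" by (rule hpow_all_imp_0)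
  then show ?thesis by (simp add: D_def)
qed

definition lin_ext :: "('c \<Rightarrow> 'u \<Rightarrow> 'u) \<Rightarrow> ('k \<Rightarrow> 'u fps) \<Rightarrow> ('k \<Rightarrow>\<^sub>0 'c::zero) fps \<Rightarrow> 'u::ab_group_add fps" where
  "lin_ext sc F x = Abs_fps (\<lambda>N. \<Sum>n\<le>N. \<Sum>k\<in>Poly_Mapping.keys (fps_nth x n).
     sc (Poly_Mapping.lookup (fps_nth x n) k) (fps_nth (F k) (N - n)))"

context module
begin

lemma module_hom_lin_ext: "module_hom (hscale pscale) (hscale scale) (lin_ext scale F)"
proof -
  define ev where "ev p i = (\<Sum>k\<in>Poly_Mapping.keys p. scale (Poly_Mapping.lookup p k) (fps_nth (F k) i))" for p i
  have lin: "fps_nth (lin_ext scale F x) N = (\<Sum>n\<le>N. ev (fps_nth x n) (N - n))" for x N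
    by (simp add: lin_ext_def ev_def)
  have add: "ev (p + q) i = ev p i + ev q i" for p q i
    unfolding ev_def by (rule setsum_keys_plus_distrib) (simp_all add: scale_left_distrib)
  have sum: "ev (sum p A) i = (\<Sum>a\<in>A. ev (p a) i)" for p i and A :: "nat set"
    by (induction A rule: infinite_finite_induct) (simp_all add: add ev_def[of 0])
  have sc: "ev (pscale c p) i = scale c (ev p i)" for c p i
    unfolding ev_def scale_sum_right
    by (rule sum.mono_neutral_cong_left) (auto simp: in_keys_iff)
  show ?thesis
    unfolding module_hom_iff
  proof (intro conjI allI)
    show "module (hscale (pscale :: 'a \<Rightarrow> ('d \<Rightarrow>\<^sub>0 'a) \<Rightarrow> _))"
      by (rule module.module_hscale[OF module_pscale])
    show "module (hscale scale)" by (rule module_hscale)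
    show "lin_ext scale F (x + y) = lin_ext scale F x + lin_ext scale F y" for x y
      by (rule fps_ext) (simp add: lin add sum.distrib)
    show "lin_ext scale F (hscale pscale c x) = hscale scale c (lin_ext scale F x)" for c x
    proof (rule fps_ext)
      fix N
      let ?f = "\<lambda>i k l. scale (fps_nth c i) (ev (fps_nth x k) l)"
      have "fps_nth (lin_ext scale F (hscale pscale c x)) N = (\<Sum>n=0..N. \<Sum>i=0..n. ?f i (n - i) (N - n))"
        by (simp add: lin hscale_nth sum sc atLeast0AtMost)
      also have "\<dots> = (\<Sum>n=0..N. \<Sum>i=0..N - n. ?f n i (N - n - i))"
        by (rule fps_mult_assoc_lemma)
      also have "\<dots> = fps_nth (hscale scale c (lin_ext scale F x)) N"
        by (simp add: lin hscale_nth scale_sum_right atLeast0AtMost)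
      finally show "fps_nth (lin_ext scale F (hscale pscale c x)) N = fps_nth (hscale scale c (lin_ext scale F x)) N" .
    qed
  qed
qed

lemma lin_ext_single: "lin_ext scale F (fps_const (Poly_Mapping.single k 1)) = F k"
proof (rule fps_ext)
  fix N
  have "fps_nth (lin_ext scale F (fps_const (Poly_Mapping.single k 1))) N =
      (\<Sum>n\<le>N. if n = 0 then fps_nth (F k) N else 0)"
    unfolding lin_ext_def fps_nth_Abs_fps by (rule sum.cong) (auto simp: lookup_single)
  then show "fps_nth (lin_ext scale F (fps_const (Poly_Mapping.single k 1))) N = fps_nth (F k) N"
    by simp
qed

end

section \<open>Series in two variables\<close>

text \<open>Modulo h^n only n Laurent series are involved; their smallest subdegree bounds the
  exponents. The inserted 0 guards the minimum for n = 0.\<close>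

lemma lcoeff_hpow: "\<exists>J. \<forall>j<J. lcoeff G j \<in> hpow n"
proof (intro exI allI impI)
  let ?J = "Min (insert 0 ((\<lambda>m. fls_subdegree (fps_nth G m)) ` {..<n}))"
  fix j assume "j < ?J"
  then have "j < fls_subdegree (fps_nth G m)" if "m < n" for m
    using that by (subst (asm) Min_gr_iff) auto
  then show "lcoeff G j \<in> hpow n"
    by (simp add: hpow_def lcoeff_def)
qed

lemma lcoeff_add: "lcoeff (G + H) j = lcoeff G j + lcoeff H j"
  by (rule fps_ext) (simp add: lcoeff_def)

lemma lcoeff_0 [simp]: "lcoeff 0 j = 0"
  by (rule fps_ext) (simp add: lcoeff_def)

lemma
  fixes f g :: "complex fls"
  shows fls_times_nth_Sum_any: "fls_nth (f * g) m = Sum_any (\<lambda>j. fls_nth f j * fls_nth g (m - j))"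
    and finite_fls_times: "finite {j. fls_nth f j * fls_nth g (m - j) \<noteq> 0}"
proof -
  have sub: "{j. fls_nth f j * fls_nth g (m - j) \<noteq> 0} \<subseteq> {fls_subdegree f..m - fls_subdegree g}"
    using fls_subdegree_leI by force
  then show "finite {j. fls_nth f j * fls_nth g (m - j) \<noteq> 0}"
    by (rule finite_subset) simp
  show "fls_nth (f * g) m = Sum_any (\<lambda>j. fls_nth f j * fls_nth g (m - j))"
    unfolding fls_times_nth(2) by (rule Sum_any.expand_superset[symmetric]) (use sub in auto)
qed

lemma
  shows lcoeff_mult: "lcoeff (G * H) m = hsum (\<lambda>j. lcoeff G j * lcoeff H (m - j))"
    and hsummable_lcoeff_mult: "hsummable (\<lambda>j. lcoeff G j * lcoeff H (m - j))"
proof -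
  have nth: "fps_nth (lcoeff G j * lcoeff H (m - j)) n =
      (\<Sum>a\<le>n. fls_nth (fps_nth G a) j * fls_nth (fps_nth H (n - a)) (m - j))" for j n
    by (simp add: fps_mult_nth lcoeff_def atLeast0AtMost)
  have fin: "finite (\<Union>a\<le>n. {j. fls_nth (fps_nth G a) j * fls_nth (fps_nth H (n - a)) (m - j) \<noteq> 0})" (is "finite (?S n)") for n
    by (intro finite_UN_I finite_fls_times) simp
  have out: "fps_nth (lcoeff G j * lcoeff H (m - j)) n = 0" if "j \<notin> ?S n" for j n
    unfolding nth by (rule sum.neutral) (use that in blast)
  show "hsummable (\<lambda>j. lcoeff G j * lcoeff H (m - j))"
    unfolding hsummable_def
  proof
    fix n show "finite {j. fps_nth (lcoeff G j * lcoeff H (m - j)) n \<noteq> 0}"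
      by (rule finite_subset[OF _ fin[of n]]) (use out in blast)
  qed
  show "lcoeff (G * H) m = hsum (\<lambda>j. lcoeff G j * lcoeff H (m - j))"
  proof (rule fps_ext)
    fix n
    have "fps_nth (hsum (\<lambda>j. lcoeff G j * lcoeff H (m - j))) n =
        (\<Sum>j\<in>?S n. fps_nth (lcoeff G j * lcoeff H (m - j)) n)"
      by (rule hsum_nth[OF fin out])
    also have "\<dots> = (\<Sum>a\<le>n. \<Sum>j\<in>?S n. fls_nth (fps_nth G a) j * fls_nth (fps_nth H (n - a)) (m - j))"
      unfolding nth by (rule sum.swap)
    also have "\<dots> = (\<Sum>a\<le>n. fls_nth (fps_nth G a * fps_nth H (n - a)) m)"
    proof (intro sum.cong refl)
      fix a assume "a \<in> {..n}"
      then show "(\<Sum>j\<in>?S n. fls_nth (fps_nth G a) j * fls_nth (fps_nth H (n - a)) (m - j)) =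
          fls_nth (fps_nth G a * fps_nth H (n - a)) m"
        unfolding fls_times_nth_Sum_any
        by (intro Sum_any.expand_superset[symmetric] fin) auto
    qed
    also have "\<dots> = fps_nth (lcoeff (G * H) m) n"
      by (simp add: lcoeff_def fps_mult_nth atLeast0AtMost fls_nth_sum)
    finally show "fps_nth (lcoeff (G * H) m) n = fps_nth (hsum (\<lambda>j. lcoeff G j * lcoeff H (m - j))) n" ..
  qed
qed

text \<open>Coefficient functions of series in \<open>z_1, z_2\<close> whose exponents of \<open>z_1\<close> are bounded below modulo
  every power of h: on these, series in \<open>z_1/z_2\<close> act, and \<open>z_1^2 - z_2^2\<close> is not a zero divisor.\<close>

definition tame :: "(int \<Rightarrow> int \<Rightarrow> 'w::zero fps) \<Rightarrow> bool" where
  "tame X \<longleftrightarrow> (\<forall>n. \<exists>K. \<forall>k<K. \<forall>l. X k l \<in> hpow n)"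

lemma tame_sum:
  fixes X :: "'a \<Rightarrow> int \<Rightarrow> int \<Rightarrow> 'w::comm_monoid_add fps"
  assumes "finite A" "\<And>a. a \<in> A \<Longrightarrow> tame (X a)"
  shows "tame (\<lambda>k l. \<Sum>a\<in>A. X a k l)"
  unfolding tame_def
proof
  fix n
  have "\<forall>a\<in>A. \<exists>K. \<forall>k<K. \<forall>l. X a k l \<in> hpow n"
    using assms(2) by (auto simp: tame_def)
  then obtain K where K: "\<And>a k l. a \<in> A \<Longrightarrow> k < K a \<Longrightarrow> X a k l \<in> hpow n"
    by metis
  show "\<exists>K. \<forall>k<K. \<forall>l. (\<Sum>a\<in>A. X a k l) \<in> hpow n"
  proof (intro exI[of _ "Min (insert 0 (K ` A))"] allI impI hpow_sum)
    fix k l a assume "k < Min (insert 0 (K ` A))" "a \<in> A"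
    then show "X a k l \<in> hpow n"
      using assms(1) by (intro K) auto
  qed
qed

lemma tame_diff:
  fixes X Y :: "int \<Rightarrow> int \<Rightarrow> 'w::group_add fps"
  assumes "tame X" "tame Y"
  shows "tame (\<lambda>k l. X k l - Y k l)"
  unfolding tame_def
proof
  fix n
  obtain K L where "\<forall>k<K. \<forall>l. X k l \<in> hpow n" "\<forall>k<L. \<forall>l. Y k l \<in> hpow n"
    using assms unfolding tame_def by blast
  then show "\<exists>K. \<forall>k<K. \<forall>l. X k l - Y k l \<in> hpow n"
    by (intro exI[of _ "min K L"]) (auto intro!: hpow_diff)
qed

section \<open>The action of series in z_1/z_2, and cancelling powers of z_1^2 - z_2^2\<close>

locale complex_module = module scW
  for scW :: "complex \<Rightarrow> 'w \<Rightarrow> 'w::ab_group_add"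
begin

text \<open>The product G(z_1/z_2) X(z_1, z_2), with G expanded in nonnegative direction of
  z_1/z_2.\<close>

definition diag_act :: "complex fls fps \<Rightarrow> (int \<Rightarrow> int \<Rightarrow> 'w fps) \<Rightarrow> int \<Rightarrow> int \<Rightarrow> 'w fps" where
  "diag_act G X k l = hsum (\<lambda>j. hscale scW (lcoeff G j) (X (k - j) (l + j)))"

text \<open>Modulo each power of h, the index j is bounded below by G and above by tameness of
  X.\<close>

lemma hsummable_diag_act:
  assumes "tame X"
  shows "hsummable (\<lambda>j. hscale scW (lcoeff G j) (X (k - j) (l + j)))"
  unfolding hsummable_def
proof
  fix N
  obtain J where J: "\<forall>j<J. lcoeff G j \<in> hpow (Suc N)" using lcoeff_hpow by blast
  obtain K where K: "\<forall>k<K. \<forall>l. X k l \<in> hpow (Suc N)" using assms unfolding tame_def by blast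
  have "hscale scW (lcoeff G j) (X (k - j) (l + j)) \<in> hpow (Suc N)" if "j \<notin> {J..k - K}" for j
  proof (cases "j < J")
    case True
    then show ?thesis using J by (intro hpow_hscale_left) simp
  next
    case False
    then have "k - j < K" using that by auto
    then show ?thesis using K by (intro hpow_hscale_right) simp
  qed
  then have "{j. fps_nth (hscale scW (lcoeff G j) (X (k - j) (l + j))) N \<noteq> 0} \<subseteq> {J..k - K}"
    by (force simp: hpow_def)
  then show "finite {j. fps_nth (hscale scW (lcoeff G j) (X (k - j) (l + j))) N \<noteq> 0}"
    by (rule finite_subset) simp
qed

lemma tame_diag_act:
  assumes "tame X"
  shows "tame (diag_act G X)"
  unfolding tame_def
proof
  fix n
  obtain J where J: "\<forall>j<J. lcoeff G j \<in> hpow n" using lcoeff_hpow by blast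
  obtain K where K: "\<forall>k<K. \<forall>l. X k l \<in> hpow n" using assms unfolding tame_def by blast
  have "hscale scW (lcoeff G j) (X (k - j) (l + j)) \<in> hpow n" if "k < J + K" for j k l
  proof (cases "j < J")
    case True
    then show ?thesis using J by (intro hpow_hscale_left) simp
  next
    case False
    then have "k - j < K" using that by auto
    then show ?thesis using K by (intro hpow_hscale_right) simp
  qed
  then show "\<exists>K. \<forall>k<K. \<forall>l. diag_act G X k l \<in> hpow n"
    unfolding diag_act_def by (intro exI[of _ "J + K"] allI impI hpow_hsum) blast
qed

text \<open>With m the total shift, the lower bounds for G, H and X confine (j, m) to a finite
  rectangle modulo each power of h. This is what permits the exchange of summations.\<close>

lemma diag_act_mult:
  assumes X: "tame X"
  shows "diag_act G (diag_act H X) k l = diag_act (G * H) X k l"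
proof -
  interpret h: module "hscale scW" by (rule module_hscale)
  define f where "f j m = hscale scW (lcoeff G j * lcoeff H (m - j)) (X (k - m) (l + m))" for j m
  have "diag_act G (diag_act H X) k l = hsum (\<lambda>j. hsum (f j))"
  proof -
    have "hscale scW (lcoeff G j) (diag_act H X (k - j) (l + j)) = hsum (f j)" for j
    proof -
      have "hscale scW (lcoeff G j) (diag_act H X (k - j) (l + j)) =
          hsum (\<lambda>i. hscale scW (lcoeff G j) (hscale scW (lcoeff H i) (X (k - j - i) (l + j + i))))"
        unfolding diag_act_def
        by (rule hom_hsum[OF module_hom_hscale module_axioms module_axioms hsummable_diag_act[OF X]])
      also have "\<dots> = hsum (\<lambda>i. f j (j + i))"
        by (simp add: f_def diff_diff_eq add.assoc)
      also have "\<dots> = hsum (f j)"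
        by (rule hsum_reindex) (rule o_bij[of "\<lambda>m. m - j"]; simp add: fun_eq_iff)
      finally show ?thesis .
    qed
    then show ?thesis by (simp add: diag_act_def[of G])
  qed
  also have "\<dots> = hsum (\<lambda>m. hsum (\<lambda>j. f j m))"
  proof (rule hsum_swap)
    fix N
    obtain J where J: "\<forall>j<J. lcoeff G j \<in> hpow (Suc N)" using lcoeff_hpow by blast
    obtain I where I: "\<forall>j<I. lcoeff H j \<in> hpow (Suc N)" using lcoeff_hpow by blast
    obtain K where K: "\<forall>k<K. \<forall>l. X k l \<in> hpow (Suc N)" using X unfolding tame_def by blast
    have f: "f j m = hscale scW (lcoeff G j) (hscale scW (lcoeff H (m - j)) (X (k - m) (l + m)))" for j m
      by (simp add: f_def)
    have "f j m \<in> hpow (Suc N)" if "j < J \<or> m - j < I \<or> k - m < K" for j m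
      using that J I K unfolding f
      by (elim disjE) (blast intro: hpow_hscale_left hpow_hscale_right)+
    then have "fps_nth (f j m) N = 0" if "j < J \<or> m - j < I \<or> k - m < K" for j m
      using that by (simp add: hpow_def)
    then have "{(j, m). fps_nth (f j m) N \<noteq> 0} \<subseteq> {J..k - K - I} \<times> {J + I..k - K}"
      by (force simp: not_less)
    then show "finite {(j, m). fps_nth (f j m) N \<noteq> 0}"
      by (rule finite_subset) simp
  qed
  also have "\<dots> = diag_act (G * H) X k l"
    unfolding diag_act_def
  proof (intro arg_cong[where f = hsum] ext)
    fix m
    have hom: "module_hom (hscale (*)) (hscale scW) (\<lambda>c. hscale scW c x)" for x
    proof -
      have "hscale (*) c d = c * d" for c d :: "complex fps"
        by (rule fps_ext) (simp add: hscale_nth fps_mult_nth atLeast0AtMost)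
      moreover have "module ((*) :: complex \<Rightarrow> _)"
        by unfold_locales (simp_all add: algebra_simps)
      ultimately show ?thesis
        using module.module_hscale[of "(*) :: complex \<Rightarrow> _"]
        by (simp add: module_hom_iff module_hscale h.scale_left_distrib)
    qed
    have "module ((*) :: complex \<Rightarrow> _)"
      by unfold_locales (simp_all add: algebra_simps)
    from hom_hsum[OF hom this module_axioms hsummable_lcoeff_mult]
    show "hsum (\<lambda>j. f j m) = hscale scW (lcoeff (G * H) m) (X (k - m) (l + m))"
      by (simp add: f_def lcoeff_mult)
  qed
  finally show ?thesis .
qed

lemma diag_act_0: "diag_act 0 X k l = 0"
proof -
  interpret h: module "hscale scW" by (rule module_hscale)
  show ?thesis by (simp add: diag_act_def hsum_0)
qed

lemma diag_act_add_left:
  assumes "tame X"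
  shows "diag_act (G + H) X k l = diag_act G X k l + diag_act H X k l"
proof -
  interpret h: module "hscale scW" by (rule module_hscale)
  show ?thesis
    unfolding diag_act_def lcoeff_add h.scale_left_distrib
    by (rule hsum_add) (intro hsummable_diag_act assms)+
qed

lemma diag_act_sum_left:
  assumes "tame X"
  shows "diag_act (sum G A) X k l = (\<Sum>a\<in>A. diag_act (G a) X k l)"
  by (induction A rule: infinite_finite_induct) (simp_all add: diag_act_0 diag_act_add_left assms)

lemma diag_act_sum_right:
  assumes "\<And>a. a \<in> A \<Longrightarrow> tame (X a)"
  shows "diag_act G (\<lambda>k l. \<Sum>a\<in>A. X a k l) k l = (\<Sum>a\<in>A. diag_act G (X a) k l)"
proof -
  interpret h: module "hscale scW" by (rule module_hscale)
  show ?thesis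
    unfolding diag_act_def h.scale_sum_right
    by (rule hsum_sum) (intro hsummable_diag_act assms)
qed

text \<open>Induction on k from the lower bound of tameness. In the coefficient at (k, l + 2r) of
  the product, the summand i = r contains D at (k, l), while all others have a smaller first
  exponent. Exponents count half powers, so \<open>mult_diff\<close> multiplies by (z_1^2 -
  z_2^2)^r.\<close>

lemma tame_mult_diff_cancel:
  assumes D: "tame D" and eq: "\<And>k l. mult_diff scW r D k l \<in> hpow n"
  shows "D k l \<in> hpow n"
proof -
  interpret h: module "hscale scW" by (rule module_hscale)
  obtain K where K: "\<forall>k<K. \<forall>l. D k l \<in> hpow n" using D unfolding tame_def by blast
  have "\<forall>l. D k l \<in> hpow n"
  proof (induction "nat (k - K)" arbitrary: k rule: less_induct)
    case less
    show ?case
    proof (cases "k < K")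
      case False
      show ?thesis
      proof
        fix l
        let ?c = "\<lambda>i. fps_const ((-1) ^ i * of_nat (r choose i)) :: complex fps"
        let ?t = "\<lambda>i. hscale scW (?c i) (D (k - 2 * int (r - i)) (l + 2 * int r - 2 * int i))"
        have IH: "D k' l' \<in> hpow n" if "k' < k" for k' l'
        proof (cases "k' < K")
          case True
          then show ?thesis using K by blast
        next
          case False
          then have "nat (k' - K) < nat (k - K)" using that by simp
          then show ?thesis using less by blast
        qed
        have "mult_diff scW r D k (l + 2 * int r) = sum ?t {..<r} + ?t r"
          by (simp add: mult_diff_def flip: lessThan_Suc_atMost)
        moreover have "sum ?t {..<r} \<in> hpow n"
          by (intro hpow_sum hpow_hscale_right IH) simp
        ultimately have "?t r \<in> hpow n"
          using hpow_diff[OF eq[of k "l + 2 * int r"], of "sum ?t {..<r}"] by simp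
        \<comment> \<open>The coefficient of this summand is the sign (-1)^r, its own
          inverse.\<close>
        then have "hscale scW (?c r) (?t r) \<in> hpow n" by (rule hpow_hscale_right)
        moreover have "hscale scW (?c r) (?t r) = D k l"
          by (simp flip: power_mult_distrib)
        ultimately show "D k l \<in> hpow n" by simp
      qed
    qed (use K in blast)
  qed
  then show ?thesis by blast
qed

lemma mult_diff_diff:
  "mult_diff scW r (\<lambda>k l. X k l - Y k l) k l = mult_diff scW r X k l - mult_diff scW r Y k l"
proof -
  interpret h: module "hscale scW" by (rule module_hscale)
  show ?thesis by (simp add: mult_diff_def h.scale_right_diff_distrib sum_subtractf)
qed

text \<open>In \<open>sigma_local\<close> the multiplication precedes the summation over the
  expansion of sigma. For tame series each summand converges by itself, so the order can be
  reversed.\<close>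

lemma hsum_mult_diff:
  assumes "finite A" and X: "\<And>a. a \<in> A \<Longrightarrow> tame (X a)"
  shows "hsum (\<lambda>j. mult_diff scW r (\<lambda>k l. \<Sum>a\<in>A. hscale scW (lcoeff (G a) j) (X a k l)) (k - j) (l + j)) =
    mult_diff scW r (\<lambda>k l. \<Sum>a\<in>A. diag_act (G a) (X a) k l) k l"
proof -
  interpret h: module "hscale scW" by (rule module_hscale)
  define t where "t i j = (\<Sum>a\<in>A. hscale scW (lcoeff (G a) j)
      (X a (k - 2 * int (r - i) - j) (l - 2 * int i + j)))" for i j
  have sm: "hsummable (t i)" for i
    unfolding t_def by (intro hsummable_sum hsummable_diag_act X)
  have hsum_t: "hsum (t i) = (\<Sum>a\<in>A. diag_act (G a) (X a) (k - 2 * int (r - i)) (l - 2 * int i))" for i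
    unfolding t_def diag_act_def by (intro hsum_sum hsummable_diag_act X)
  have "mult_diff scW r (\<lambda>k l. \<Sum>a\<in>A. hscale scW (lcoeff (G a) j) (X a k l)) (k - j) (l + j) =
      (\<Sum>i\<le>r. hscale scW (fps_const ((-1) ^ i * of_nat (r choose i))) (t i j))" for j
    by (simp add: mult_diff_def t_def algebra_simps)
  then have "hsum (\<lambda>j. mult_diff scW r (\<lambda>k l. \<Sum>a\<in>A. hscale scW (lcoeff (G a) j) (X a k l)) (k - j) (l + j)) =
      (\<Sum>i\<le>r. hsum (\<lambda>j. hscale scW (fps_const ((-1) ^ i * of_nat (r choose i))) (t i j)))"
    by (simp only:) (intro hsum_sum hom_hsummable[OF module_hom_hscale module_axioms module_axioms sm])
  also have "\<dots> = (\<Sum>i\<le>r. hscale scW (fps_const ((-1) ^ i * of_nat (r choose i))) (hsum (t i)))"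
    by (simp only: hom_hsum[OF module_hom_hscale module_axioms module_axioms sm])
  also have "\<dots> = mult_diff scW r (\<lambda>k l. \<Sum>a\<in>A. diag_act (G a) (X a) k l) k l"
    by (simp add: mult_diff_def hsum_t)
  finally show ?thesis .
qed

end

section \<open>Representations of free algebras\<close>

lemma pscale_conv_mult: "pscale c p = Poly_Mapping.single 0 c * p"
  for p :: "'g monom_word \<Rightarrow>\<^sub>0 complex"
  by (simp add: pscale_def mult_map_scale_conv_mult)

lemma single_0_commute: "Poly_Mapping.single 0 c * p = p * Poly_Mapping.single 0 c"
  for p :: "'g monom_word \<Rightarrow>\<^sub>0 complex"
proof -
  have "Poly_Mapping.single 0 c * (\<Sum>k\<in>A. Poly_Mapping.single k (f k)) =
      (\<Sum>k\<in>A. Poly_Mapping.single k (f k)) * Poly_Mapping.single 0 c"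
    for A and f :: "'g monom_word \<Rightarrow> complex"
    by (simp add: sum_distrib_left sum_distrib_right mult_single mult.commute)
  then show ?thesis using poly_mapping_sum_single[of p] by metis
qed

text \<open>The scalars as central elements, which turns \<open>hscale\<close> into a product in the
  free algebra.\<close>

definition scalar_falg :: "complex fps \<Rightarrow> 'g falg" where
  "scalar_falg c = Abs_fps (\<lambda>n. Poly_Mapping.single 0 (fps_nth c n))"

lemma hscale_conv_mult: "hscale pscale c x = scalar_falg c * x" for x :: "'g falg"
  by (rule fps_ext) (simp add: hscale_nth fps_mult_nth scalar_falg_def pscale_conv_mult atLeast0AtMost)

lemma scalar_falg_commute: "scalar_falg c * x = x * scalar_falg c" for x :: "'g falg"
proof (rule fps_ext)
  fix n
  have "fps_nth (scalar_falg c * x) n = (\<Sum>i\<le>n. fps_nth x (n - i) * fps_nth (scalar_falg c) i)"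
    by (simp add: fps_mult_nth scalar_falg_def single_0_commute atLeast0AtMost)
  also have "\<dots> = (\<Sum>i\<le>n. fps_nth x i * fps_nth (scalar_falg c) (n - i))"
    by (subst sum.atLeastAtMost_rev[of _ 0 n, folded atMost_atLeast0]) simp
  also have "\<dots> = fps_nth (x * scalar_falg c) n"
    by (simp add: fps_mult_nth atLeast0AtMost)
  finally show "fps_nth (scalar_falg c * x) n = fps_nth (x * scalar_falg c) n" .
qed

lemma hscale_mult_left: "hscale pscale c x * y = hscale pscale c (x * y)" for x y :: "'g falg"
  by (simp add: hscale_conv_mult mult.assoc)

lemma hscale_mult_right: "x * hscale pscale c y = hscale pscale c (x * y)" for x y :: "'g falg"
  by (metis hscale_conv_mult mult.assoc scalar_falg_commute)

lemma fps_X_mult_conv_hscale: "fps_X * x = hscale pscale fps_X x" for x :: "'g falg"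
proof -
  interpret P: module "pscale :: complex \<Rightarrow> ('g monom_word \<Rightarrow>\<^sub>0 complex) \<Rightarrow> _"
    by (rule module_pscale)
  show ?thesis
    using P.hscale_monom_nth[of 1 1 x] by (intro fps_ext) (simp add: fps_X_mult_nth)
qed

lemma fps_const_single_mult:
  "fps_const (Poly_Mapping.single (Monom_Word gs) 1) * fps_const (Poly_Mapping.single (Monom_Word hs) 1) =
    (fps_const (Poly_Mapping.single (Monom_Word (gs @ hs)) 1) :: 'g falg)"
  by (simp add: mult_single)

lemma one_falg: "(1 :: 'g falg) = fps_const (Poly_Mapping.single (Monom_Word []) 1)"
  by (simp flip: zero_monom_word_def)

lemma module_homI:
  assumes "module s1" "module s2" "\<And>x y. f (x + y) = f x + f y" "\<And>c x. f (s1 c x) = s2 c (f x)"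
  shows "module_hom s1 s2 f"
  using assms by (simp add: module_hom_iff)

context complex_module
begin

text \<open>\<open>foldr\<close> lets the last letter act first, so concatenation of words becomes
  composition of operators.\<close>

definition free_act :: "('g \<Rightarrow> 'w fps \<Rightarrow> 'w fps) \<Rightarrow> 'g falg \<Rightarrow> 'w fps \<Rightarrow> 'w fps" where
  "free_act op x w = lin_ext scW (\<lambda>m. case m of Monom_Word gs \<Rightarrow> foldr op gs w) x"

lemma module_hom_free_act: "module_hom (hscale pscale) (hscale scW) (\<lambda>x. free_act op x w)"
  unfolding free_act_def by (rule module_hom_lin_ext)

lemma free_act_word:
  "free_act op (fps_const (Poly_Mapping.single (Monom_Word gs) 1)) w = foldr op gs w"
  by (simp add: free_act_def lin_ext_single)

lemma falg_hom_eqI: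
  fixes f g :: "'g falg \<Rightarrow> 'w fps"
  assumes "module_hom (hscale pscale) (hscale scW) f" "module_hom (hscale pscale) (hscale scW) g"
    and "\<And>gs. f (fps_const (Poly_Mapping.single (Monom_Word gs) 1)) =
      g (fps_const (Poly_Mapping.single (Monom_Word gs) 1))"
  shows "f x = g x"
  by (rule hom_eqI[OF assms(1,2) module_axioms], case_tac k) (simp add: assms(3))

lemma hom_add:
  "module_hom (hscale pscale) (hscale scW) f \<Longrightarrow> module_hom (hscale pscale) (hscale scW) g \<Longrightarrow>
    module_hom (hscale pscale) (hscale scW) (\<lambda>x. f x + g x)"
  by (auto simp: module_hom_iff module.scale_right_distrib[OF module_hscale])

lemma hom_hscale:
  "module_hom (hscale pscale) (hscale scW) f \<Longrightarrow>
    module_hom (hscale pscale) (hscale scW) (\<lambda>x. hscale scW c (f x))"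
  by (auto simp: module_hom_iff module.scale_right_distrib[OF module_hscale]
      module.scale_scale[OF module_hscale] mult.commute)

lemma hom_mult_left:
  fixes y :: "'g falg"
  assumes "module_hom (hscale pscale) (hscale scW) f"
  shows "module_hom (hscale pscale) (hscale scW) (\<lambda>x. f (y * x))"
    and "module_hom (hscale pscale) (hscale scW) (\<lambda>x. f (x * y))"
  using assms by (auto simp: module_hom_iff hscale_mult_right hscale_mult_left distrib_left distrib_right)

lemma hom_compose:
  assumes "module_hom (hscale scW) (hscale scW) f" "module_hom (hscale pscale) (hscale scW) g"
  shows "module_hom (hscale pscale) (hscale scW) (\<lambda>x. f (g x))"
  using assms by (auto simp: module_hom_iff)

text \<open>The annihilator J of the module is one of the sets intersected in
  \<open>tf_ideal\<close>: it is a two-sided ideal, h-saturated because W has no h-torsion, and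
  closed because the action is continuous and W is separated. Hence it is enough that the relations
  act by zero.\<close>

lemma module_structure_free_act:
  fixes op :: "'g \<Rightarrow> 'w fps \<Rightarrow> 'w fps"
  assumes op: "\<And>g. module_hom (hscale scW) (hscale scW) (op g)"
    and rels: "\<And>x w. x \<in> rels \<Longrightarrow> free_act op x w = 0"
  shows "module_structure scW rels (free_act op)"
proof -
  interpret h: module "hscale scW" by (rule module_hscale)
  interpret hP: module "hscale pscale :: complex fps \<Rightarrow> 'g falg \<Rightarrow> _"
    by (rule module.module_hscale[OF module_pscale])
  have word: "foldr op gs (w1 + w2) = foldr op gs w1 + foldr op gs w2"
      "foldr op gs (hscale scW c w) = hscale scW c (foldr op gs w)" for gs w1 w2 w c
    using op by (induction gs) (simp_all add: module_hom_iff)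
  have hom_w: "module_hom (hscale scW) (hscale scW) (free_act op x)" for x
  proof (rule module_homI[OF module_hscale module_hscale])
    show "free_act op x (w1 + w2) = free_act op x w1 + free_act op x w2" for w1 w2
      by (rule falg_hom_eqI[OF module_hom_free_act hom_add[OF module_hom_free_act module_hom_free_act]])
        (simp add: free_act_word word)
    show "free_act op x (hscale scW c w) = hscale scW c (free_act op x w)" for c w
      by (rule falg_hom_eqI[OF module_hom_free_act hom_hscale[OF module_hom_free_act]])
        (simp add: free_act_word word)
  qed
  have one: "free_act op 1 w = w" for w
    unfolding one_falg free_act_word by simp
  \<comment> \<open>Both sides are linear in x and then in y, which reduces the claim to a pair of
    words.\<close>
  have mult: "free_act op (x * y) w = free_act op x (free_act op y w)" for x y w
  proof (rule falg_hom_eqI[where f = "\<lambda>x. free_act op (x * y) w"])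
    show "module_hom (hscale pscale) (hscale scW) (\<lambda>x. free_act op (x * y) w)"
      by (rule hom_mult_left(2)[OF module_hom_free_act])
    show "module_hom (hscale pscale) (hscale scW) (\<lambda>x. free_act op x (free_act op y w))"
      by (rule module_hom_free_act)
    fix gs
    let ?g = "fps_const (Poly_Mapping.single (Monom_Word gs) 1) :: 'g falg"
    show "free_act op (?g * y) w = free_act op ?g (free_act op y w)"
    proof (rule falg_hom_eqI[where f = "\<lambda>y. free_act op (?g * y) w"])
      show "module_hom (hscale pscale) (hscale scW) (\<lambda>y. free_act op (?g * y) w)"
        by (rule hom_mult_left(1)[OF module_hom_free_act])
      show "module_hom (hscale pscale) (hscale scW) (\<lambda>y. free_act op ?g (free_act op y w))"
        by (rule hom_compose[OF hom_w module_hom_free_act])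
      show "free_act op (?g * fps_const (Poly_Mapping.single (Monom_Word hs) 1)) w =
          free_act op ?g (free_act op (fps_const (Poly_Mapping.single (Monom_Word hs) 1)) w)" for hs
        unfolding fps_const_single_mult free_act_word by simp
    qed
  qed
  define J where "J = {x. \<forall>w. free_act op x w = 0}"
  have lin: "free_act op (x + y) w = free_act op x w + free_act op y w"
      "free_act op (x - y) w = free_act op x w - free_act op y w"
      "free_act op 0 w = 0" "free_act op (hscale pscale c x) w = hscale scW c (free_act op x w)" for x y w c
    using module_hom.add[OF module_hom_free_act] module_hom.diff[OF module_hom_free_act]
      module_hom.zero[OF module_hom_free_act] module_hom.scale[OF module_hom_free_act] by blast+
  have zero: "free_act op x 0 = 0" for x
    using module_hom.zero[OF hom_w] .
  have "tf_ideal rels \<subseteq> J"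
    unfolding tf_ideal_def
  proof (rule Inter_lower, intro CollectI conjI ballI allI impI subsetI)
    show "x \<in> J" if "x \<in> rels" for x using that rels by (simp add: J_def)
    show "0 \<in> J" by (simp add: J_def lin)
    show "x + y \<in> J" if "x \<in> J" "y \<in> J" for x y using that by (simp add: J_def lin)
    show "x * y \<in> J" if "x \<in> J" for x y using that by (simp add: J_def mult)
    show "y * x \<in> J" if "x \<in> J" for x y using that by (simp add: J_def mult zero)
    show "x \<in> J" if "fps_X * x \<in> J" for x
      unfolding J_def
    proof (intro CollectI allI fps_ext)
      fix w n
      have "hscale scW fps_X (free_act op x w) = 0"
        using that by (simp add: J_def fps_X_mult_conv_hscale lin)
      then have "fps_nth (hscale scW (fps_const 1 * fps_X ^ 1) (free_act op x w)) (Suc n) = 0" by simp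
      then show "fps_nth (free_act op x w) n = fps_nth 0 n"
        by (simp only: hscale_monom_nth) simp
    qed
    show "x \<in> J" if lim: "\<forall>n. \<exists>y\<in>J. x - y \<in> hpow n" for x
      unfolding J_def
    proof (intro CollectI allI hpow_all_imp_0)
      fix w n
      obtain y where y: "y \<in> J" "x - y \<in> hpow n" using lim by blast
      have "free_act op (x - y) w \<in> hpow n"
        by (rule hom_hpow[OF module_hom_free_act module_pscale module_axioms y(2)])
      then show "free_act op x w \<in> hpow n" using y(1) by (simp add: lin J_def)
    qed
  qed
  then show ?thesis
    unfolding module_structure_def using module_hom_free_act hom_w one mult
    by (auto simp: J_def)
qed

lemma module_structure_eqI:
  fixes act act' :: "'g falg \<Rightarrow> 'w fps \<Rightarrow> 'w fps"
  assumes act: "module_structure scW rels act" and act': "module_structure scW rels act'"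
    and gen: "\<And>g w. act (gen g) w = act' (gen g) w"
  shows "act = act'"
proof (intro ext)
  fix x w
  show "act x w = act' x w"
  proof (rule falg_hom_eqI)
    show "module_hom (hscale pscale) (hscale scW) (\<lambda>x. act x w)"
        "module_hom (hscale pscale) (hscale scW) (\<lambda>x. act' x w)"
      using act act' by (simp_all add: module_structure_def)
    fix gs
    show "act (fps_const (Poly_Mapping.single (Monom_Word gs) 1)) w =
        act' (fps_const (Poly_Mapping.single (Monom_Word gs) 1)) w"
    proof (induction gs arbitrary: w)
      case Nil
      then show ?case
        using act act' unfolding one_falg[symmetric] by (simp add: module_structure_def)
    next
      case (Cons g gs)
      have "(fps_const (Poly_Mapping.single (Monom_Word (g # gs)) 1) :: 'g falg) =
          gen g * fps_const (Poly_Mapping.single (Monom_Word gs) 1)"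
        unfolding gen_def fps_const_single_mult by simp
      then show ?case
        using act act' Cons.IH gen by (simp only: module_structure_def)
    qed
  qed
qed

lemma hscale_monom_cancel:
  assumes "vector_space scW" "d \<noteq> 0" "hscale scW (fps_const d * fps_X ^ m) x = hscale scW (fps_const d * fps_X ^ m) y"
  shows "x = y"
proof (rule fps_ext)
  fix n
  interpret vector_space scW by fact
  have "fps_nth (hscale scW (fps_const d * fps_X ^ m) x) (n + m) =
      fps_nth (hscale scW (fps_const d * fps_X ^ m) y) (n + m)"
    using assms(3) by simp
  then show "fps_nth x n = fps_nth y n"
    using assms(2) by (simp add: hscale_monom_nth)
qed

end

section \<open>The tensor square and the map \<open>\<sigma>\<close>\<close>

lemma sum_idx_2: "(\<Sum>A\<in>idx 2. f A) = (\<Sum>x\<in>UNIV. \<Sum>y\<in>UNIV. f [x, y])"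
  by (simp add: idx_2 UNIV_bool add.assoc)

lemma hpow_mult_left: "y \<in> hpow n \<Longrightarrow> x * y \<in> hpow n" for x y :: "'a::semiring_0 fps"
  by (auto simp: hpow_def fps_mult_nth intro!: sum.neutral)

definition tensor :: "('i \<Rightarrow>\<^sub>0 complex) \<Rightarrow> ('j \<Rightarrow>\<^sub>0 complex) \<Rightarrow> ('i \<times> 'j \<Rightarrow>\<^sub>0 complex)" where
  "tensor p q = Abs_poly_mapping (\<lambda>(i, j). Poly_Mapping.lookup p i * Poly_Mapping.lookup q j)"

lemma lookup_tensor: "Poly_Mapping.lookup (tensor p q) (i, j) = Poly_Mapping.lookup p i * Poly_Mapping.lookup q j"
proof -
  have "{x. (case x of (i, j) \<Rightarrow> Poly_Mapping.lookup p i * Poly_Mapping.lookup q j) \<noteq> 0} \<subseteq>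
      Poly_Mapping.keys p \<times> Poly_Mapping.keys q"
    by (auto simp: in_keys_iff)
  then have "finite {x. (case x of (i, j) \<Rightarrow> Poly_Mapping.lookup p i * Poly_Mapping.lookup q j) \<noteq> 0}"
    by (rule finite_subset) simp
  then show ?thesis by (simp add: tensor_def)
qed

lemma poly_mapping_pair_eqI:
  "(\<And>i j. Poly_Mapping.lookup p (i, j) = Poly_Mapping.lookup q (i, j)) \<Longrightarrow> p = q"
  by (rule poly_mapping_eqI) auto

lemma tensor_linear:
  "tensor (p + p') q = tensor p q + tensor p' q" "tensor p (q + q') = tensor p q + tensor p q'"
  "tensor (pscale c p) q = pscale c (tensor p q)" "tensor p (pscale c q) = pscale c (tensor p q)"
  "tensor 0 q = 0" "tensor p 0 = 0"
  by (rule poly_mapping_pair_eqI, simp add: lookup_tensor lookup_add algebra_simps)+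

lemma tensor_sum: "tensor (sum f A) q = (\<Sum>a\<in>A. tensor (f a) q)" "tensor p (sum g A) = (\<Sum>a\<in>A. tensor p (g a))"
  by (induction A rule: infinite_finite_induct) (simp_all add: tensor_linear)

lemma htensor_nth: "fps_nth (htensor x y) N = (\<Sum>n\<le>N. tensor (fps_nth x n) (fps_nth y (N - n)))"
  by (simp add: htensor_def tensor_def)

lemma htensor_const_nth: "fps_nth (htensor (fps_const p) y) N = tensor p (fps_nth y N)"
proof -
  have "fps_nth (htensor (fps_const p) y) N = (\<Sum>n\<le>N. if n = 0 then tensor p (fps_nth y N) else 0)"
    unfolding htensor_nth by (rule sum.cong) (auto simp: tensor_linear)
  then show ?thesis by simp
qed

text \<open>The second part takes its first factor at level 0, which covers the basis vectors for
  which it is meant.\<close>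

lemma module_hom_htensor:
  "module_hom (hscale pscale) (hscale pscale) (\<lambda>x. htensor x y)" (is ?A)
  "module_hom (hscale pscale) (hscale pscale) (\<lambda>y. htensor (fps_const p) y)" (is ?B)
proof -
  show ?A
  proof (rule module_homI[OF module.module_hscale[OF module_pscale] module.module_hscale[OF module_pscale]])
    show "htensor (x + x') y = htensor x y + htensor x' y" for x x'
      by (rule fps_ext) (simp add: htensor_nth tensor_linear sum.distrib)
    show "htensor (hscale pscale c x) y = hscale pscale c (htensor x y)" for c x
    proof (rule fps_ext)
      fix N
      let ?f = "\<lambda>i k l. pscale (fps_nth c i) (tensor (fps_nth x k) (fps_nth y l))"
      have "fps_nth (htensor (hscale pscale c x) y) N = (\<Sum>n=0..N. \<Sum>i=0..n. ?f i (n - i) (N - n))"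
        by (simp add: htensor_nth hscale_nth tensor_sum tensor_linear atLeast0AtMost)
      also have "\<dots> = (\<Sum>n=0..N. \<Sum>i=0..N - n. ?f n i (N - n - i))"
        by (rule fps_mult_assoc_lemma)
      also have "\<dots> = fps_nth (hscale pscale c (htensor x y)) N"
        by (simp add: htensor_nth hscale_nth module.scale_sum_right[OF module_pscale] atLeast0AtMost)
      finally show "fps_nth (htensor (hscale pscale c x) y) N = fps_nth (hscale pscale c (htensor x y)) N" .
    qed
  qed
  show ?B
    by (rule module_homI[OF module.module_hscale[OF module_pscale] module.module_hscale[OF module_pscale]];
        rule fps_ext; simp add: htensor_const_nth tensor_linear hscale_nth tensor_sum)
qed

lemma htensor_single:
  "htensor (fps_const (Poly_Mapping.single i 1)) (fps_const (Poly_Mapping.single j 1)) =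
    fps_const (Poly_Mapping.single (i, j) 1)"
proof (rule fps_ext, rule poly_mapping_pair_eqI)
  fix n i' j'
  show "Poly_Mapping.lookup (fps_nth (htensor (fps_const (Poly_Mapping.single i 1)) (fps_const (Poly_Mapping.single j 1))) n) (i', j') =
      Poly_Mapping.lookup (fps_nth (fps_const (Poly_Mapping.single (i, j) 1)) n) (i', j')"
    by (cases "n = 0") (auto simp: htensor_const_nth lookup_tensor lookup_single when_def)
qed

definition expand_h :: "ratfun fps \<Rightarrow> complex fls fps" where
  "expand_h g = Abs_fps (\<lambda>n. expand0 (fps_nth g n))"

lemma expand_h_mult: "expand_h (g * g') = expand_h g * expand_h g'"
  by (rule fps_ext) (simp add: expand_h_def fps_mult_nth expand0_eq X.rat_eval_sum X.rat_eval_mult)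

lemma expand_h_sum: "expand_h (sum f A) = (\<Sum>a\<in>A. expand_h (f a))"
  by (rule fps_ext) (simp add: expand_h_def fps_sum_nth expand0_eq X.rat_eval_sum)

lemma expand_h_delta: "expand_h (if P then 1 else 0) = (if P then 1 else 0)"
  by (rule fps_ext) (simp add: expand_h_def expand0_eq)

lemma expand_h_R_rat: "b > 0 \<Longrightarrow> expand_h (R_rat a b i1 i2 j1 j2) = R_ell a b i1 i2 j1 j2"
  by (rule fps_ext) (simp add: expand_h_def expand0_R_rat)

lemma lookup_subst_coeff:
  "Poly_Mapping.lookup (fps_nth (subst_coeff fls_X s j) n) k =
    fls_nth (expand0 (Poly_Mapping.lookup (fps_nth s n) k)) j"
  by (simp add: subst_coeff_def Poly_Mapping.map.rep_eq when_def expand0_eq)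

lemma subst_coeff_sum: "subst_coeff fls_X (sum f A) j = (\<Sum>a\<in>A. subst_coeff fls_X (f a) j)"
  by (rule fps_ext, rule poly_mapping_eqI)
    (simp add: lookup_subst_coeff lookup_sum fps_sum_nth expand0_eq X.rat_eval_sum fls_nth_sum)

text \<open>All dependence on z sits in the scalar, so extracting a power of z affects only
  \<open>c\<close>.\<close>

lemma subst_coeff_hscale_base_ext:
  "subst_coeff fls_X (hscale pscale c (base_ext t)) j = hscale pscale (lcoeff (expand_h c) j) t"
proof (rule fps_ext, rule poly_mapping_eqI)
  fix n k
  have "Poly_Mapping.lookup (fps_nth (base_ext t) m) k = rconst (Poly_Mapping.lookup (fps_nth t m) k)" for m
    by (simp add: base_ext_def Poly_Mapping.map.rep_eq when_def)
  then show "Poly_Mapping.lookup (fps_nth (subst_coeff fls_X (hscale pscale c (base_ext t)) j) n) k =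
      Poly_Mapping.lookup (fps_nth (hscale pscale (lcoeff (expand_h c) j) t) n) k"
    by (simp add: lookup_subst_coeff hscale_nth lookup_sum expand0_eq
        X.rat_eval_sum X.rat_eval_mult fls_nth_sum lcoeff_def expand_h_def)
qed

lemma split3_0_0: "split3 [0, 0] = {([0, 0], [0, 0], [0, 0])}"
proof (intro equalityI subsetI)
  fix p assume "p \<in> split3 [0, 0]"
  then obtain x y z where p: "p = (x, y, z)" "length x = 2" "length y = 2" "length z = 2"
      "map2 (+) x (map2 (+) y z) = [0, 0]"
    by (auto simp: split3_def)
  then show "p \<in> {([0, 0], [0, 0], [0, 0])}" by (auto simp: length_2_iff)
qed (simp add: split3_def)

lemma T_word_single: "T_word [\<epsilon>] [i] [j] [r] = t_coeff \<epsilon> i j r"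
  by (simp add: T_word_def)

text \<open>One matrix factor on each side and u = v = 0. Only one splitting of the exponents
  remains, and R and its inverse occur as functions of z alone.\<close>

lemma sigma_generators:
  assumes "b > 0" "is_sigma a b \<pi> \<sigma>"
  defines "t \<equiv> \<lambda>i j. \<pi> (t_coeff False i j 0)"
  shows "\<sigma> (htensor (t i1 j1) (t i2 j2)) =
    (\<Sum>A\<in>idx 2. \<Sum>B\<in>idx 2. hscale pscale
       (R_rat a b i1 i2 (A ! 0) (A ! 1) * R_rat_inv a b B [j1, j2])
       (base_ext (htensor (t (A ! 0) (B ! 0)) (t (A ! 1) (B ! 1)))))"
proof -
  let ?R = "R_prod a b rconst rvar [False] [False] 0"
  note sigma = conjunct2[OF assms(2)[unfolded is_sigma_def Let_def], rule_format]
  have "\<sigma> (htensor (\<pi> (T_word [False] [i1] [j1] [0])) (\<pi> (T_word [False] [i2] [j2] [0]))) =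
      (\<Sum>A\<in>idx (1 + 1). \<Sum>B\<in>idx (1 + 1). \<Sum>(x1, x2, x3)\<in>split3 ([0] @ [0]).
         hscale pscale (?R ([i1] @ [i2]) A x1 * smat_inv (1 + 1) ?R B ([j1] @ [j2]) x3)
           (base_ext (htensor
              (\<pi> (T_word [False] (take 1 A) (take 1 B) (take 1 x2)))
              (\<pi> (T_word [False] (drop 1 A) (drop 1 B) (drop 1 x2))))))"
    by (rule sigma) simp
  then show ?thesis
    unfolding one_add_one append_Cons append_Nil split3_0_0 T_word_single t_def
    by (simp add: idx_2 T_word_single R_prod_zero_exponents R_rat_inv_def assms(1))
qed

section \<open>The action of L\<close>

locale deformed_rep = complex_module scW
  for scW :: "complex \<Rightarrow> 'w \<Rightarrow> 'w::ab_group_add" +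
  fixes a :: real and b :: nat
    and \<pi> :: "tgen falg \<Rightarrow> 'i hfree"
    and \<sigma> :: "('i \<times> 'i) hfree \<Rightarrow> ('i \<times> 'i \<Rightarrow>\<^sub>0 ratfun) fps"
    and YW :: "'i hfree \<Rightarrow> 'w fps \<Rightarrow> int \<Rightarrow> 'w fps"
  assumes vector_space: "vector_space scW" and a: "a > 0" and b: "b > 0"
    and hom_pi: "module_hom (hscale pscale) (hscale pscale) \<pi>"
    and sigma: "is_sigma a b \<pi> \<sigma>"
    and hom_YW: "module_hom (hscale pscale) (hscale scW) (\<lambda>v. YW v w k)"
    and hom_YW_right: "module_hom (hscale scW) (hscale scW) (\<lambda>w. YW v w k)"
    and YW_vac: "YW (\<pi> 1) w k = (if k = 0 then w else 0)"
    and local: "sigma_local scW \<sigma> YW"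
    and small: "n > 0 \<Longrightarrow> YW (\<pi> (gen (Tgen False i j 0))) w (- int n) \<in> hpow (b * n)"
    and parity: "(i = j) \<noteq> even m \<Longrightarrow> YW (\<pi> (gen (Tgen False i j 0))) w (- m) = 0"
begin

text \<open>The coefficient of z^k in the entry ij of L(z)_W. Passing to Y_W(., z^2) replaces
  z^{1/2} by z, so the half-power index of \<open>YW\<close> is the exponent k unchanged.\<close>

definition L_op :: "bool \<Rightarrow> bool \<Rightarrow> int \<Rightarrow> 'w fps \<Rightarrow> 'w fps" where
  "L_op i j k w = YW (\<pi> (t_coeff False i j 0)) w k"

lemma L_op_eq:
  "L_op i j k w = (if i = j \<and> k = 0 then w else 0) - YW (\<pi> (gen (Tgen False i j 0))) w k"
proof -
  have "YW (\<pi> (x - y)) w k = YW (\<pi> x) w k - YW (\<pi> y) w k" for x y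
    by (simp add: module_hom.diff[OF hom_pi] module_hom.diff[OF hom_YW])
  moreover have "YW (\<pi> 0) w k = 0"
    by (simp add: module_hom.zero[OF hom_pi] module_hom.zero[OF hom_YW])
  ultimately show ?thesis
    by (simp add: L_op_def t_coeff_def YW_vac)
qed

lemma hom_L_op: "module_hom (hscale scW) (hscale scW) (L_op i j k)"
  unfolding L_op_def by (rule hom_YW_right)

text \<open>The smallness hypothesis in the form used for convergence: the bound on k does not
  depend on w. The strict inequality keeps k negative, away from the Kronecker delta.\<close>

lemma L_op_hpow:
  assumes "k < - int n"
  shows "L_op i j k w \<in> hpow n"
proof -
  have "YW (\<pi> (gen (Tgen False i j 0))) w (- int (nat (- k))) \<in> hpow (b * nat (- k))"
    using assms by (intro small) auto
  moreover have "n \<le> b * nat (- k)"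
  proof -
    have "n \<le> nat (- k)" using assms by linarith
    also have "\<dots> \<le> b * nat (- k)" using b by (cases b) auto
    finally show ?thesis .
  qed
  ultimately have "YW (\<pi> (gen (Tgen False i j 0))) w k \<in> hpow n"
    using assms by (auto intro: hpow_antimono)
  then show ?thesis
    using assms by (simp add: L_op_eq hpow_minus)
qed

text \<open>Here the operator with variable z_1 acts last, on vectors that vary with l, so
  uniformity in the vector is essential. When it acts first, linearity of the outer operator
  preserves the bound.\<close>

lemma tame_L_op_left: "tame (\<lambda>k l. L_op i j k (Z l))"
  unfolding tame_def using L_op_hpow by blast

lemma tame_L_op_right: "tame (\<lambda>k l. L_op i j l (L_op i' j' k w))"
  unfolding tame_def using L_op_hpow hom_hpow[OF hom_L_op module_axioms module_axioms] by blast

lemma YW_YW_conv_lin_ext: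
  "YW_YW scW YW s w k l =
    lin_ext scW (\<lambda>(i, j). YW (fps_const (Poly_Mapping.single i 1)) (YW (fps_const (Poly_Mapping.single j 1)) w l) k) s"
  by (simp add: YW_YW_def lin_ext_def case_prod_unfold)

lemma hom_YW_YW: "module_hom (hscale pscale) (hscale scW) (\<lambda>s. YW_YW scW YW s w k l)"
  unfolding YW_YW_conv_lin_ext by (rule module_hom_lin_ext)

text \<open>\<open>YW_YW\<close> is given by its values on a basis; linearity in each argument in
  turn carries the formula to all pure tensors.\<close>

lemma YW_YW_htensor: "YW_YW scW YW (htensor u v) w k l = YW u (YW v w l) k"
proof (rule hom_eqI[where f = "\<lambda>u. YW_YW scW YW (htensor u v) w k l"])
  show "module_hom (hscale pscale) (hscale scW) (\<lambda>u. YW_YW scW YW (htensor u v) w k l)"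
    by (intro module_homI module.module_hscale module_pscale module_hscale)
      (simp_all only: module_hom.add[OF module_hom_htensor(1)] module_hom.scale[OF module_hom_htensor(1)]
        module_hom.add[OF hom_YW_YW] module_hom.scale[OF hom_YW_YW])
  show "module_hom (hscale pscale) (hscale scW) (\<lambda>u. YW u (YW v w l) k)" by (rule hom_YW)
  show "module scW" by (rule module_axioms)
  fix i
  let ?e = "fps_const (Poly_Mapping.single i 1) :: 'i hfree"
  show "YW_YW scW YW (htensor ?e v) w k l = YW ?e (YW v w l) k"
  proof (rule hom_eqI[where f = "\<lambda>v. YW_YW scW YW (htensor ?e v) w k l"])
    show "module_hom (hscale pscale) (hscale scW) (\<lambda>v. YW_YW scW YW (htensor ?e v) w k l)"
      by (intro module_homI module.module_hscale module_pscale module_hscale)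
        (simp_all only: module_hom.add[OF module_hom_htensor(2)] module_hom.scale[OF module_hom_htensor(2)]
          module_hom.add[OF hom_YW_YW] module_hom.scale[OF hom_YW_YW])
    show "module_hom (hscale pscale) (hscale scW) (\<lambda>v. YW ?e (YW v w l) k)"
      by (rule hom_compose[OF hom_YW_right hom_YW])
    show "module scW" by (rule module_axioms)
    show "YW_YW scW YW (htensor ?e (fps_const (Poly_Mapping.single j 1))) w k l =
        YW ?e (YW (fps_const (Poly_Mapping.single j 1)) w l) k" for j
      by (simp add: htensor_single YW_YW_conv_lin_ext lin_ext_single)
  qed
qed

text \<open>The entries with row A and column B of L_1(z_1) L_2(z_2); \<open>LL_opp\<close> has them
  for L_2(z_2) L_1(z_1).\<close>

definition LL :: "'w fps \<Rightarrow> bool list \<Rightarrow> bool list \<Rightarrow> int \<Rightarrow> int \<Rightarrow> 'w fps" where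
  "LL w A B k l = L_op (A ! 0) (B ! 0) k (L_op (A ! 1) (B ! 1) l w)"

definition LL_opp :: "'w fps \<Rightarrow> bool list \<Rightarrow> bool list \<Rightarrow> int \<Rightarrow> int \<Rightarrow> 'w fps" where
  "LL_opp w A B k l = L_op (A ! 1) (B ! 1) l (L_op (A ! 0) (B ! 0) k w)"

lemma tame_LL: "tame (LL w A B)" and tame_LL_opp: "tame (LL_opp w A B)"
  unfolding LL_def LL_opp_def by (rule tame_L_op_left tame_L_op_right)+

definition Rm :: "bool list \<Rightarrow> bool list \<Rightarrow> complex fls fps" where
  "Rm I J = R_ell a b (I ! 0) (I ! 1) (J ! 0) (J ! 1)"

definition Rm_inv :: "bool list \<Rightarrow> bool list \<Rightarrow> complex fls fps" where
  "Rm_inv I J = expand_h (R_rat_inv a b I J)"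

lemma Rm_inv_left:
  assumes "I \<in> idx 2" "J \<in> idx 2"
  shows "(\<Sum>K\<in>idx 2. Rm_inv I K * Rm K J) = (if I = J then 1 else 0)"
proof -
  have "expand_h (\<Sum>K\<in>idx 2. R_rat_inv a b I K * R_rat a b (K ! 0) (K ! 1) (J ! 0) (J ! 1)) =
      expand_h (if I = J then 1 else 0)"
    using R_rat_inv_left[OF b assms, of a] by (rule arg_cong)
  then show ?thesis
    by (simp add: expand_h_sum expand_h_mult expand_h_delta expand_h_R_rat b Rm_def Rm_inv_def)
qed

text \<open>Locality gives \<open>R L_1 L_2 R^{-1} = L_2 L_1\<close>: the factor \<open>(z_1^2 - z_2^2)^r\<close> can be cancelled, as
  both sides are tame.\<close>

lemma R_conjugation:
  assumes I: "I \<in> idx 2" "J \<in> idx 2"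
  shows "(\<Sum>A\<in>idx 2. \<Sum>B\<in>idx 2. diag_act (Rm I A * Rm_inv B J) (LL w A B) k l) = LL_opp w I J k l"
proof -
  let ?t = "\<lambda>i j. \<pi> (t_coeff False i j 0)"
  define G where "G = (\<lambda>(A, B). Rm I A * Rm_inv B J)"
  define X where "X = (\<lambda>(A, B). LL w A B)"
  let ?S = "idx 2 \<times> idx 2"
  define D where "D k l = (\<Sum>p\<in>?S. diag_act (G p) (X p) k l) - LL_opp w I J k l" for k l
  have fin: "finite ?S" using finite_idx_2 by simp
  have X: "tame (X p)" for p by (cases p) (simp add: X_def tame_LL)
  have J_eq: "[J ! 0, J ! Suc 0] = J" using I by (auto simp: idx_2)
  have YW_YW: "YW_YW scW YW (subst_coeff fls_X (\<sigma> (htensor (?t (I ! 0) (J ! 0)) (?t (I ! 1) (J ! 1)))) j) w =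
      (\<lambda>k l. \<Sum>p\<in>?S. hscale scW (lcoeff (G p) j) (X p k l))" for j
  proof (intro ext)
    fix k l
    have "YW_YW scW YW (subst_coeff fls_X (\<sigma> (htensor (?t (I ! 0) (J ! 0)) (?t (I ! 1) (J ! 1)))) j) w k l =
        (\<Sum>A\<in>idx 2. \<Sum>B\<in>idx 2. hscale scW (lcoeff (G (A, B)) j) (X (A, B) k l))"
      by (simp add: sigma_generators[OF b sigma] subst_coeff_sum subst_coeff_hscale_base_ext
          module_hom.sum[OF hom_YW_YW] module_hom.scale[OF hom_YW_YW] YW_YW_htensor J_eq
          expand_h_mult expand_h_R_rat b G_def X_def LL_def L_op_def Rm_def Rm_inv_def)
    then show "YW_YW scW YW (subst_coeff fls_X (\<sigma> (htensor (?t (I ! 0) (J ! 0)) (?t (I ! 1) (J ! 1)))) j) w k l =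
        (\<Sum>p\<in>?S. hscale scW (lcoeff (G p) j) (X p k l))"
      by (simp add: sum.cartesian_product case_prod_unfold)
  qed
  have D: "tame D"
    unfolding D_def by (intro tame_diff tame_sum fin tame_diag_act X tame_LL_opp)
  have "D k l \<in> hpow n" for n
  proof -
    \<comment> \<open>Locality is available for positive exponents only, hence \<open>Suc n\<close>.
      The r obtained depends on n but disappears in the cancellation.\<close>
    obtain r where r: "\<And>w k l. let P = (\<lambda>j. mult_diff scW r
                   (YW_YW scW YW (subst_coeff fls_X (\<sigma> (htensor (?t (I ! 0) (J ! 0)) (?t (I ! 1) (J ! 1)))) j) w) (k - j) (l + j))
        in (\<forall>N<Suc n. finite {j. fps_nth (P j) N \<noteq> 0}) \<and>
           hsum P - mult_diff scW r (\<lambda>k l. YW (?t (I ! 1) (J ! 1)) (YW (?t (I ! 0) (J ! 0)) w k) l) k l \<in> hpow (Suc n)"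
      using local unfolding sigma_local_def by blast
    have "mult_diff scW r D k l \<in> hpow (Suc n)" for k l
    proof -
      have "hsum (\<lambda>j. mult_diff scW r (\<lambda>k l. \<Sum>p\<in>?S. hscale scW (lcoeff (G p) j) (X p k l)) (k - j) (l + j)) -
          mult_diff scW r (LL_opp w I J) k l \<in> hpow (Suc n)"
        using r[of w k l] unfolding Let_def YW_YW LL_opp_def[abs_def] L_op_def by blast
      then show ?thesis
        unfolding D_def mult_diff_diff by (simp only: hsum_mult_diff[OF fin X])
    qed
    then have "D k l \<in> hpow (Suc n)" by (rule tame_mult_diff_cancel[OF D])
    then show ?thesis by (rule hpow_antimono[rotated]) simp
  qed
  then have "D k l = 0" by (rule hpow_all_imp_0)
  then show ?thesis
    by (simp add: D_def G_def X_def sum.cartesian_product case_prod_unfold)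
qed

text \<open>The entries of R are scalar series in z_1/z_2 and commute. Tameness allows the factor
  coming from the right multiplication to be moved next to the inverse of R, where the two contract
  to the identity.\<close>

lemma RLL:
  assumes I: "I \<in> idx 2" "K \<in> idx 2"
  shows "(\<Sum>A\<in>idx 2. diag_act (Rm I A) (LL w A K) k l) = (\<Sum>J\<in>idx 2. diag_act (Rm J K) (LL_opp w I J) k l)"
proof -
  have swap: "(\<Sum>J\<in>S. \<Sum>A\<in>S. \<Sum>B\<in>S. f J A B) = (\<Sum>A\<in>S. \<Sum>B\<in>S. \<Sum>J\<in>S. f J A B)"
    for f :: "bool list \<Rightarrow> bool list \<Rightarrow> bool list \<Rightarrow> 'w fps" and S
  proof -
    have "(\<Sum>J\<in>S. \<Sum>A\<in>S. \<Sum>B\<in>S. f J A B) = (\<Sum>A\<in>S. \<Sum>J\<in>S. \<Sum>B\<in>S. f J A B)"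
      by (rule sum.swap)
    also have "\<dots> = (\<Sum>A\<in>S. \<Sum>B\<in>S. \<Sum>J\<in>S. f J A B)"
      by (intro sum.cong refl sum.swap)
    finally show ?thesis .
  qed
  have "(\<Sum>J\<in>idx 2. diag_act (Rm J K) (LL_opp w I J) k l) =
      (\<Sum>J\<in>idx 2. diag_act (Rm J K) (\<lambda>k l. \<Sum>A\<in>idx 2. \<Sum>B\<in>idx 2. diag_act (Rm I A * Rm_inv B J) (LL w A B) k l) k l)"
  proof (intro sum.cong refl)
    fix J :: "bool list" assume "J \<in> idx 2"
    then have "LL_opp w I J = (\<lambda>k l. \<Sum>A\<in>idx 2. \<Sum>B\<in>idx 2. diag_act (Rm I A * Rm_inv B J) (LL w A B) k l)"
      using I by (simp add: R_conjugation fun_eq_iff)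
    then show "diag_act (Rm J K) (LL_opp w I J) k l =
        diag_act (Rm J K) (\<lambda>k l. \<Sum>A\<in>idx 2. \<Sum>B\<in>idx 2. diag_act (Rm I A * Rm_inv B J) (LL w A B) k l) k l"
      by (simp only:)
  qed
  also have "\<dots> = (\<Sum>J\<in>idx 2. \<Sum>A\<in>idx 2. \<Sum>B\<in>idx 2. diag_act (Rm J K * (Rm I A * Rm_inv B J)) (LL w A B) k l)"
    by (simp add: diag_act_sum_right diag_act_mult tame_sum finite_idx_2 tame_diag_act tame_LL)
  also have "\<dots> = (\<Sum>A\<in>idx 2. \<Sum>B\<in>idx 2. \<Sum>J\<in>idx 2. diag_act (Rm I A * (Rm_inv B J * Rm J K)) (LL w A B) k l)"
    by (subst swap) (simp only: mult_ac)
  also have "\<dots> = (\<Sum>A\<in>idx 2. \<Sum>B\<in>idx 2. diag_act (Rm I A * (\<Sum>J\<in>idx 2. Rm_inv B J * Rm J K)) (LL w A B) k l)"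
    by (simp add: diag_act_sum_left[symmetric] tame_LL sum_distrib_left)
  also have "\<dots> = (\<Sum>A\<in>idx 2. \<Sum>B\<in>idx 2. if B = K then diag_act (Rm I A) (LL w A B) k l else 0)"
    by (intro sum.cong refl) (simp add: Rm_inv_left I diag_act_0)
  also have "\<dots> = (\<Sum>A\<in>idx 2. diag_act (Rm I A) (LL w A K) k l)"
    using finite_idx_2 I by simp
  finally show ?thesis ..
qed

section \<open>Division by powers of -p^{1/2} and the action of the generators\<close>

lemma minus_p_half_power: "(- p_half a b) ^ m = fps_const (complex_of_real ((- sqrt a) ^ m)) * fps_X ^ (b * m)"
proof -
  have "- p_half a b = fps_const (complex_of_real (- sqrt a)) * fps_X ^ b"
    by (simp add: p_half_def flip: fps_const_neg)
  then show ?thesis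
    by (simp add: power_mult_distrib power_mult fps_const_power del: fps_const_neg)
qed

lemma hscale_p_half_cancel: "hscale scW ((- p_half a b) ^ m) x = hscale scW ((- p_half a b) ^ m) y \<Longrightarrow> x = y"
  unfolding minus_p_half_power
  by (rule hscale_monom_cancel[OF vector_space]) (use a in auto)

text \<open>Up to the nonzero constant (-sqrt a)^m, the power (-p^{1/2})^m is h^(bm), so for m > 0
  the smallness hypothesis is exactly divisibility by it. The quotients are only chosen here; their
  linearity follows from cancellation.\<close>

lemma lbar_ops:
  obtains op where
    "\<And>i j m w. hscale scW ((- p_half a b) ^ nat (max m 0)) (op (Lbar i j m) w) = YW (\<pi> (gen (Tgen False i j 0))) w (- m)"
proof -
  interpret h: module "hscale scW" by (rule module_hscale)
  have "\<exists>x. hscale scW ((- p_half a b) ^ nat (max m 0)) x = YW (\<pi> (gen (Tgen False i j 0))) w (- m)" for i j m w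
  proof (cases "m > 0")
    case True
    define c where "c = complex_of_real ((- sqrt a) ^ nat m)"
    let ?y = "YW (\<pi> (gen (Tgen False i j 0))) w (- m)"
    have "c \<noteq> 0" using a by (simp add: c_def)
    have "?y \<in> hpow (b * nat m)" using small[of "nat m" i j w] True by simp
    then have "hscale scW (fps_X ^ (b * nat m)) (fps_shift (b * nat m) ?y) = ?y"
      using hpow_conv_hscale by metis
    moreover have "fps_const (inverse c) * (fps_const c * fps_X ^ (b * nat m)) = fps_X ^ (b * nat m)"
      using \<open>c \<noteq> 0\<close> by (simp add: mult.assoc[symmetric])
    ultimately have "hscale scW (fps_const (inverse c) * (fps_const c * fps_X ^ (b * nat m))) (fps_shift (b * nat m) ?y) = ?y"
      by (simp only:)
    then have "hscale scW (fps_const c * fps_X ^ (b * nat m)) (hscale scW (fps_const (inverse c)) (fps_shift (b * nat m) ?y)) = ?y"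
      by (simp only: h.scale_scale mult.commute)
    moreover have "(- p_half a b) ^ nat (max m 0) = fps_const c * fps_X ^ (b * nat m)"
    proof -
      have "max m 0 = m" using True by simp
      then show ?thesis unfolding c_def by (simp only: minus_p_half_power)
    qed
    ultimately have "hscale scW ((- p_half a b) ^ nat (max m 0))
        (hscale scW (fps_const (inverse c)) (fps_shift (b * nat m) ?y)) = ?y"
      by (simp only:)
    then show ?thesis by (rule exI)
  qed (auto intro!: exI[of _ "YW (\<pi> (gen (Tgen False i j 0))) w (- m)"])
  note ex = this
  define f where "f i j m w = (SOME x. hscale scW ((- p_half a b) ^ nat (max m 0)) x =
      YW (\<pi> (gen (Tgen False i j 0))) w (- m))" for i j m w
  have "hscale scW ((- p_half a b) ^ nat (max m 0)) (f i j m w) = YW (\<pi> (gen (Tgen False i j 0))) w (- m)" for i j m w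
    unfolding f_def by (rule someI_ex[OF ex])
  then show ?thesis
    by (intro that[of "\<lambda>g. case g of Lbar i j m \<Rightarrow> f i j m"]) simp
qed

text \<open>The powers of p^{1/2} built into the generators give the free algebra the same one-sided
  bound as W. The sums in \<open>RLL_rel\<close> thus converge before anything acts.\<close>

lemma L_coeff_hpow:
  assumes "k < - int n"
  shows "L_coeff a b i j k \<in> hpow n"
proof -
  interpret P: module "pscale :: complex \<Rightarrow> (lgen monom_word \<Rightarrow>\<^sub>0 complex) \<Rightarrow> _" by (rule module_pscale)
  have "p_half a b \<in> hpow 1" using b hpow_antimono[OF _ hpow_p_half] by simp
  then have "(- p_half a b) ^ nat (max (- k) 0) \<in> hpow (1 * nat (max (- k) 0))"
    by (intro hpow_power hpow_minus)
  then have "(- p_half a b) ^ nat (max (- k) 0) \<in> hpow n"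
    by (rule hpow_antimono[rotated]) (use assms in linarith)
  then show ?thesis
    using assms by (simp add: L_coeff_def hpow_minus P.hpow_hscale_left)
qed

lemma RLL_rel_act:
  assumes act: "\<And>w. module_hom (hscale pscale) (hscale scW) (\<lambda>x. act x w)"
    and mult: "\<And>x y w. act (x * y) w = act x (act y w)"
    and L: "\<And>i j k w. act (L_coeff a b i j k) w = L_op i j k w"
  shows "act (RLL_rel a b i1 i2 j1 j2 k l) w = 0"
proof -
  \<comment> \<open>The free algebra is itself an instance, so the summability results proved for W
    apply to the sums in \<open>RLL_rel\<close>.\<close>
  interpret P: complex_module "pscale :: complex \<Rightarrow> (lgen monom_word \<Rightarrow>\<^sub>0 complex) \<Rightarrow> _"
    unfolding complex_module_def by (rule module_pscale)
  have tame1: "tame (\<lambda>k l. L_coeff a b x j1 k * L_coeff a b y j2 l)" for x y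
    unfolding tame_def using L_coeff_hpow hpow_mult_right by blast
  have tame2: "tame (\<lambda>k l. L_coeff a b i2 y l * L_coeff a b i1 x k)" for x y
    unfolding tame_def using L_coeff_hpow hpow_mult_left by blast
  have summable: "hsummable (\<lambda>n. hscale scW (lcoeff (R_ell a b i1 i2 x y) n) (L_op x j1 (k - n) (L_op y j2 (l + n) w)))"
      "hsummable (\<lambda>n. hscale scW (lcoeff (R_ell a b x y j1 j2) n) (L_op i2 y (l + n) (L_op i1 x (k - n) w)))" for x y
    using hsummable_diag_act[OF tame_L_op_left[of x j1 "\<lambda>l. L_op y j2 l w"]]
      hsummable_diag_act[OF tame_L_op_right] by blast+
  have "act (RLL_rel a b i1 i2 j1 j2 k l) w =
      hsum (\<lambda>n. \<Sum>x\<in>UNIV. \<Sum>y\<in>UNIV. hscale scW (lcoeff (R_ell a b i1 i2 x y) n)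
          (L_op x j1 (k - n) (L_op y j2 (l + n) w))) -
      hsum (\<lambda>n. \<Sum>x\<in>UNIV. \<Sum>y\<in>UNIV. hscale scW (lcoeff (R_ell a b x y j1 j2) n)
          (L_op i2 y (l + n) (L_op i1 x (k - n) w)))"
    unfolding RLL_rel_def
    by (simp add: module_hom.diff[OF act] module_hom.sum[OF act] module_hom.scale[OF act] mult L
        hom_hsum[OF act module_pscale module_axioms] hsummable_sum P.hsummable_diag_act[OF tame1]
        P.hsummable_diag_act[OF tame2])
  also have "\<dots> = (\<Sum>x\<in>UNIV. \<Sum>y\<in>UNIV. diag_act (R_ell a b i1 i2 x y) (\<lambda>k l. L_op x j1 k (L_op y j2 l w)) k l) -
      (\<Sum>x\<in>UNIV. \<Sum>y\<in>UNIV. diag_act (R_ell a b x y j1 j2) (\<lambda>k l. L_op i2 y l (L_op i1 x k w)) k l)"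
    unfolding diag_act_def
    by (simp add: hsum_sum hsummable_sum summable)
  also have "\<dots> = 0"
  proof -
    have "[x, y] \<in> idx 2" for x y by (simp add: idx_def)
    from RLL[OF this[of i1 i2] this[of j1 j2], of w k l] show ?thesis
      by (simp add: sum_idx_2 LL_def[abs_def] LL_opp_def[abs_def] Rm_def)
  qed
  finally show ?thesis .
qed

text \<open>The Kronecker deltas on both sides cancel. What remains is the equation that defines the
  quotients, at m = -k.\<close>

lemma act_L_coeff_iff:
  assumes "module_structure scW rels act"
  shows "act (L_coeff a b i j k) w = L_op i j k w \<longleftrightarrow>
    hscale scW ((- p_half a b) ^ nat (max (- k) 0)) (act (gen (Lbar i j (- k))) w) =
      YW (\<pi> (gen (Tgen False i j 0))) w k"
proof -
  have act: "module_hom (hscale pscale) (hscale scW) (\<lambda>x. act x w)" and one: "act 1 w = w"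
    using assms by (simp_all add: module_structure_def)
  show ?thesis
    by (simp add: L_op_eq L_coeff_def module_hom.diff[OF act] module_hom.scale[OF act] module_hom.zero[OF act] one)
qed

theorem module_structure_ex1:
  "\<exists>!act. module_structure scW (A_rels a b) act \<and> (\<forall>i j k w. act (L_coeff a b i j k) w = L_op i j k w)"
proof -
  interpret h: module "hscale scW" by (rule module_hscale)
  obtain op where op: "\<And>i j m w. hscale scW ((- p_half a b) ^ nat (max m 0)) (op (Lbar i j m) w) =
      YW (\<pi> (gen (Tgen False i j 0))) w (- m)"
    using lbar_ops by blast
  have hom_op: "module_hom (hscale scW) (hscale scW) (op g)" for g
  proof (cases g)
    case (Lbar i j m)
    \<comment> \<open>The chosen quotients become linear after multiplication by the power of
      -p^{1/2}, which is injective on W.\<close>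
    show ?thesis
    proof (rule module_homI[OF module_hscale module_hscale]; rule hscale_p_half_cancel[of "nat (max m 0)"])
      show "hscale scW ((- p_half a b) ^ nat (max m 0)) (op g (x + y)) =
          hscale scW ((- p_half a b) ^ nat (max m 0)) (op g x + op g y)" for x y
        by (simp only: Lbar op h.scale_right_distrib module_hom.add[OF hom_YW_right])
      show "hscale scW ((- p_half a b) ^ nat (max m 0)) (op g (hscale scW c x)) =
          hscale scW ((- p_half a b) ^ nat (max m 0)) (hscale scW c (op g x))" for c x
        by (simp only: Lbar op h.scale_left_commute[of _ c] module_hom.scale[OF hom_YW_right])
    qed
  qed
  \<comment> \<open>With no relations imposed the free algebra already acts; this is needed to
    evaluate \<open>L_coeff\<close>, and hence the relations.\<close>
  have free: "module_structure scW {} (free_act op)"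
    by (rule module_structure_free_act[OF hom_op]) simp
  have gen: "free_act op (gen g) w = op g w" for g w
    by (simp add: gen_def free_act_word)
  have L: "free_act op (L_coeff a b i j k) w = L_op i j k w" for i j k w
    by (simp add: act_L_coeff_iff[OF free] gen op)
  have "free_act op x w = 0" if x: "x \<in> A_rels a b" for x w
  proof -
    consider i j n where "x = gen (Lbar i j n)" "(i = j) \<noteq> even n"
      | i1 i2 j1 j2 k l where "x = RLL_rel a b i1 i2 j1 j2 k l"
      using x unfolding A_rels_def by (elim UnE CollectE exE conjE) simp_all
    then show ?thesis
    proof cases
      case 1
      \<comment> \<open>Parity kills the coefficient of Y_W, that is, the operator multiplied by a
        power of -p^{1/2}; cancellation kills the operator.\<close>
      have "hscale scW ((- p_half a b) ^ nat (max n 0)) (op (Lbar i j n) w) =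
          hscale scW ((- p_half a b) ^ nat (max n 0)) 0"
        using parity[OF 1(2)] by (simp add: op)
      then show ?thesis
        unfolding 1(1) gen by (rule hscale_p_half_cancel)
    next
      case 2
      show ?thesis
        unfolding 2 by (rule RLL_rel_act) (use free L in \<open>simp_all add: module_structure_def\<close>)
    qed
  qed
  then have str: "module_structure scW (A_rels a b) (free_act op)"
    by (intro module_structure_free_act hom_op)
  show ?thesis
  proof (rule ex1I[of _ "free_act op"])
    show "module_structure scW (A_rels a b) (free_act op) \<and>
        (\<forall>i j k w. free_act op (L_coeff a b i j k) w = L_op i j k w)"
      using str L by blast
    fix act assume act: "module_structure scW (A_rels a b) act \<and>
        (\<forall>i j k w. act (L_coeff a b i j k) w = L_op i j k w)"
    show "act = free_act op"
    proof (rule module_structure_eqI[OF conjunct1[OF act] str])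
      fix g w
      obtain i j m where g: "g = Lbar i j m" by (cases g)
      have "hscale scW ((- p_half a b) ^ nat (max m 0)) (act (gen g) w) =
          hscale scW ((- p_half a b) ^ nat (max m 0)) (free_act op (gen g) w)"
        using act act_L_coeff_iff[OF conjunct1[OF act], of i j "- m" w] by (simp add: g gen op)
      then show "act (gen g) w = free_act op (gen g) w" by (rule hscale_p_half_cancel)
    qed
  qed
qed

end

text \<open>Apart from the constant, \<open>L_coeff\<close> contains a generator multiplied by a
  power of -p^{1/2}, so prescribing its action amounts to a division in W. The quantifier
  \<open>\<exists>!\<close> records that the division is possible, compatible with the relations,
  and has a single outcome.\<close>

theorem theorem6p7:
  fixes a :: real and b :: nat and c :: complex
    and \<pi> :: "tgen falg \<Rightarrow> 'i hfree"
    and Tm Ti :: "bool \<Rightarrow> bool \<Rightarrow> bool \<Rightarrow> 'i hfree \<Rightarrow> int \<Rightarrow> 'i hfree"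
    and Y :: "('i \<times> 'i) hfree \<Rightarrow> int \<Rightarrow> 'i hfree"
    and \<sigma> \<rho> :: "('i \<times> 'i) hfree \<Rightarrow> ('i \<times> 'i \<Rightarrow>\<^sub>0 ratfun) fps"
    and \<tau> :: "'i hfree \<Rightarrow> 'i hfree"
    and scW :: "complex \<Rightarrow> 'w \<Rightarrow> 'w::ab_group_add"
    and YW :: "'i hfree \<Rightarrow> 'w fps \<Rightarrow> int \<Rightarrow> 'w fps"
  assumes "a > 0" and "b > 0"
    and "presents (U_rels a b) \<pi>"
    and "is_Tminus a b c \<pi> Tm" and "is_op_inverse Tm Ti"
    and "is_vertex_operator c \<pi> Ti Y"
    and "is_sigma a b \<pi> \<sigma>" and "is_rho a b c \<pi> \<rho>" and "is_tau \<pi> \<tau>"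
    and "deformed_module scW \<pi> Y \<sigma> \<rho> \<tau> YW"
    and "\<forall>i j n w. n > 0 \<longrightarrow> YW (\<pi> (gen (Tgen False i j 0))) w (- int n) \<in> hpow (b * n)"
    and "\<forall>i j n w. (i = j) \<noteq> even n \<longrightarrow> YW (\<pi> (gen (Tgen False i j 0))) w (- n) = 0"
  shows "\<exists>!act. module_structure scW (A_rels a b) act \<and>
           (\<forall>i j k w. act (L_coeff a b i j k) w = YW (\<pi> (t_coeff False i j 0)) w k)"
proof -
  have "vector_space scW" using assms(10) by (simp add: deformed_module_def)
  then interpret vs: vector_space scW .
  interpret deformed_rep scW a b \<pi> \<sigma> YW
    by (intro deformed_rep.intro complex_module.intro deformed_rep_axioms.intro vs.module_axioms)
      (use assms in \<open>simp_all add: deformed_module_def presents_def\<close>)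
  show ?thesis
    using module_structure_ex1 by (simp only: L_op_def)
qed

end
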